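(* Let $H$ be a finitely generated subgroup of $G=\mathbb{Z}^m\times F_n$, let $\pi\colon G\to F_n$ be the natural projection, and suppose that $H\pi$ is not cyclic and $H\pi\not\leqslant[F_n,F_n]$. Let $L_H=H\cap\mathbb{Z}^m$. (i) If $[\mathbb{Z}^m:L_H]=\infty$, then $\mathrm{di}'_G(H)=\infty$. (ii) If $[\mathbb{Z}^m:L_H]=l<\infty$, then $\mathrm{di}'_G(H)=l\cdot\mathrm{di}'_{F_n}(H\pi)$.
   Context: $F_n$ is the free group of rank $n$. For a group $G$, $\mathrm r(G)$ is the rank (minimum cardinality of a generating set) and $\tilde{\mathrm r}(G)=\max\{0,\mathrm r(G)-1\}$ is the reduced rank. Arguments of maps are written on the left, so $H\pi$ is the image of $H$. Restricted degree of inertia: let $G$ be a group and $\pi\colon G\to G/Z(G)$ the projection modulo its center. Let $H$ be a finitely generated subgroup of $G$ such that $H\pi$ is not virtually cyclic and $H\pi\not\leqslant[G\pi,G\pi]$. Then $\mathrm{di}'_G(H)=\sup_K\{\tilde{\mathrm r}(H\cap K)/\tilde{\mathrm r}(K)\}$, where $K$ runs over all finitely generated subgroups of $G$ such that $H\cap K$ is finitely generated, $[H\pi:H\pi\cap K\pi]=\infty$, and $H\pi\cap K\pi\not\leqslant[G\pi,G\pi]$; here $0/0$ is understood to be $1$. Since $H\pi$ is not cyclic, $n\geqslant 2$. For $G=\mathbb{Z}^m\times F_n$ with $n\geqslant2$ the center is $\mathbb{Z}^m$ and the projection modulo the center is the natural projection $\pi\colon G\to F_n$; for $G=F_n$ with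 $n\geqslant 2$ the center is trivial and the projection is the identity. *)

theory Defs
  imports
    "HOL-Algebra.Algebra"
    "HOL-Library.Extended_Nat"
    "HOL-Library.Extended_Nonnegative_Real"
begin

section \<open>The groups \<open>F\<^sub>n\<close> and \<open>\<int>\<^sup>m\<close>\<close>

text \<open>
  The free group of rank \<open>n\<close> on the letters \<open>0, \<dots>, n - 1\<close>, realised on reduced words.  The pair
  \<open>(i, True)\<close> stands for the \<open>i\<close>-th free generator and \<open>(i, False)\<close> for its inverse.  The product of
  two reduced words is their concatenation followed by free reduction: \<open>cons_red\<close> prepends one
  letter to a reduced word and cancels it against the first letter if possible.
\<close>

type_synonym letter = "nat \<times> bool"

definition letter_inv :: "letter \<Rightarrow> letter" where
  "letter_inv x = (fst x, \<not> snd x)"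

definition reduced :: "letter list \<Rightarrow> bool" where
  "reduced w \<longleftrightarrow> successively (\<lambda>x y. y \<noteq> letter_inv x) w"

definition cons_red :: "letter \<Rightarrow> letter list \<Rightarrow> letter list" where
  "cons_red x w =
     (case w of [] \<Rightarrow> [x] | y # ys \<Rightarrow> if y = letter_inv x then ys else x # w)"

definition free_group :: "nat \<Rightarrow> letter list monoid" where
  "free_group n =
     \<lparr>carrier = {w. reduced w \<and> set w \<subseteq> {..<n} \<times> UNIV}, monoid.mult = foldr cons_red, one = []\<rparr>"

definition Z_power :: "nat \<Rightarrow> (nat \<Rightarrow> int) monoid" where
  "Z_power m = product_group {..<m} (\<lambda>_. integer_group)"

section \<open>Rank, index, center\<close>

text \<open>
  A subgroup \<open>H\<close> of \<open>G\<close> is regarded as a group in its own right as \<open>G\<lparr>carrier := H\<rparr>\<close>.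
\<close>

definition finitely_generated :: "('a, 'b) monoid_scheme \<Rightarrow> bool" where
  "finitely_generated G \<longleftrightarrow>
     (\<exists>S. S \<subseteq> carrier G \<and> finite S \<and> generate G S = carrier G)"

text \<open>Only meaningful for finitely generated groups, the only ones it is applied to below.\<close>

definition group_rank :: "('a, 'b) monoid_scheme \<Rightarrow> nat" where
  "group_rank G =
     (LEAST k. \<exists>S. S \<subseteq> carrier G \<and> finite S \<and> card S = k \<and> generate G S = carrier G)"

text \<open>Truncated subtraction on \<^typ>\<open>nat\<close> provides the maximum with \<open>0\<close>.\<close>

definition reduced_rank :: "('a, 'b) monoid_scheme \<Rightarrow> nat" where
  "reduced_rank G = group_rank G - 1"

definition subgroup_index :: "('a, 'b) monoid_scheme \<Rightarrow> 'a set \<Rightarrow> enat" where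
  "subgroup_index G H =
     (if finite (rcosets\<^bsub>G\<^esub> H) then enat (card (rcosets\<^bsub>G\<^esub> H)) else \<infinity>)"

definition virtually_cyclic :: "('a, 'b) monoid_scheme \<Rightarrow> bool" where
  "virtually_cyclic G \<longleftrightarrow>
     (\<exists>C. subgroup C G \<and> cyclic_group (G\<lparr>carrier := C\<rparr>) \<and> subgroup_index G C \<noteq> \<infinity>)"

definition center :: "('a, 'b) monoid_scheme \<Rightarrow> 'a set" where
  "center G = {z \<in> carrier G. \<forall>g \<in> carrier G. z \<otimes>\<^bsub>G\<^esub> g = g \<otimes>\<^bsub>G\<^esub> z}"

abbreviation center_quotient :: "('a, 'b) monoid_scheme \<Rightarrow> 'a set monoid" where
  "center_quotient G \<equiv> G Mod center G"

definition center_proj :: "('a, 'b) monoid_scheme \<Rightarrow> 'a \<Rightarrow> 'a set" where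
  "center_proj G g = center G #>\<^bsub>G\<^esub> g"

section \<open>The restricted degree of inertia\<close>

definition inertia_admissible :: "('a, 'b) monoid_scheme \<Rightarrow> 'a set \<Rightarrow> bool" where
  "inertia_admissible G H \<longleftrightarrow>
     subgroup H G \<and> finitely_generated (G\<lparr>carrier := H\<rparr>) \<and>
     \<not> virtually_cyclic ((center_quotient G)\<lparr>carrier := center_proj G ` H\<rparr>) \<and>
     \<not> center_proj G ` H \<subseteq> derived (center_quotient G) (carrier (center_quotient G))"

definition inertia_test_subgroups :: "('a, 'b) monoid_scheme \<Rightarrow> 'a set \<Rightarrow> 'a set set" where
  "inertia_test_subgroups G H = {K.
     subgroup K G \<and> finitely_generated (G\<lparr>carrier := K\<rparr>) \<and>
     finitely_generated (G\<lparr>carrier := H \<inter> K\<rparr>) \<and>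
     subgroup_index ((center_quotient G)\<lparr>carrier := center_proj G ` H\<rparr>)
       (center_proj G ` H \<inter> center_proj G ` K) = \<infinity> \<and>
     \<not> center_proj G ` H \<inter> center_proj G ` K
         \<subseteq> derived (center_quotient G) (carrier (center_quotient G))}"

text \<open>
  In \<^typ>\<open>ennreal\<close> we have \<open>0 / 0 = 0\<close>, whereas here \<open>0 / 0\<close> is \<open>1\<close>; \<open>a / 0 = \<infinity>\<close> for \<open>a > 0\<close>
  agrees with \<^typ>\<open>ennreal\<close>, but does not arise below, since subgroups of cyclic groups are cyclic.
\<close>

definition rank_ratio :: "nat \<Rightarrow> nat \<Rightarrow> ennreal" where
  "rank_ratio a b = (if a = 0 \<and> b = 0 then 1 else of_nat a / of_nat b)"

text \<open>\<open>di'\<^sub>G(H)\<close>, which is defined for admissible \<open>H\<close> only.\<close>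

definition restricted_inertia :: "('a, 'b) monoid_scheme \<Rightarrow> 'a set \<Rightarrow> ennreal" where
  "restricted_inertia G H =
     (if inertia_admissible G H
      then SUP K \<in> inertia_test_subgroups G H.
             rank_ratio (reduced_rank (G\<lparr>carrier := H \<inter> K\<rparr>)) (reduced_rank (G\<lparr>carrier := K\<rparr>))
      else undefined)"

section \<open>Basic facts\<close>

lemma letter_inv_invol [simp]: "letter_inv (letter_inv x) = x"
  by (simp add: letter_inv_def)

lemma fst_letter_inv [simp]: "fst (letter_inv x) = fst x"
  by (simp add: letter_inv_def)

lemma reduced_Nil [simp]: "reduced []"
  by (simp add: reduced_def)

lemma reduced_Cons:
  "reduced (x # w) \<longleftrightarrow> reduced w \<and> (w = [] \<or> hd w \<noteq> letter_inv x)"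
  by (cases w) (auto simp: reduced_def)

lemma reduced_cons_red: "reduced w \<Longrightarrow> reduced (cons_red x w)"
  by (cases w) (auto simp: cons_red_def reduced_Cons)

lemma reduced_foldr: "reduced v \<Longrightarrow> reduced (foldr cons_red u v)"
  by (induction u) (auto simp: reduced_cons_red)

lemma cons_red_cancel: "reduced w \<Longrightarrow> cons_red (letter_inv x) (cons_red x w) = w"
  by (cases w) (auto simp: cons_red_def reduced_Cons split: list.splits)

lemma cons_red_cancel': "reduced w \<Longrightarrow> cons_red x (cons_red (letter_inv x) w) = w"
  using cons_red_cancel[of w "letter_inv x"] by simp

lemma foldr_cons_red:
  assumes "reduced v"
  shows "foldr cons_red (cons_red x u) v = cons_red x (foldr cons_red u v)"
  using assms by (cases u) (auto simp: cons_red_def[of x "_ # _"] cons_red_def[of x "[]"]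
      cons_red_cancel' reduced_foldr)

lemma foldr_cons_red_assoc:
  "reduced w \<Longrightarrow>
     foldr cons_red (foldr cons_red u v) w = foldr cons_red u (foldr cons_red v w)"
  by (induction u) (auto simp: foldr_cons_red)

lemma foldr_cons_red_Nil: "reduced w \<Longrightarrow> foldr cons_red w [] = w"
  by (induction w) (auto simp: reduced_Cons cons_red_def split: list.splits)

lemma set_cons_red: "set (cons_red x w) \<subseteq> insert x (set w)"
  by (cases w) (auto simp: cons_red_def)

lemma set_foldr_cons_red: "set (foldr cons_red u v) \<subseteq> set u \<union> set v"
proof (induction u)
  case (Cons x u)
  show ?case using set_cons_red[of x "foldr cons_red u v"] Cons by auto
qed simp

lemma reduced_inverse: "reduced w \<Longrightarrow> reduced (rev (map letter_inv w))"
proof -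
  assume w: "reduced w"
  have "letter_inv y \<noteq> x" if "y \<noteq> letter_inv x" for x y
    using that by auto
  then have "successively (\<lambda>x y. x \<noteq> letter_inv y) (map letter_inv w)"
    using w unfolding reduced_def
    by (auto simp: successively_map elim!: successively_mono)
  then show ?thesis
    by (simp add: reduced_def)
qed

lemma foldr_inverse: "foldr cons_red (rev (map letter_inv w)) w = []"
  by (induction w) (auto simp: cons_red_def)

lemma group_free_group [simp]: "group (free_group n)"
proof (rule groupI)
  fix x assume x: "x \<in> carrier (free_group n)"
  then have "letter_inv ` set x \<subseteq> {..<n} \<times> UNIV" "reduced x"
    by (auto simp: free_group_def letter_inv_def)
  then have "rev (map letter_inv x) \<in> carrier (free_group n)"
    by (simp add: free_group_def reduced_inverse)
  moreover have "rev (map letter_inv x) \<otimes>\<^bsub>free_group n\<^esub> x = \<one>\<^bsub>free_group n\<^esub>"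
    by (simp add: free_group_def foldr_inverse)
  ultimately show "\<exists>y\<in>carrier (free_group n). y \<otimes>\<^bsub>free_group n\<^esub> x = \<one>\<^bsub>free_group n\<^esub>"
    by blast
next
  fix x y assume "x \<in> carrier (free_group n)" "y \<in> carrier (free_group n)"
  then show "x \<otimes>\<^bsub>free_group n\<^esub> y \<in> carrier (free_group n)"
    using set_foldr_cons_red[of x y] by (auto simp: free_group_def reduced_foldr)
qed (auto simp: free_group_def foldr_cons_red_assoc)

lemma group_Z_power [simp]: "group (Z_power m)"
  by (simp add: Z_power_def)

lemma (in group) center_normal: "center G \<lhd> G"
proof -
  have inv: "inv z \<in> center G" if z: "z \<in> center G" for z
  proof -
    have zc: "z \<in> carrier G" using z by (simp add: center_def)
    have "inv z \<otimes> g = g \<otimes> inv z" if g: "g \<in> carrier G" for g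
    proof -
      have "z \<otimes> g = g \<otimes> z" using z g by (simp add: center_def)
      then have "g = inv z \<otimes> (g \<otimes> z)" using inv_solve_left[of g z "g \<otimes> z"] zc g by simp
      then have "g = (inv z \<otimes> g) \<otimes> z" using zc g by (simp add: m_assoc)
      then show ?thesis using inv_solve_right[of "inv z \<otimes> g" g z] zc g by simp
    qed
    then show ?thesis using zc by (simp add: center_def)
  qed
  have sub: "subgroup (center G) G"
  proof (rule subgroupI)
    show "center G \<noteq> {}" by (auto simp: center_def)
    show "a \<otimes> b \<in> center G" if "a \<in> center G" "b \<in> center G" for a b
    proof -
      have ab: "a \<in> carrier G" "b \<in> carrier G" using that by (auto simp: center_def)
      have "a \<otimes> b \<otimes> g = g \<otimes> (a \<otimes> b)" if g: "g \<in> carrier G" for g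
      proof -
        have "a \<otimes> b \<otimes> g = a \<otimes> (b \<otimes> g)" using ab g by (simp add: m_assoc)
        also have "b \<otimes> g = g \<otimes> b" using \<open>b \<in> center G\<close> g by (simp add: center_def)
        also have "a \<otimes> (g \<otimes> b) = (a \<otimes> g) \<otimes> b" using ab g by (simp add: m_assoc)
        also have "a \<otimes> g = g \<otimes> a" using \<open>a \<in> center G\<close> g by (simp add: center_def)
        finally show ?thesis using ab g by (simp add: m_assoc)
      qed
      then show ?thesis using ab by (simp add: center_def)
    qed
  qed (use inv in \<open>auto simp: center_def\<close>)
  moreover have "x \<otimes> h \<otimes> inv x \<in> center G" if "x \<in> carrier G" "h \<in> center G" for x h
  proof -
    have "h \<in> carrier G" "x \<otimes> h = h \<otimes> x" using that by (auto simp: center_def)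
    then have "x \<otimes> h \<otimes> inv x = h" using that(1) by (simp add: m_assoc)
    then show ?thesis using that by simp
  qed
  ultimately show ?thesis by (simp add: normal_inv_iff)
qed

end

theory Submission
  imports Defs
begin

text \<open>
  Write \<open>H\<close> as the extension of \<open>P = H\<pi>\<close> by \<open>L\<^sub>H\<close>.  A free basis of \<open>P\<close> gives a section \<open>A\<close>,
  so the subgroups of \<open>\<int>\<^sup>m \<times> F\<^sub>n\<close> have rank \<open>r(L\<^sub>K) + r(K\<pi>)\<close>.  For a test subgroup \<open>K\<close> of \<open>H\<close>, the group
  \<open>(H \<inter> K)\<pi>\<close> has index at most \<open>l = [\<int>\<^sup>m : L\<^sub>H]\<close> in \<open>P \<inter> K\<pi>\<close>, and the Schreier index formula yields
  \<open>di'(H) \<le> l di'(P)\<close>.  Conversely let \<open>K\<close> be a test subgroup of \<open>P\<close>.  Since \<open>P \<inter> K\<close> is not contained in the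
  derived subgroup, some \<open>\<phi> : F\<^sub>n \<rightarrow> \<int>\<close> does not vanish on it, and for infinitely many \<open>d\<close> the subgroups
  \<open>K\<^sub>d = \<phi>\<inverse>(d\<int>) \<inter> K\<close> and \<open>P \<inter> K\<^sub>d\<close> have index \<open>d\<close> in \<open>K\<close> and \<open>P \<inter> K\<close>.  Since \<open>P \<inter> K\<close> has infinite index in
  \<open>P\<close>, there are \<open>z\<^sub>0, \<dots>, z\<^sub>m \<in> P\<close> which generate a free product \<open>V = K\<^sub>d * \<langle>z\<^sub>0\<rangle> * \<dots> * \<langle>z\<^sub>m\<rangle>\<close> still of infinite index;
  by Kurosh, \<open>P \<inter> V\<close> contains \<open>P \<inter> K\<^sub>d\<close> and the \<open>z\<^sub>i\<close> as independent free factors.  A homomorphism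
  \<open>B : V \<rightarrow> \<int>\<^sup>m\<close> can be prescribed on the \<open>z\<^sub>i\<close> so that \<open>A - B\<close> maps \<open>P \<inter> V\<close> onto \<open>\<int>\<^sup>m/L\<^sub>H\<close>; then the graph of \<open>B\<close>
  meets \<open>H\<close> in a subgroup whose projection has index \<open>l\<close> in \<open>P \<inter> V\<close>, and the ratio tends to \<open>l\<close> times that
  of \<open>K\<close> as \<open>d \<rightarrow> \<infinity>\<close>.  If \<open>[\<int>\<^sup>m : L\<^sub>H] = \<infinity>\<close>, the same construction with a lattice \<open>L \<supseteq> L\<^sub>H\<close> of
  arbitrarily large finite index in place of \<open>L\<^sub>H\<close> gives unbounded ratios.
\<close>

section \<open>Free sets in groups\<close>

text \<open>The \<open>m + 1\<close> factors \<open>z\<^sub>i\<close> add the constant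
  \<open>m + 1\<close> to reduced ranks above and below the fraction line, which blurs the ratio of
  \<open>K\<close>. Passing to \<open>K\<^sub>d\<close> cures this: by the index formula the reduced
  ranks of \<open>K\<close> and \<open>P \<inter> K\<close> are multiplied by \<open>d\<close>,
  while the constant stays. Both indices must be \<open>d\<close> at once; this is why
  \<open>\<phi>\<close> lives on all of \<open>F\<^sub>n\<close> and is nonzero at some
  \<open>w\<close> in \<open>P \<inter> K\<close>. For
  \<open>d = 1 + \<bar>\<phi> w\<bar> * k\<close> the value \<open>\<phi> w\<close> is a unit modulo
  \<open>d\<close>, so the powers of this one \<open>w\<close> represent all classes in both groups.
  To generate \<open>\<int>\<^sup>m\<close>, \<open>m\<close> factors are enough; the one in excess
  keeps the constant positive, so that a cyclic \<open>K\<close>, with ratio \<open>0/0 = 1\<close>,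
  is covered as well: there the constant alone yields \<open>l\<close>. In the upper bound the rank
  of \<open>L\<^sub>K\<close> is added to numerator and denominator; this is harmless because
  \<open>l * di'(P)\<close> is at least 1.\<close>

text \<open>
  \<open>S\<close> is a free basis of the subgroup it generates: every integer labelling \<open>c\<close> of the edges of the
  Cayley graph is the gradient of a potential \<open>F\<close>, which means that the Cayley graph is a tree.  In this form
  the theorems of Nielsen--Schreier and Kurosh follow by integrating suitable labellings.
\<close>

definition free_set :: "('a, 'b) monoid_scheme \<Rightarrow> 'a set \<Rightarrow> bool" where
  "free_set G S \<longleftrightarrow> S \<subseteq> carrier G \<and>
     (\<forall>c :: 'a \<Rightarrow> 'a \<Rightarrow> int. \<exists>F. \<forall>x \<in> generate G S. \<forall>s \<in> S. F (x \<otimes>\<^bsub>G\<^esub> s) = F x + c x s)"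

definition additive_on :: "('a, 'b) monoid_scheme \<Rightarrow> 'a set \<Rightarrow> ('a \<Rightarrow> int) \<Rightarrow> bool" where
  "additive_on G U h \<longleftrightarrow> (\<forall>x \<in> U. \<forall>y \<in> U. h (x \<otimes>\<^bsub>G\<^esub> y) = h x + h y)"

text \<open>The certificate for lower bounds on ranks: for a finite subset \<open>T\<close> of a
  subgroup \<open>U\<close> it says that \<open>T\<close> is a basis of a free direct summand of the
  abelianisation of \<open>U\<close>.\<close>

definition extends_additively :: "('a, 'b) monoid_scheme \<Rightarrow> 'a set \<Rightarrow> 'a set \<Rightarrow> bool" where
  "extends_additively G T U \<longleftrightarrow> (\<forall>f. \<exists>h. additive_on G U h \<and> (\<forall>t \<in> T. h t = f t))"

definition transversal :: "('a, 'b) monoid_scheme \<Rightarrow> 'a set \<Rightarrow> 'a set \<Rightarrow> 'a set \<Rightarrow> bool" where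
  "transversal G U V T \<longleftrightarrow> T \<subseteq> V \<and> (\<forall>x \<in> V. \<exists>!t. t \<in> T \<and> x \<otimes>\<^bsub>G\<^esub> inv\<^bsub>G\<^esub> t \<in> U)"

lemma additive_onD: "additive_on G U h \<Longrightarrow> x \<in> U \<Longrightarrow> y \<in> U \<Longrightarrow> h (x \<otimes>\<^bsub>G\<^esub> y) = h x + h y"
  by (simp add: additive_on_def)

lemma additive_on_subset: "additive_on G U h \<Longrightarrow> V \<subseteq> U \<Longrightarrow> additive_on G V h"
  by (auto simp: additive_on_def)

lemma free_setD:
  "free_set G S \<Longrightarrow> \<exists>F. \<forall>x \<in> generate G S. \<forall>s \<in> S. F (x \<otimes>\<^bsub>G\<^esub> s) = F x + (c x s :: int)"
  by (auto simp: free_set_def)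

lemma free_set_carrier: "free_set G S \<Longrightarrow> S \<subseteq> carrier G"
  by (auto simp: free_set_def)

lemma extends_additivelyD:
  "extends_additively G T U \<Longrightarrow> \<exists>h. additive_on G U h \<and> (\<forall>t \<in> T. h t = f t)"
  by (simp add: extends_additively_def)

lemma extends_additively_mono:
  "extends_additively G T U \<Longrightarrow> T' \<subseteq> T \<Longrightarrow> U' \<subseteq> U \<Longrightarrow> extends_additively G T' U'"
  unfolding extends_additively_def by (meson additive_on_subset subsetD)

abbreviation (input) rank_of :: "('a, 'b) monoid_scheme \<Rightarrow> 'a set \<Rightarrow> nat" where
  "rank_of G U \<equiv> group_rank (G\<lparr>carrier := U\<rparr>)"

abbreviation (input) fg :: "('a, 'b) monoid_scheme \<Rightarrow> 'a set \<Rightarrow> bool" where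
  "fg G U \<equiv> finitely_generated (G\<lparr>carrier := U\<rparr>)"

text \<open>Several representatives of one coset are allowed. This makes the notion stable under
  enlarging \<open>U\<close> and under homomorphic images; exact counting is left to
  \<open>transversal\<close>.\<close>

definition finite_index :: "('a, 'b) monoid_scheme \<Rightarrow> 'a set \<Rightarrow> 'a set \<Rightarrow> bool" where
  "finite_index G U V \<longleftrightarrow> (\<exists>T. finite T \<and> T \<subseteq> V \<and> (\<forall>x \<in> V. \<exists>t \<in> T. x \<otimes>\<^bsub>G\<^esub> inv\<^bsub>G\<^esub> t \<in> U))"

lemma finite_index_mono: "finite_index G U V \<Longrightarrow> U \<subseteq> W \<Longrightarrow> finite_index G W V"
  unfolding finite_index_def by (meson subsetD)

lemma transversal_finite_index:
  assumes "transversal G U V T" "finite T"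
  shows "finite_index G U V"
  unfolding finite_index_def
proof (intro exI[of _ T] conjI ballI)
  fix x assume "x \<in> V"
  then have "\<exists>!t. t \<in> T \<and> x \<otimes>\<^bsub>G\<^esub> inv\<^bsub>G\<^esub> t \<in> U"
    using assms(1) by (simp add: transversal_def)
  then show "\<exists>t \<in> T. x \<otimes>\<^bsub>G\<^esub> inv\<^bsub>G\<^esub> t \<in> U" by blast
qed (use assms in \<open>auto simp: transversal_def\<close>)

lemma image_subset_iff_on:
  assumes "inj_on f C" "A \<subseteq> C" "B \<subseteq> C"
  shows "f ` A \<subseteq> f ` B \<longleftrightarrow> A \<subseteq> B"
proof
  assume "f ` A \<subseteq> f ` B"
  then have "inv_into C f ` f ` A \<subseteq> inv_into C f ` f ` B" by (rule image_mono)
  then show "A \<subseteq> B" using assms by (simp add: inv_into_image_cancel)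
qed (rule image_mono)

lemma (in group_hom) finite_index_image:
  assumes "finite_index G U V" "V \<subseteq> carrier G"
  shows "finite_index H (h ` U) (h ` V)"
proof -
  obtain T where T: "finite T" "T \<subseteq> V" "\<And>x. x \<in> V \<Longrightarrow> \<exists>t \<in> T. x \<otimes> inv t \<in> U"
    using assms(1) unfolding finite_index_def by blast
  have "\<exists>t \<in> h ` T. y \<otimes>\<^bsub>H\<^esub> inv\<^bsub>H\<^esub> t \<in> h ` U" if y: "y \<in> h ` V" for y
  proof -
    obtain x where x: "x \<in> V" "y = h x" using y by blast
    obtain t where t: "t \<in> T" "x \<otimes> inv t \<in> U" using T(3)[OF x(1)] by blast
    have "x \<in> carrier G" "t \<in> carrier G" using x t T(2) assms(2) by auto
    then have "h (x \<otimes> inv t) = y \<otimes>\<^bsub>H\<^esub> inv\<^bsub>H\<^esub> h t" using x by simp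
    then show ?thesis using t by (metis imageI)
  qed
  then show ?thesis unfolding finite_index_def using T(1,2) by (intro exI[of _ "h ` T"]) auto
qed

section \<open>Additive maps and potentials on Cayley graphs\<close>

context group
begin

lemma inv_mult_cancel [simp]:
  "x \<in> carrier G \<Longrightarrow> y \<in> carrier G \<Longrightarrow> inv x \<otimes> (x \<otimes> y) = y"
  "x \<in> carrier G \<Longrightarrow> y \<in> carrier G \<Longrightarrow> x \<otimes> (inv x \<otimes> y) = y"
  by (simp_all flip: m_assoc)

text \<open>The induction follows a path in the Cayley graph, one edge
  \<open>y \<rightarrow> y \<otimes> s\<close> at a time in either direction; this is the form in
  which potentials can be compared.\<close>

lemma generate_right_induct [consumes 2, case_names one mult mult_inv]:
  assumes S: "S \<subseteq> carrier G" and x: "x \<in> generate G S"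
    and one: "P \<one>"
    and mult: "\<And>y s. y \<in> generate G S \<Longrightarrow> s \<in> S \<Longrightarrow> P y \<Longrightarrow> P (y \<otimes> s)"
    and mult_inv: "\<And>y s. y \<in> generate G S \<Longrightarrow> s \<in> S \<Longrightarrow> P y \<Longrightarrow> P (y \<otimes> inv s)"
  shows "P x"
proof -
  have gc: "y \<in> carrier G" if "y \<in> generate G S" for y
    using S that generate_in_carrier by blast
  have "\<forall>y \<in> generate G S. P y \<longrightarrow> P (y \<otimes> x)"
    using x
  proof induction
    case one
    then show ?case using gc by simp
  next
    case (eng h1 h2)
    show ?case
    proof (intro ballI impI)
      fix y assume y: "y \<in> generate G S" "P y"
      have "y \<otimes> h1 \<in> generate G S" using y eng.hyps by (auto intro: generate.eng)
      moreover have "P (y \<otimes> h1)" using eng y by blast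
      ultimately have "P ((y \<otimes> h1) \<otimes> h2)" using eng by blast
      then show "P (y \<otimes> (h1 \<otimes> h2))" using y eng.hyps by (simp add: m_assoc gc)
    qed
  next
    case (incl h)
    then show ?case using mult by blast
  next
    case (inv h)
    then show ?case using mult_inv by blast
  qed
  then have "P (\<one> \<otimes> x)" using one generate.one by blast
  then show ?thesis using gc[OF x] by simp
qed

lemma additive_on_one: "additive_on G U h \<Longrightarrow> \<one> \<in> U \<Longrightarrow> h \<one> = 0"
  using additive_onD[of G U h \<one> \<one>] by simp

lemma additive_on_inv:
  assumes "additive_on G U h" "subgroup U G" "x \<in> U"
  shows "h (inv x) = - h x"
proof -
  have "inv x \<in> U" "\<one> \<in> U" "x \<in> carrier G"
    using assms(2,3) subgroup.m_inv_closed subgroup.one_closed subgroup.mem_carrier by metis+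
  then show ?thesis
    using additive_onD[OF assms(1,3), of "inv x"] additive_on_one[OF assms(1)] by simp
qed

lemma additive_on_pow:
  assumes h: "additive_on G U h" and U: "subgroup U G" and x: "x \<in> U"
  shows "h (x [^] (k::int)) = k * h x"
proof -
  have nat: "h (x [^] n) = int n * h x \<and> x [^] n \<in> U" for n :: nat
  proof (induction n)
    case 0
    then show ?case using additive_on_one[OF h] subgroup.one_closed[OF U] by simp
  next
    case (Suc n)
    then have "x [^] n \<otimes> x \<in> U" "h (x [^] n \<otimes> x) = h (x [^] n) + h x"
      using additive_onD[OF h, of "x [^] n" x] x subgroup.m_closed[OF U] by blast+
    then show ?case using Suc by (simp add: distrib_right)
  qed
  show ?thesis
  proof (cases "k < 0")
    case False
    then have "x [^] k = x [^] nat k" using int_pow_def2[of G x k] by simp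
    then show ?thesis using nat[of "nat k"] False by simp
  next
    case True
    then have "x [^] k = inv (x [^] nat (- k))" using int_pow_def2[of G x k] by simp
    moreover have "h (inv (x [^] nat (- k))) = - h (x [^] nat (- k))"
      using additive_on_inv[OF h U] nat by blast
    ultimately show ?thesis using nat[of "nat (- k)"] True by simp
  qed
qed

lemma additive_on_vanish:
  assumes h: "additive_on G W h" and W: "subgroup W G" and S: "S \<subseteq> W" "\<And>s. s \<in> S \<Longrightarrow> h s = 0"
    and x: "x \<in> generate G S"
  shows "h x = 0"
proof -
  have Sc: "S \<subseteq> carrier G" using S(1) subgroup.subset[OF W] by blast
  have SW: "generate G S \<subseteq> W" using generate_subgroup_incl[OF S(1) W] .
  show ?thesis
    using Sc x
  proof (induction rule: generate_right_induct)
    case one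
    then show ?case using additive_on_one[OF h] subgroup.one_closed[OF W] by blast
  next
    case (mult y s)
    then show ?case using additive_onD[OF h, of y s] S SW by auto
  next
    case (mult_inv y s)
    have "s \<in> W" "inv s \<in> W" using mult_inv(2) S(1) subgroup.m_inv_closed[OF W] by blast+
    then show ?case
      using additive_onD[OF h, of y "inv s"] additive_on_inv[OF h W, of s] mult_inv S(2) SW by auto
  qed
qed

text \<open>The difference of two potentials is constant along edges, and the Cayley graph of the
  generated subgroup is connected.\<close>

lemma potential_unique:
  fixes F F' :: "'a \<Rightarrow> int"
  assumes S: "S \<subseteq> carrier G"
    and eq: "\<And>x s. x \<in> generate G S \<Longrightarrow> s \<in> S \<Longrightarrow> F (x \<otimes> s) - F x = F' (x \<otimes> s) - F' x"
    and x: "x \<in> generate G S"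
  shows "F x - F \<one> = F' x - F' \<one>"
  using S x
proof (induction rule: generate_right_induct)
  case (mult y s)
  then show ?case using eq[of y s] by simp
next
  case (mult_inv y s)
  have "y \<otimes> inv s \<in> generate G S" using mult_inv by (auto intro: generate.intros)
  moreover have "y \<otimes> inv s \<otimes> s = y"
    using mult_inv S generate_in_carrier[OF S] by (auto simp: m_assoc subsetD)
  ultimately show ?case using eq[of "y \<otimes> inv s" s] mult_inv by simp
qed simp

text \<open>If the labelling is invariant under left translation by \<open>u\<close>, then
  \<open>y \<mapsto> F (u \<otimes> y)\<close> is another potential of it and differs from
  \<open>F\<close> by a constant. A labelling invariant under a whole subgroup thus has a potential
  that is additive on this subgroup; all additive maps on subgroups of free groups below arise in
  this way.\<close>

lemma potential_translate:
  fixes F :: "'a \<Rightarrow> int"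
  assumes S: "S \<subseteq> carrier G" and F1: "F \<one> = 0"
    and F: "\<And>x s. x \<in> generate G S \<Longrightarrow> s \<in> S \<Longrightarrow> F (x \<otimes> s) = F x + c x s"
    and u: "u \<in> generate G S"
    and inv: "\<And>x s. x \<in> generate G S \<Longrightarrow> s \<in> S \<Longrightarrow> c (u \<otimes> x) s = c x s"
    and x: "x \<in> generate G S"
  shows "F (u \<otimes> x) = F u + F x"
proof -
  have gc: "y \<in> carrier G" if "y \<in> generate G S" for y
    using S that generate_in_carrier by blast
  have "F (u \<otimes> x) - F (u \<otimes> \<one>) = F x - F \<one>"
  proof (rule potential_unique[of S "\<lambda>y. F (u \<otimes> y)" F, OF S _ x])
    fix y s assume ys: "y \<in> generate G S" "s \<in> S"
    have "u \<otimes> y \<in> generate G S" using u ys by (auto intro: generate.eng)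
    then have "F (u \<otimes> y \<otimes> s) = F (u \<otimes> y) + c y s" using F inv ys by simp
    moreover have "u \<otimes> y \<otimes> s = u \<otimes> (y \<otimes> s)" using u ys S gc by (auto simp: m_assoc subsetD)
    ultimately show "F (u \<otimes> (y \<otimes> s)) - F (u \<otimes> y) = F (y \<otimes> s) - F y" using F ys by simp
  qed
  then show ?thesis using F1 gc[OF u] by simp
qed

lemma free_set_potential:
  assumes "free_set G S"
  obtains F :: "'a \<Rightarrow> int" where "F \<one> = 0"
    "\<And>x s. x \<in> generate G S \<Longrightarrow> s \<in> S \<Longrightarrow> F (x \<otimes> s) = F x + c x s"
proof -
  obtain F where "\<forall>x \<in> generate G S. \<forall>s \<in> S. F (x \<otimes> s) = F x + (c x s :: int)"
    using free_setD[OF assms] by blast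
  then show ?thesis by (intro that[of "\<lambda>x. F x - F \<one>"]) auto
qed

text \<open>A labelling that depends on the generator alone is invariant under every
  translation.\<close>

lemma free_set_extends_additively:
  assumes "free_set G S"
  shows "extends_additively G S (generate G S)"
  unfolding extends_additively_def
proof
  fix f :: "'a \<Rightarrow> int"
  have S: "S \<subseteq> carrier G" using assms by (simp add: free_set_def)
  obtain F where F: "F \<one> = 0" "\<And>x s. x \<in> generate G S \<Longrightarrow> s \<in> S \<Longrightarrow> F (x \<otimes> s) = F x + f s"
    using free_set_potential[OF assms, of "\<lambda>_. f"] by blast
  have "additive_on G (generate G S) F"
    unfolding additive_on_def using potential_translate[OF S F(1) F(2)] by blast
  moreover have "F s = f s" if "s \<in> S" for s
    using F(2)[OF generate.one that] F(1) S that by (auto simp: subsetD)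
  ultimately show "\<exists>h. additive_on G (generate G S) h \<and> (\<forall>s\<in>S. h s = f s)" by blast
qed

text \<open>Modulo 2, an additive map is determined by its values on \<open>S\<close>, so there are at most \<open>2\<^sup>|\<^sup>S\<^sup>|\<close> of them.\<close>

lemma card_extends_additively_le:
  assumes S: "S \<subseteq> carrier G" "finite S" and T: "T \<subseteq> generate G S" "finite T"
    and ext: "extends_additively G T (generate G S)"
  shows "card T \<le> card S"
proof -
  let ?U = "generate G S"
  obtain h where h: "\<And>f. additive_on G ?U (h f)" "\<And>f t. t \<in> T \<Longrightarrow> h f t = f t"
    using ext unfolding extends_additively_def by metis
  let ?A = "T \<rightarrow>\<^sub>E {0, 1::int}" and ?B = "S \<rightarrow>\<^sub>E {0, 1::int}"
  let ?\<Phi> = "\<lambda>f. \<lambda>s\<in>S. h f s mod 2"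
  have "inj_on ?\<Phi> ?A"
  proof (rule inj_onI)
    fix f g assume f: "f \<in> ?A" and g: "g \<in> ?A" and eq: "?\<Phi> f = ?\<Phi> g"
    have "h f s mod 2 = h g s mod 2" if "s \<in> S" for s
      using fun_cong[OF eq, of s] that by simp
    then have even: "even (h f s - h g s)" if "s \<in> S" for s
      using that by (simp add: mod_eq_dvd_iff)
    have "even (h f x - h g x)" if "x \<in> ?U" for x
      using S(1) that
    proof (induction rule: generate_right_induct)
      case one
      then show ?case using additive_on_one[OF h(1) generate.one] by simp
    next
      case (mult y s)
      have "h k (y \<otimes> s) = h k y + h k s" for k
        using additive_onD[OF h(1)] mult by (auto intro: generate.incl)
      then show ?case using even[of s] mult by simp
    next
      case (mult_inv y s)
      have "h k (y \<otimes> inv s) = h k y - h k s" for k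
        using additive_onD[OF h(1), of y "inv s"] additive_on_inv[OF h(1) generate_is_subgroup[OF S(1)], of s] mult_inv
          generate.incl[of s S G] generate.inv[of s S G] by simp
      then show ?case using even[of s] mult_inv by simp
    qed
    then have "even (f t - g t)" if "t \<in> T" for t
      using that T h(2) by (metis subsetD)
    moreover have "f t \<in> {0,1}" "g t \<in> {0,1}" if "t \<in> T" for t
      using f g that by auto
    ultimately have "f t = g t" if "t \<in> T" for t
      using that by fastforce
    then show "f = g" using f g by (intro PiE_ext) auto
  qed
  moreover have "?\<Phi> ` ?A \<subseteq> ?B" by auto
  moreover have "finite ?B" using S by (simp add: finite_PiE)
  ultimately have "card ?A \<le> card ?B" by (rule card_inj_on_le)
  then have "(2::nat) ^ card T \<le> 2 ^ card S" using S T by (simp add: card_PiE)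
  then show ?thesis by simp
qed

text \<open>
  A \<open>{0, 1}\<close>-labelling of the edges of the Schreier graph is determined modulo 2 by the values of its
  potential on \<open>R\<close> and on all but one of the elements of \<open>T\<close>.
\<close>

lemma index_rank_lower_bound:
  assumes S: "free_set G S" "finite S"
    and U: "U \<subseteq> generate G S" and R: "R \<subseteq> carrier G" "finite R" "generate G R = U"
    and T: "transversal G U (generate G S) T" "finite T"
  shows "card T * card S + 1 \<le> card R + card T"
proof -
  let ?V = "generate G S"
  have Sc: "S \<subseteq> carrier G" using S by (simp add: free_set_def)
  have Ug: "subgroup U G" using R generate_is_subgroup by blast
  have gc: "y \<in> carrier G" if "y \<in> ?V" for y
    using Sc that generate_in_carrier by blast
  have TV: "T \<subseteq> ?V" using T by (simp add: transversal_def)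
  define rep where "rep x = (THE t. t \<in> T \<and> x \<otimes> inv t \<in> U)" for x
  have rep: "rep x \<in> T" "x \<otimes> inv (rep x) \<in> U" if "x \<in> ?V" for x
    using theI'[of "\<lambda>t. t \<in> T \<and> x \<otimes> inv t \<in> U"] T that unfolding rep_def transversal_def by auto
  have rep_eq: "rep x = t" if "x \<in> ?V" "t \<in> T" "x \<otimes> inv t \<in> U" for x t
    using T rep[OF that(1)] that unfolding transversal_def by blast
  have rep_u: "rep (u \<otimes> x) = rep x" if "u \<in> U" "x \<in> ?V" for u x
  proof (rule rep_eq)
    show "u \<otimes> x \<in> ?V" using that U by (auto intro: generate.eng)
    have "u \<otimes> x \<otimes> inv (rep x) = u \<otimes> (x \<otimes> inv (rep x))"
      using that U gc rep[OF that(2)] TV by (auto simp: m_assoc subsetD)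
    then show "u \<otimes> x \<otimes> inv rep x \<in> U"
      using rep[OF that(2)] that subgroup.m_closed[OF Ug] by simp
  qed (use rep that in auto)
  have rep_T: "rep t = t" if "t \<in> T" for t
    using that rep_eq[of t t] TV gc subgroup.one_closed[OF Ug] by auto
  \<comment> \<open>The representative of the trivial coset lies in \<open>U\<close>, so its
    potential is already controlled by \<open>R\<close>. This saving is the \<open>+ 1\<close> of
    the formula.\<close>
  obtain t0 where t0: "t0 \<in> T" "t0 \<in> U"
  proof -
    have "rep \<one> \<in> T" "\<one> \<otimes> inv (rep \<one>) \<in> U" using rep[OF generate.one] by auto
    moreover from this have "inv (\<one> \<otimes> inv (rep \<one>)) \<in> U" using subgroup.m_inv_closed[OF Ug] by blast
    ultimately show ?thesis using that[of "rep \<one>"] TV gc by (auto simp: subsetD)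
  qed
  \<comment> \<open>The label of an edge depends only on the coset of its origin, so this is a
    labelling of the Schreier graph lifted to the Cayley graph; its potential is additive on
    \<open>U\<close>.\<close>
  define c where "c f x s = f (rep x, s)" for f :: "'a \<times> 'a \<Rightarrow> int" and x s
  have "\<exists>F :: 'a \<Rightarrow> int. F \<one> = 0 \<and> (\<forall>x \<in> ?V. \<forall>s \<in> S. F (x \<otimes> s) = F x + c f x s)" for f
    using free_set_potential[OF S(1)] by metis
  then obtain F :: "('a \<times> 'a \<Rightarrow> int) \<Rightarrow> 'a \<Rightarrow> int" where F1: "\<And>f. F f \<one> = 0"
    and F: "\<And>f x s. x \<in> ?V \<Longrightarrow> s \<in> S \<Longrightarrow> F f (x \<otimes> s) = F f x + c f x s"
    by metis
  have Fadd: "F f (u \<otimes> x) = F f u + F f x" if "u \<in> U" "x \<in> ?V" for f u x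
  proof (rule potential_translate[OF Sc F1 F])
    show "c f (u \<otimes> y) s = c f y s" if "y \<in> ?V" for y s
      using rep_u \<open>u \<in> U\<close> that by (simp add: c_def)
  qed (use that U in auto)
  then have Fu: "additive_on G U (F f)" for f
    using U by (auto simp: additive_on_def)
  let ?A = "T \<times> S \<rightarrow>\<^sub>E {0, 1::int}" and ?B = "(R \<rightarrow>\<^sub>E {0, 1::int}) \<times> (T - {t0} \<rightarrow>\<^sub>E {0, 1::int})"
  let ?\<Phi> = "\<lambda>f. (\<lambda>s\<in>R. F f s mod 2, \<lambda>t\<in>T-{t0}. F f t mod 2)"
  have "inj_on ?\<Phi> ?A"
  proof (rule inj_onI)
    fix f g assume f: "f \<in> ?A" and g: "g \<in> ?A" and eq: "?\<Phi> f = ?\<Phi> g"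
    then have eqR: "(\<lambda>s\<in>R. F f s mod 2) = (\<lambda>s\<in>R. F g s mod 2)"
      and eqT: "(\<lambda>t\<in>T-{t0}. F f t mod 2) = (\<lambda>t\<in>T-{t0}. F g t mod 2)" by blast+
    have "F f s mod 2 = F g s mod 2" if "s \<in> R" for s
      using fun_cong[OF eqR, of s] that by simp
    then have evenR: "even (F f s - F g s)" if "s \<in> R" for s
      using that by (simp add: mod_eq_dvd_iff)
    have "F f s mod 2 = F g s mod 2" if "s \<in> T - {t0}" for s
      using fun_cong[OF eqT, of s] that by simp
    then have evenT': "even (F f s - F g s)" if "s \<in> T - {t0}" for s
      using that by (simp add: mod_eq_dvd_iff)
    have evenU: "even (F f x - F g x)" if "x \<in> U" for x
      using R(1) that[folded R(3)]
    proof (induction rule: generate_right_induct)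
      case (mult y s)
      have "F k (y \<otimes> s) = F k y + F k s" for k
        using additive_onD[OF Fu] mult R(3) by (auto intro: generate.incl)
      then show ?case using evenR[of s] mult by simp
    next
      case (mult_inv y s)
      have sU: "s \<in> U" using mult_inv R(3) by (auto intro: generate.incl)
      have "F k (y \<otimes> inv s) = F k y - F k s" for k
        using additive_onD[OF Fu, of y "inv s"] additive_on_inv[OF Fu Ug sU, of k] mult_inv R(3) sU
          subgroup.m_inv_closed[OF Ug] by auto
      then show ?case using evenR[of s] mult_inv by simp
    qed (simp add: F1)
    have evenT: "even (F f t - F g t)" if "t \<in> T" for t
      using that evenU[OF t0(2)] evenT' by (cases "t = t0") auto
    have even: "even (F f x - F g x)" if "x \<in> ?V" for x
    proof -
      have t: "rep x \<in> ?V" using rep[OF that] TV by blast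
      have "x = (x \<otimes> inv (rep x)) \<otimes> rep x" using t that gc by (simp add: m_assoc)
      then have "F k x = F k (x \<otimes> inv (rep x)) + F k (rep x)" for k
        using Fadd[of "x \<otimes> inv (rep x)" "rep x"] rep[OF that] t by metis
      then show ?thesis
        using evenU[of "x \<otimes> inv (rep x)"] evenT[of "rep x"] rep[OF that] by simp
    qed
    have "f (t, s) = g (t, s)" if ts: "t \<in> T" "s \<in> S" for t s
    proof -
      have tV: "t \<in> ?V" "t \<otimes> s \<in> ?V" using ts TV by (auto intro: generate.intros)
      have Fts: "F k (t \<otimes> s) = F k t + k (t, s)" for k
        using F[OF tV(1) ts(2), of k] rep_T ts by (simp add: c_def)
      have "f (t, s) - g (t, s) = (F f (t \<otimes> s) - F g (t \<otimes> s)) - (F f t - F g t)"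
        unfolding Fts by simp
      then have "even (f (t, s) - g (t, s))"
        using dvd_diff[OF even[OF tV(2)] even[OF tV(1)]] by metis
      moreover have "f (t, s) \<in> {0,1}" "g (t, s) \<in> {0,1}"
        using PiE_mem[OF f] PiE_mem[OF g] ts by blast+
      ultimately show ?thesis by fastforce
    qed
    then have "f p = g p" if "p \<in> T \<times> S" for p
      using that by blast
    then show "f = g" by (rule PiE_ext[OF f g])
  qed
  moreover have "?\<Phi> ` ?A \<subseteq> ?B"
  proof (rule image_subsetI)
    fix f
    have "F f x mod 2 \<in> {0, 1}" for x by auto
    then show "?\<Phi> f \<in> ?B" by (simp only: mem_Times_iff fst_conv snd_conv restrict_PiE_iff) blast
  qed
  moreover have "finite ?B" using R T by (simp add: finite_PiE)
  ultimately have "card ?A \<le> card ?B" by (rule card_inj_on_le)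
  then have "(2::nat) ^ (card T * card S) \<le> 2 ^ card R * 2 ^ (card T - 1)"
    by (simp only: card_cartesian_product card_PiE S R T finite_SigmaI finite_Diff prod_constant)
      (simp add: card_Diff_singleton t0 card_cartesian_product numeral_2_eq_2)
  then have "(2::nat) ^ (card T * card S) \<le> 2 ^ (card R + (card T - 1))"
    by (simp add: power_add)
  then have "card T * card S \<le> card R + (card T - 1)" by simp
  moreover have "card T > 0" using t0 T by (auto simp: card_gt_0_iff)
  ultimately show ?thesis by linarith
qed

section \<open>Schreier transversals and the theorems of Nielsen-Schreier and Kurosh\<close>

text \<open>\<open>len x\<close> is the distance from the trivial coset to the coset of
  \<open>x\<close> in the Schreier graph, and \<open>\<tau> x\<close> is the endpoint of a geodesic.
  Representatives at distance \<open>k + 1\<close> are one-letter continuations of chosen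
  representatives at distance \<open>k\<close>, so together the geodesics form a spanning tree of
  the Schreier graph.\<close>

lemma schreier_transversal:
  assumes S: "S \<subseteq> carrier G" and U: "subgroup U G" "U \<subseteq> generate G S"
  obtains \<tau> :: "'a \<Rightarrow> 'a" and len :: "'a \<Rightarrow> nat" where
    "\<And>x. x \<in> generate G S \<Longrightarrow> \<tau> x \<in> generate G S"
    "\<And>x. x \<in> generate G S \<Longrightarrow> x \<otimes> inv (\<tau> x) \<in> U"
    "\<And>x y. x \<in> generate G S \<Longrightarrow> y \<in> generate G S \<Longrightarrow> x \<otimes> inv y \<in> U \<Longrightarrow> \<tau> x = \<tau> y \<and> len x = len y"
    "\<And>x. x \<in> generate G S \<Longrightarrow> \<tau> x = \<one> \<or>
       (\<exists>x' \<in> generate G S. \<exists>s \<in> S. len x = Suc (len x') \<and> (\<tau> x = \<tau> x' \<otimes> s \<or> \<tau> x = \<tau> x' \<otimes> inv s))"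
    "\<tau> \<one> = \<one>"
proof -
  let ?V = "generate G S"
  have gc: "y \<in> carrier G" if "y \<in> ?V" for y
    using S that generate_in_carrier by blast
  have Vm: "x \<otimes> y \<in> ?V" if "x \<in> ?V" "y \<in> ?V" for x y using that by (rule generate.eng)
  define A where "A = S \<union> m_inv G ` S"
  have AV: "a \<in> ?V" if "a \<in> A" for a
    using that by (auto simp: A_def intro: generate.incl generate.inv)
  define eqv where "eqv x y \<longleftrightarrow> x \<otimes> inv y \<in> U" for x y
  have refl: "eqv x x" if "x \<in> ?V" for x
    using that gc subgroup.one_closed[OF U(1)] by (simp add: eqv_def)
  have sym: "eqv y x" if "eqv x y" "x \<in> ?V" "y \<in> ?V" for x y
  proof -
    have "inv (x \<otimes> inv y) \<in> U" using that subgroup.m_inv_closed[OF U(1)] by (simp add: eqv_def)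
    then show ?thesis using that gc by (simp add: eqv_def inv_mult_group)
  qed
  have trans: "eqv x z" if "eqv x y" "eqv y z" "x \<in> ?V" "y \<in> ?V" "z \<in> ?V" for x y z
  proof -
    have "(x \<otimes> inv y) \<otimes> (y \<otimes> inv z) \<in> U" using that subgroup.m_closed[OF U(1)] by (simp add: eqv_def)
    then show ?thesis using that gc by (simp add: eqv_def m_assoc)
  qed
  have mult: "eqv (x \<otimes> a) (y \<otimes> a)" if "eqv x y" "x \<in> ?V" "y \<in> ?V" "a \<in> ?V" for x y a
    using that gc by (simp add: eqv_def inv_mult_group m_assoc)
  define adj where "adj = {(x, x \<otimes> a) |x a. x \<in> ?V \<and> a \<in> A}"
  have adjV: "y \<in> ?V" if "(\<one>, y) \<in> adj ^^ k" for y k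
    using that
  proof (cases k)
    case 0
    then show ?thesis using that generate.one[of G S] by auto
  next
    case (Suc j)
    then show ?thesis using that Vm AV by (auto simp: adj_def)
  qed
  have ball: "\<exists>k. (\<one>, x) \<in> adj ^^ k" if "x \<in> ?V" for x
    using S that
  proof (induction rule: generate_right_induct)
    case one
    have "(\<one>, \<one>) \<in> adj ^^ 0" by simp
    then show ?case by blast
  next
    case (mult y s)
    then obtain k where "(\<one>, y) \<in> adj ^^ k" by blast
    moreover have "(y, y \<otimes> s) \<in> adj" using mult by (auto simp: adj_def A_def)
    ultimately have "(\<one>, y \<otimes> s) \<in> adj ^^ Suc k" by auto
    then show ?case by blast
  next
    case (mult_inv y s)
    then obtain k where "(\<one>, y) \<in> adj ^^ k" by blast
    moreover have "(y, y \<otimes> inv s) \<in> adj" using mult_inv by (auto simp: adj_def A_def)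
    ultimately have "(\<one>, y \<otimes> inv s) \<in> adj ^^ Suc k" by auto
    then show ?case by blast
  qed
  define len where "len x = (LEAST k. \<exists>y. (\<one>, y) \<in> adj ^^ k \<and> eqv x y)" for x
  have len_ex: "\<exists>y. (\<one>, y) \<in> adj ^^ len x \<and> eqv x y" if "x \<in> ?V" for x
    unfolding len_def by (rule LeastI_ex) (use ball[OF that] refl[OF that] in blast)
  have len_le: "len x \<le> k" if "(\<one>, y) \<in> adj ^^ k" "eqv x y" for x y k
    unfolding len_def by (rule Least_le) (use that in blast)
  \<comment> \<open>\<open>y\<close> continues, by one letter, the representative of a coset at
    distance \<open>k\<close> and lands in the coset of \<open>x\<close>.\<close>
  define N where "N k r x y \<longleftrightarrow> (\<exists>x' \<in> ?V. \<exists>a \<in> A. len x' = k \<and> y = r x' \<otimes> a \<and> eqv x y)"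
    for k and r :: "'a \<Rightarrow> 'a" and x y
  define rep where "rep = rec_nat (\<lambda>_. \<one>) (\<lambda>k r x. SOME y. N k r x y)"
  have rep_0: "rep 0 = (\<lambda>_. \<one>)" and rep_Suc: "rep (Suc k) = (\<lambda>x. SOME y. N k (rep k) x y)" for k
    by (simp_all add: rep_def)
  have rep: "rep (len x) x \<in> ?V \<and> eqv x (rep (len x) x) \<and>
      (\<forall>k. len x = Suc k \<longrightarrow> N k (rep k) x (rep (len x) x))" if "x \<in> ?V" for x
    using that
  proof (induction "len x" arbitrary: x)
    case 0
    obtain y where "(\<one>, y) \<in> adj ^^ len x" "eqv x y" using len_ex 0 by blast
    then have "eqv x \<one>" by (simp flip: 0(1))
    then show ?case using generate.one[of G S] by (simp add: rep_0 flip: 0(1))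
  next
    case (Suc k)
    obtain y where y: "(\<one>, y) \<in> adj ^^ Suc k" "eqv x y" using len_ex[OF Suc(3)] Suc(2) by auto
    then obtain y' a where y': "(\<one>, y') \<in> adj ^^ k" "a \<in> A" "y = y' \<otimes> a"
      by (auto simp: adj_def)
    have V: "y \<in> ?V" "y' \<in> ?V" "a \<in> ?V" using adjV y(1) y'(1,2) AV by blast+
    have xr: "eqv x (r \<otimes> a)" if "eqv y' r" "r \<in> ?V" for r
      using trans[OF y(2) mult[OF that(1), of a, folded y'(3)]] V that Suc(3) Vm by auto
    have "len y' = k"
    proof (rule antisym)
      show "len y' \<le> k" using len_le y' refl V by blast
      obtain r where r: "(\<one>, r) \<in> adj ^^ len y'" "eqv y' r" using len_ex V by blast
      have "r \<in> ?V" using adjV r by blast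
      then have "(\<one>, r \<otimes> a) \<in> adj ^^ Suc (len y')" using r y' by (auto simp: adj_def)
      then have "len x \<le> Suc (len y')" using len_le xr r \<open>r \<in> ?V\<close> by blast
      then show "k \<le> len y'" using Suc(2) by simp
    qed
    then have "rep k y' \<in> ?V" "eqv y' (rep k y')" using Suc(1)[of y'] V by auto
    then have "N k (rep k) x (rep k y' \<otimes> a)"
      using xr \<open>len y' = k\<close> V y' by (auto simp: N_def)
    then have *: "N k (rep k) x (rep (Suc k) x)" unfolding rep_Suc by (rule someI)
    then obtain x' a' where "x' \<in> ?V" "a' \<in> A" "len x' = k" "rep (Suc k) x = rep k x' \<otimes> a'"
      "eqv x (rep (Suc k) x)" by (auto simp: N_def)
    then have "rep (Suc k) x \<in> ?V" using Suc(1)[of x'] Vm AV by auto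
    then show ?case using * \<open>eqv x (rep (Suc k) x)\<close> Suc(2) by (metis old.nat.inject)
  qed
  define \<tau> where "\<tau> x = rep (len x) x" for x
  show ?thesis
  proof (rule that[of \<tau> len])
    fix x assume x: "x \<in> ?V"
    show "\<tau> x \<in> ?V" "x \<otimes> inv (\<tau> x) \<in> U" using rep[OF x] by (auto simp: \<tau>_def eqv_def)
    show "\<tau> x = \<one> \<or>
       (\<exists>x' \<in> ?V. \<exists>s \<in> S. len x = Suc (len x') \<and> (\<tau> x = \<tau> x' \<otimes> s \<or> \<tau> x = \<tau> x' \<otimes> inv s))"
    proof (cases "len x")
      case 0
      then show ?thesis by (simp add: \<tau>_def rep_0)
    next
      case (Suc k)
      then have "N k (rep k) x (\<tau> x)" using rep[OF x] by (simp add: \<tau>_def)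
      then obtain x' a where "x' \<in> ?V" "a \<in> A" "len x' = k" "\<tau> x = rep k x' \<otimes> a"
        unfolding N_def by blast
      then show ?thesis using Suc by (auto simp: \<tau>_def A_def)
    qed
  next
    fix x y assume x: "x \<in> ?V" and y: "y \<in> ?V" and "x \<otimes> inv y \<in> U"
    then have "eqv x y" by (simp add: eqv_def)
    then have eq: "eqv x z = eqv y z" if "z \<in> ?V" for z
      using trans sym x y that by blast
    have len: "len x = len y"
      using eq adjV unfolding len_def by metis
    \<comment> \<open>Since \<open>N\<close> sees \<open>x\<close> only through its coset, the
      choice operator returns the same representative on the whole coset.\<close>
    have "N k (rep k) x z = N k (rep k) y z" for k z
    proof (cases "\<exists>x' \<in> ?V. \<exists>a \<in> A. len x' = k \<and> z = rep k x' \<otimes> a")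
      case True
      then have "z \<in> ?V" using rep Vm AV by auto
      then show ?thesis using eq by (simp add: N_def)
    next
      case False
      then show ?thesis by (auto simp: N_def)
    qed
    then have "N k (rep k) x = N k (rep k) y" for k by blast
    then have "rep k x = rep k y" for k
      by (cases k) (simp_all add: rep_0 rep_Suc)
    then show "\<tau> x = \<tau> y \<and> len x = len y" using len by (simp add: \<tau>_def)
  next
    have "len \<one> \<le> 0" using len_le[of \<one> 0 \<one>] refl generate.one[of G S] by simp
    then show "\<tau> \<one> = \<one>" by (simp add: \<tau>_def rep_0)
  qed
qed

text \<open>The edges with trivial Schreier generator \<open>g t s\<close> contain a spanning tree
  of the Schreier graph; the nontrivial generators form \<open>R\<close>. Freeness follows by
  lifting a labelling of the Cayley graph of \<open>R\<close> to that of \<open>S\<close> and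
  restricting the potential to \<open>U\<close>. The count only bounds \<open>card R\<close> from
  above; \<open>index_rank_lower_bound\<close> supplies the other direction.\<close>

theorem nielsen_schreier:
  assumes S: "free_set G S" and U: "subgroup U G" "U \<subseteq> generate G S"
  obtains R where "free_set G R" "generate G R = U"
    "\<And>T. finite S \<Longrightarrow> transversal G U (generate G S) T \<Longrightarrow> finite T \<Longrightarrow>
       finite R \<and> card R + card T \<le> card T * card S + 1"
proof -
  let ?V = "generate G S"
  have Sc: "S \<subseteq> carrier G" using S by (rule free_set_carrier)
  have gc: "y \<in> carrier G" if "y \<in> ?V" for y
    using Sc that generate_in_carrier by blast
  obtain \<tau> :: "'a \<Rightarrow> 'a" and len :: "'a \<Rightarrow> nat" where
    \<tau>V: "\<And>x. x \<in> ?V \<Longrightarrow> \<tau> x \<in> ?V" and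
    \<tau>U: "\<And>x. x \<in> ?V \<Longrightarrow> x \<otimes> inv (\<tau> x) \<in> U" and
    \<tau>eq: "\<And>x y. x \<in> ?V \<Longrightarrow> y \<in> ?V \<Longrightarrow> x \<otimes> inv y \<in> U \<Longrightarrow> \<tau> x = \<tau> y \<and> len x = len y" and
    \<tau>step: "\<And>x. x \<in> ?V \<Longrightarrow> \<tau> x = \<one> \<or>
       (\<exists>x' \<in> ?V. \<exists>s \<in> S. len x = Suc (len x') \<and> (\<tau> x = \<tau> x' \<otimes> s \<or> \<tau> x = \<tau> x' \<otimes> inv s))" and
    \<tau>1: "\<tau> \<one> = \<one>"
    by (rule schreier_transversal[OF Sc U]) (rule that)
  have Vm: "x \<otimes> y \<in> ?V" if "x \<in> ?V" "y \<in> ?V" for x y using that by (rule generate.eng)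
  have Vi: "inv x \<in> ?V" if "x \<in> ?V" for x using Sc that by (rule generate_m_inv_closed)
  have SV: "s \<in> ?V" if "s \<in> S" for s using that by (rule generate.incl)
  have UV: "u \<in> ?V" if "u \<in> U" for u using that U by blast
  have \<tau>u: "\<tau> (u \<otimes> x) = \<tau> x" if "u \<in> U" "x \<in> ?V" for u x
    using \<tau>eq[of "u \<otimes> x" x] that UV gc Vm by (simp add: m_assoc)
  have \<tau>\<tau>: "\<tau> (\<tau> x) = \<tau> x \<and> len (\<tau> x) = len x" if "x \<in> ?V" for x
    using \<tau>eq[OF that \<tau>V[OF that] \<tau>U[OF that]] by simp
  have \<tau>mult: "\<tau> (x \<otimes> y) = \<tau> (\<tau> x \<otimes> y)" if "x \<in> ?V" "y \<in> ?V" for x y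
  proof -
    have "(x \<otimes> y) \<otimes> inv (\<tau> x \<otimes> y) = x \<otimes> inv (\<tau> x)"
      using that gc \<tau>V by (simp add: inv_mult_group m_assoc)
    then show ?thesis using \<tau>eq[of "x \<otimes> y" "\<tau> x \<otimes> y"] that Vm \<tau>V \<tau>U by simp
  qed
  define g where "g t s = t \<otimes> s \<otimes> inv (\<tau> (t \<otimes> s))" for t s
  have gU: "g t s \<in> U" if "t \<in> ?V" "s \<in> S" for t s
    using that \<tau>U Vm SV by (simp add: g_def)
  define R where "R = {g (\<tau> x) s |x s. x \<in> ?V \<and> s \<in> S} - {\<one>}"
  have RU: "R \<subseteq> U" using gU \<tau>V by (auto simp: R_def)
  then have Rc: "R \<subseteq> carrier G" using UV gc by blast
  have gR: "g (\<tau> x) s \<in> generate G R" if "x \<in> ?V" "s \<in> S" for x s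
    using that by (cases "g (\<tau> x) s = \<one>") (auto simp: R_def intro: generate.one generate.incl)
  have key: "(x \<otimes> s) \<otimes> inv (\<tau> (x \<otimes> s)) = (x \<otimes> inv (\<tau> x)) \<otimes> g (\<tau> x) s" if "x \<in> ?V" "s \<in> S" for x s
  proof -
    have c: "x \<in> carrier G" "s \<in> carrier G" "\<tau> x \<in> carrier G" "\<tau> (\<tau> x \<otimes> s) \<in> carrier G"
      using that gc \<tau>V SV Vm by auto
    then show ?thesis
      unfolding g_def using \<tau>mult[OF that(1) SV[OF that(2)]] by (simp add: m_assoc)
  qed
  have in_gen: "x \<otimes> inv (\<tau> x) \<in> generate G R" if "x \<in> ?V" for x
    using Sc that
  proof (induction rule: generate_right_induct)
    case one
    then show ?case using \<tau>1 by (simp add: generate.one)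
  next
    case (mult y s)
    then show ?case using key gR by (simp add: generate.eng)
  next
    case (mult_inv y s)
    let ?z = "y \<otimes> inv s"
    have z: "?z \<in> ?V" using mult_inv Vm Vi SV by blast
    have zs: "?z \<otimes> s = y" using mult_inv gc SV by (simp add: m_assoc)
    have "y \<otimes> inv (\<tau> y) = (?z \<otimes> inv (\<tau> ?z)) \<otimes> g (\<tau> ?z) s" using key[OF z mult_inv(2)] zs by simp
    moreover have "?z \<otimes> inv (\<tau> ?z) \<in> carrier G" "g (\<tau> ?z) s \<in> carrier G"
      using z \<tau>U gU mult_inv \<tau>V UV gc by blast+
    ultimately have "?z \<otimes> inv (\<tau> ?z) = (y \<otimes> inv (\<tau> y)) \<otimes> inv (g (\<tau> ?z) s)"
      by (simp add: m_assoc)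
    moreover have "inv (g (\<tau> ?z) s) \<in> generate G R"
      using gR[OF z mult_inv(2)] generate_m_inv_closed[OF Rc] by blast
    ultimately show ?case using mult_inv by (simp add: generate.eng)
  qed
  have genR: "generate G R = U"
  proof
    show "generate G R \<subseteq> U" using generate_subgroup_incl[OF RU U(1)] .
    show "U \<subseteq> generate G R"
    proof
      fix u assume u: "u \<in> U"
      then have "\<tau> u = \<tau> \<one>" using \<tau>eq[of u \<one>] UV gc by (simp add: generate.one)
      then show "u \<in> generate G R" using in_gen[OF UV[OF u]] \<tau>1 u UV gc by simp
    qed
  qed
  have "\<exists>F. \<forall>x \<in> U. \<forall>y \<in> R. F (x \<otimes> y) = F x + c x y" for c :: "'a \<Rightarrow> 'a \<Rightarrow> int"
  proof -
    \<comment> \<open>Edges with trivial Schreier generator get the label 0, so the potential does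
      not change on the way from \<open>u\<close> to \<open>u \<otimes> \<tau> x\<close>. Every
      other edge gets the label of the edge of the Cayley graph of \<open>R\<close> which it
      represents.\<close>
    define c' where "c' x s = (if g (\<tau> x) s = \<one> then 0 else c (x \<otimes> inv (\<tau> x)) (g (\<tau> x) s))" for x s
    obtain F :: "'a \<Rightarrow> int" where F0: "F \<one> = 0" and F: "\<And>x s. x \<in> ?V \<Longrightarrow> s \<in> S \<Longrightarrow> F (x \<otimes> s) = F x + c' x s"
      by (rule free_set_potential[OF S, of c']) (rule that)
    have F\<tau>: "F (u \<otimes> \<tau> x) = F u" if u: "u \<in> U" and "x \<in> ?V" for u x
      using that(2)
    proof (induction "len x" arbitrary: x rule: less_induct)
      case less
      consider "\<tau> x = \<one>" | x' s where "x' \<in> ?V" "s \<in> S" "len x = Suc (len x')" "\<tau> x = \<tau> x' \<otimes> s"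
        | x' s where "x' \<in> ?V" "s \<in> S" "len x = Suc (len x')" "\<tau> x = \<tau> x' \<otimes> inv s"
        using \<tau>step[OF less.prems] by blast
      then show ?case
      proof cases
        case 1
        then show ?thesis using UV u gc by simp
      next
        case 2
        have V: "u \<in> ?V" "\<tau> x' \<in> ?V" "s \<in> ?V" "\<tau> x \<in> ?V" using 2(1,2) u UV \<tau>V SV less.prems by blast+
        have "g (\<tau> (u \<otimes> \<tau> x')) s = \<one>"
          using 2 V \<tau>u[OF u V(2)] \<tau>\<tau>[of x'] \<tau>\<tau>[of x] less.prems gc by (simp add: g_def flip: 2(4))
        then have "F (u \<otimes> \<tau> x' \<otimes> s) = F (u \<otimes> \<tau> x')"
          using F[of "u \<otimes> \<tau> x'" s] V Vm 2 by (simp add: c'_def)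
        moreover have "F (u \<otimes> \<tau> x') = F u" using less.hyps[of x'] 2 by simp
        ultimately show ?thesis using 2(4) V gc by (simp add: m_assoc)
      next
        case 3
        have V: "u \<in> ?V" "\<tau> x' \<in> ?V" "s \<in> ?V" "\<tau> x \<in> ?V" using 3(1,2) u UV \<tau>V SV less.prems by blast+
        have xs: "\<tau> x \<otimes> s = \<tau> x'" using 3(4) V gc by (simp add: m_assoc)
        have "g (\<tau> (u \<otimes> \<tau> x)) s = \<one>"
          using 3 V \<tau>u[OF u V(4)] \<tau>\<tau>[of x'] \<tau>\<tau>[of x] less.prems gc xs by (simp add: g_def)
        then have "F (u \<otimes> \<tau> x \<otimes> s) = F (u \<otimes> \<tau> x)"
          using F[of "u \<otimes> \<tau> x" s] V Vm 3 by (simp add: c'_def)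
        moreover have "F (u \<otimes> \<tau> x') = F u" using less.hyps[of x'] 3 by simp
        ultimately show ?thesis using xs V gc by (simp add: m_assoc)
      qed
    qed
    have "F (u \<otimes> y) = F u + c u y" if u: "u \<in> U" and y: "y \<in> R" for u y
    proof -
      obtain x s where xs: "x \<in> ?V" "s \<in> S" "y = g (\<tau> x) s" "y \<noteq> \<one>" using y by (auto simp: R_def)
      have V: "u \<in> ?V" "\<tau> x \<in> ?V" "s \<in> ?V" "\<tau> (\<tau> x \<otimes> s) \<in> ?V" "u \<otimes> \<tau> x \<in> ?V"
        using xs u UV \<tau>V SV Vm by auto
      have "u \<otimes> y \<in> U" using u y RU subgroup.m_closed[OF U(1)] by blast
      then have "F (u \<otimes> y) = F (u \<otimes> y \<otimes> \<tau> (\<tau> x \<otimes> s))" using F\<tau>[of "u \<otimes> y" "\<tau> x \<otimes> s"] V Vm by simp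
      also have "u \<otimes> y \<otimes> \<tau> (\<tau> x \<otimes> s) = u \<otimes> \<tau> x \<otimes> s"
        using V gc xs(3) by (simp add: g_def m_assoc)
      also have "F (u \<otimes> \<tau> x \<otimes> s) = F (u \<otimes> \<tau> x) + c' (u \<otimes> \<tau> x) s" using F V xs by blast
      also have "c' (u \<otimes> \<tau> x) s = c u y"
        using \<tau>u[OF u V(2)] \<tau>\<tau>[OF xs(1)] V gc xs by (simp add: c'_def m_assoc)
      finally show ?thesis using F\<tau>[OF u xs(1)] by simp
    qed
    then show ?thesis by blast
  qed
  then have free: "free_set G R" unfolding free_set_def genR using Rc by blast
  have card: "finite R \<and> card R + card T \<le> card T * card S + 1"
    if fS: "finite S" and T: "transversal G U ?V T" and fT: "finite T" for T
  proof -
    have TV: "t \<in> ?V" if "t \<in> T" for t using T that by (auto simp: transversal_def)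
    have inj: "inj_on \<tau> T"
    proof (rule inj_onI)
      fix t t' assume t: "t \<in> T" "t' \<in> T" "\<tau> t = \<tau> t'"
      have "(t \<otimes> inv (\<tau> t)) \<otimes> inv (t' \<otimes> inv (\<tau> t')) \<in> U"
        using \<tau>U TV t subgroup.m_closed[OF U(1)] subgroup.m_inv_closed[OF U(1)] by blast
      moreover have "(t \<otimes> inv (\<tau> t)) \<otimes> inv (t' \<otimes> inv (\<tau> t')) = t \<otimes> inv t'"
        using t TV \<tau>V gc by (simp add: inv_mult_group m_assoc)
      ultimately have "t \<otimes> inv t' \<in> U" by simp
      moreover have "t \<otimes> inv t \<in> U" using t TV gc subgroup.one_closed[OF U(1)] by simp
      ultimately show "t = t'" using T t TV unfolding transversal_def by blast
    qed
    have "\<tau> ` ?V \<subseteq> \<tau> ` T"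
    proof
      fix y assume "y \<in> \<tau> ` ?V"
      then obtain x where x: "x \<in> ?V" "y = \<tau> x" by blast
      then obtain t where "t \<in> T" "x \<otimes> inv t \<in> U" using T by (auto simp: transversal_def)
      then show "y \<in> \<tau> ` T" using \<tau>eq[of x t] TV x by blast
    qed
    then have \<tau>VT: "\<tau> ` ?V = \<tau> ` T" using TV by blast
    let ?T = "\<tau> ` T"
    have fin: "finite ?T" and cardT: "card ?T = card T" using fT inj by (auto simp: card_image)
    define E where "E = {(t, s) \<in> ?T \<times> S. g t s = \<one>}"
    \<comment> \<open>Each representative other than \<open>\<one>\<close> is the far end of the
      last edge of its geodesic, and this edge belongs to \<open>E\<close>. Hence at least
      \<open>card T - 1\<close> of the \<open>card T * card S\<close> edges give a trivial
      generator.\<close>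
    define far where "far = (\<lambda>(t, s). if len (t \<otimes> s) > len t then t \<otimes> s else t)"
    have "?T - {\<one>} \<subseteq> far ` E"
    proof
      fix t assume "t \<in> ?T - {\<one>}"
      then obtain x where x: "x \<in> ?V" "t = \<tau> x" "\<tau> x \<noteq> \<one>" using TV by blast
      consider x' s where "x' \<in> ?V" "s \<in> S" "len x = Suc (len x')" "\<tau> x = \<tau> x' \<otimes> s"
        | x' s where "x' \<in> ?V" "s \<in> S" "len x = Suc (len x')" "\<tau> x = \<tau> x' \<otimes> inv s"
        using \<tau>step[OF x(1)] x by blast
      then show "t \<in> far ` E"
      proof cases
        case 1
        then have "(\<tau> x', s) \<in> E"
          using x \<tau>\<tau>[of x] \<tau>VT \<tau>V gc by (auto simp: E_def g_def simp flip: 1(4))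
        moreover have "far (\<tau> x', s) = t"
          using 1 x \<tau>\<tau>[of x] \<tau>\<tau>[of x'] by (simp add: far_def flip: 1(4))
        ultimately show ?thesis by (metis image_eqI)
      next
        case 2
        have xs: "\<tau> x \<otimes> s = \<tau> x'" using 2 x gc \<tau>V SV by (simp add: m_assoc)
        moreover have "\<tau> x \<in> ?T" using x \<tau>VT by blast
        ultimately have "(\<tau> x, s) \<in> E"
          using 2 \<tau>\<tau>[of x'] \<tau>V gc by (simp add: E_def g_def)
        moreover have "far (\<tau> x, s) = t"
          using 2 x \<tau>\<tau>[of x] \<tau>\<tau>[of x'] xs by (simp add: far_def)
        ultimately show ?thesis by (metis image_eqI)
      qed
    qed
    moreover have fE: "finite E" by (rule finite_subset[of _ "?T \<times> S"]) (use fin fS in \<open>auto simp: E_def\<close>)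
    ultimately have "card (?T - {\<one>}) \<le> card E" by (rule surj_card_le[rotated])
    moreover have "card ?T \<le> card (?T - {\<one>}) + 1" by (auto simp: card_Diff_singleton_if)
    ultimately have cE: "card T \<le> card E + 1" using cardT by linarith
    have R_eq: "R \<subseteq> (\<lambda>(t, s). g t s) ` (?T \<times> S - E)"
      unfolding R_def E_def \<tau>VT[symmetric] by auto
    have "card R \<le> card (?T \<times> S - E)"
      using R_eq fin fS by (intro surj_card_le) auto
    also have "\<dots> = card (?T \<times> S) - card E"
      using fE by (intro card_Diff_subset) (auto simp: E_def)
    finally have "card R \<le> card T * card S - card E"
      using cardT by (simp add: card_cartesian_product)
    moreover have "card E \<le> card T * card S"
      using card_mono[of "?T \<times> S" E] fin fS cardT by (auto simp: E_def card_cartesian_product)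
    moreover have "finite R" using R_eq fin fS by (meson finite_Diff finite_SigmaI finite_imageI finite_subset)
    ultimately show ?thesis using cE by linarith
  qed
  show ?thesis using that[OF free genR card] .
qed

lemma free_set_finite:
  assumes R: "free_set G R" and S: "S \<subseteq> carrier G" "finite S" "generate G S = generate G R"
  shows "finite R \<and> card R \<le> card S"
proof -
  have *: "card R' \<le> card S" if "finite R'" "R' \<subseteq> R" for R'
  proof (rule card_extends_additively_le[OF S(1,2)])
    show "R' \<subseteq> generate G S" using that S(3) by (auto intro: generate.incl)
    show "extends_additively G R' (generate G S)"
      using extends_additively_mono[OF free_set_extends_additively[OF R] that(2)] S(3) by simp
  qed (rule that)
  have "finite R"
  proof (rule ccontr)
    assume "infinite R"
    then obtain R' where "R' \<subseteq> R" "card R' = Suc (card S)" "finite R'"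
      using infinite_arbitrarily_large by blast
    then show False using * by fastforce
  qed
  then show ?thesis using * by blast
qed

lemma free_set_notin_generate:
  assumes "free_set G (S \<union> Z)" "z \<in> Z" "z \<notin> S"
  shows "z \<notin> generate G S"
proof
  assume z: "z \<in> generate G S"
  have S: "S \<subseteq> carrier G" using free_set_carrier[OF assms(1)] by blast
  obtain h where h: "additive_on G (generate G (S \<union> Z)) h"
    "\<And>t. t \<in> S \<union> Z \<Longrightarrow> h t = (if t \<in> S then 0 else 1)"
    using extends_additivelyD[OF free_set_extends_additively[OF assms(1)], of "\<lambda>t. if t \<in> S then 0 else 1"]
    by blast
  have SZ: "S \<subseteq> generate G (S \<union> Z)" by (auto intro: generate.incl)
  have "h z = 0"
    by (rule additive_on_vanish[OF h(1) _ SZ _ z])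
      (use h(2) free_set_carrier[OF assms(1)] in \<open>auto intro: generate_is_subgroup\<close>)
  then show False using h(2)[of z] assms by force
qed

text \<open>
  The conclusion of the Kurosh subgroup theorem in cohomological form: the vertex groups of \<open>U\<close>
  acting on the Bass--Serre tree of the free product of \<open>\<langle>S\<rangle>\<close> and the \<open>\<langle>z\<rangle>\<close> are independent.
\<close>

lemma kurosh_extends_additively:
  assumes free: "free_set G (S \<union> Z)" and disj: "S \<inter> Z = {}"
    and U: "subgroup U G" "U \<subseteq> generate G (S \<union> Z)" and ZU: "Z \<subseteq> U"
    and T: "T \<subseteq> U \<inter> generate G S" "extends_additively G T (U \<inter> generate G S)"
  shows "extends_additively G (T \<union> Z) U"
  unfolding extends_additively_def
proof
  fix f :: "'a \<Rightarrow> int"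
  let ?V = "generate G (S \<union> Z)" and ?A = "generate G S"
  define M where "M = U \<inter> ?A"
  have SZc: "S \<union> Z \<subseteq> carrier G" using free by (rule free_set_carrier)
  then have Sc: "S \<subseteq> carrier G" by blast
  have AV: "?A \<subseteq> ?V" by (rule mono_generate) auto
  have gc: "y \<in> carrier G" if "y \<in> ?V" for y
    using SZc that generate_in_carrier by blast
  have Ac: "y \<in> carrier G" if "y \<in> ?A" for y
    using Sc that generate_in_carrier by blast
  have A: "subgroup ?A G" using Sc by (rule generate_is_subgroup)
  have M: "subgroup M G" unfolding M_def using subgroups_Inter_pair[OF U(1) A] .
  have Uc: "y \<in> carrier G" if "y \<in> U" for y using that U gc by blast
  obtain \<phi> where \<phi>: "additive_on G M \<phi>" "\<And>t. t \<in> T \<Longrightarrow> \<phi> t = f t"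
    using extends_additivelyD[OF T(2), of f] by (auto simp: M_def)
  define \<rho> where "\<rho> a = (SOME b. b \<in> ?A \<and> a \<otimes> inv b \<in> M)" for a
  have \<rho>: "\<rho> a \<in> ?A" "a \<otimes> inv (\<rho> a) \<in> M" if "a \<in> ?A" for a
  proof -
    have "a \<in> ?A \<and> a \<otimes> inv a \<in> M" using that Ac subgroup.one_closed[OF M] by simp
    then have "\<rho> a \<in> ?A \<and> a \<otimes> inv (\<rho> a) \<in> M" unfolding \<rho>_def by (rule someI)
    then show "\<rho> a \<in> ?A" "a \<otimes> inv (\<rho> a) \<in> M" by auto
  qed
  have coset: "w \<otimes> a \<otimes> inv b \<in> W \<longleftrightarrow> a \<otimes> inv b \<in> W"
    if W: "subgroup W G" and "w \<in> W" "a \<in> carrier G" "b \<in> carrier G" for W w a b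
  proof -
    have w: "w \<in> carrier G" using that subgroup.mem_carrier by metis
    then have eq: "w \<otimes> a \<otimes> inv b = w \<otimes> (a \<otimes> inv b)" using that by (simp add: m_assoc)
    show ?thesis
    proof
      assume "w \<otimes> a \<otimes> inv b \<in> W"
      then have "inv w \<otimes> (w \<otimes> (a \<otimes> inv b)) \<in> W"
        unfolding eq using that subgroup.m_closed[OF W] subgroup.m_inv_closed[OF W] by blast
      then show "a \<otimes> inv b \<in> W" using w that by simp
    next
      assume "a \<otimes> inv b \<in> W"
      then show "w \<otimes> a \<otimes> inv b \<in> W" unfolding eq using that subgroup.m_closed[OF W] by blast
    qed
  qed
  \<comment> \<open>\<open>\<Phi>\<close> carries \<open>\<phi>\<close> from \<open>M\<close> to all
    of \<open>generate G S\<close>: it is equivariant under \<open>M\<close>, so its gradient is an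
    \<open>M\<close>-invariant labelling.\<close>
  define \<Phi> where "\<Phi> a = \<phi> (a \<otimes> inv (\<rho> a))" for a
  have \<Phi>: "\<Phi> (w \<otimes> a) = \<phi> w + \<Phi> a" if "w \<in> M" "a \<in> ?A" for w a
  proof -
    have "b \<in> ?A \<and> w \<otimes> a \<otimes> inv b \<in> M \<longleftrightarrow> b \<in> ?A \<and> a \<otimes> inv b \<in> M" for b
      using coset[OF M that(1)] that Ac by blast
    then have "\<rho> (w \<otimes> a) = \<rho> a" unfolding \<rho>_def by simp
    moreover have "w \<otimes> a \<otimes> inv (\<rho> a) = w \<otimes> (a \<otimes> inv (\<rho> a))"
      using that Ac \<rho>(1)[OF that(2)] by (simp add: m_assoc M_def)
    ultimately show ?thesis
      using additive_onD[OF \<phi>(1) that(1) \<rho>(2)[OF that(2)]] by (simp add: \<Phi>_def)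
  qed
  define P where "P x a \<longleftrightarrow> a \<in> ?A \<and> x \<otimes> inv a \<in> U" for x a
  \<comment> \<open>A \<open>U\<close>-invariant labelling. If \<open>x\<close> lies in a coset
    \<open>U a\<close> with \<open>a\<close> in \<open>generate G S\<close>, its
    \<open>S\<close>-edges carry the gradient of \<open>\<Phi>\<close> at \<open>a\<close>; the
    \<open>Z\<close>-edges which start in \<open>U\<close> carry \<open>f\<close>; all other labels
    are 0. The choice of \<open>a\<close> is immaterial because \<open>\<Phi>\<close> is equivariant
    under \<open>M\<close>.\<close>
  define c where "c x s =
    (if s \<in> S then if \<exists>a. P x a then \<Phi> ((SOME a. P x a) \<otimes> s) - \<Phi> (SOME a. P x a) else 0
     else if x \<in> U then f s else 0)" for x s
  have P_u: "P (u \<otimes> x) = P x" if "u \<in> U" "x \<in> ?V" for u x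
    unfolding P_def using coset[OF U(1) that(1)] gc[OF that(2)] Ac by blast
  have U_u: "u \<otimes> x \<in> U \<longleftrightarrow> x \<in> U" if "u \<in> U" "x \<in> ?V" for u x
    using coset[OF U(1) that(1) gc[OF that(2)] one_closed] that gc Uc by simp
  have c_u: "c (u \<otimes> x) s = c x s" if "u \<in> U" "x \<in> ?V" for u x s
    unfolding c_def P_u[OF that] U_u[OF that] ..
  have c_A: "c a s = \<Phi> (a \<otimes> s) - \<Phi> a" if "a \<in> ?A" "s \<in> S" for a s
  proof -
    have "P a a" using that Ac subgroup.one_closed[OF U(1)] by (simp add: P_def)
    define b where "b = (SOME b. P a b)"
    have "P a b" unfolding b_def using \<open>P a a\<close> by (rule someI)
    then have b: "b \<in> ?A" "a \<otimes> inv b \<in> U" by (auto simp: P_def)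
    have sA: "s \<in> ?A" using that by (auto intro: generate.incl)
    have w: "a \<otimes> inv b \<in> M" using b that subgroup.m_closed[OF A] subgroup.m_inv_closed[OF A] by (simp add: M_def)
    have "a = (a \<otimes> inv b) \<otimes> b" "a \<otimes> s = (a \<otimes> inv b) \<otimes> (b \<otimes> s)" using that b Ac sA by (simp_all add: m_assoc)
    then have "\<Phi> a = \<phi> (a \<otimes> inv b) + \<Phi> b" "\<Phi> (a \<otimes> s) = \<phi> (a \<otimes> inv b) + \<Phi> (b \<otimes> s)"
      using \<Phi>[OF w b(1)] \<Phi>[OF w, of "b \<otimes> s"] b(1) sA by (simp_all add: generate.eng)
    moreover have "c a s = \<Phi> (b \<otimes> s) - \<Phi> b"
      using that(2) \<open>P a a\<close> unfolding c_def b_def by auto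
    ultimately show ?thesis by simp
  qed
  obtain F :: "'a \<Rightarrow> int" where F1: "F \<one> = 0"
    and F: "\<And>x s. x \<in> ?V \<Longrightarrow> s \<in> S \<union> Z \<Longrightarrow> F (x \<otimes> s) = F x + c x s"
    by (rule free_set_potential[OF free, of c]) (rule that)
  have "F (u \<otimes> x) = F u + F x" if "u \<in> U" "x \<in> U" for u x
  proof (rule potential_translate[OF SZc F1 F])
    show "c (u \<otimes> y) s = c y s" if "y \<in> ?V" for y s
      using c_u[OF \<open>u \<in> U\<close> that] .
  qed (use that U in auto)
  then have "additive_on G U F" by (simp add: additive_on_def)
  moreover have "F t = f t" if t: "t \<in> T \<union> Z" for t
  proof (cases "t \<in> Z")
    case True
    then have "t \<notin> S" using disj by blast
    then have "c \<one> t = f t" using subgroup.one_closed[OF U(1)] by (simp add: c_def)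
    then show ?thesis using F[of \<one> t] True F1 SZc by (auto simp: generate.one subsetD)
  next
    case False
    then have "t \<in> T" using t by blast
    then have tM: "t \<in> M" and tA: "t \<in> ?A" using T by (auto simp: M_def)
    have "F t - F \<one> = \<Phi> t - \<Phi> \<one>"
    proof (rule potential_unique[OF Sc _ tA])
      fix x s assume "x \<in> ?A" "s \<in> S"
      then show "F (x \<otimes> s) - F x = \<Phi> (x \<otimes> s) - \<Phi> x"
        using F[of x s] c_A[of x s] AV by auto
    qed
    moreover have "\<Phi> t = \<phi> t + \<Phi> \<one>"
      using \<Phi>[OF tM, of \<one>] tA Ac by (simp add: generate.one)
    ultimately show ?thesis using F1 \<phi>(2)[OF \<open>t \<in> T\<close>] by simp
  qed
  ultimately show "\<exists>h. additive_on G U h \<and> (\<forall>t\<in>T \<union> Z. h t = f t)" by blast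
qed

lemma free_set_image:
  fixes H :: "('c, 'd) monoid_scheme"
  assumes free: "free_set G S" and \<psi>: "group_hom G H \<psi>" and inj: "inj_on \<psi> (generate G S)"
  shows "free_set H (\<psi> ` S)"
proof -
  interpret \<psi>: group_hom G H \<psi> by (rule \<psi>)
  have S: "S \<subseteq> carrier G" using free by (rule free_set_carrier)
  have gc: "y \<in> carrier G" if "y \<in> generate G S" for y
    using S that generate_in_carrier by blast
  have gen: "generate H (\<psi> ` S) = \<psi> ` generate G S" using \<psi>.generate_img[OF S] by simp
  have "\<exists>F. \<forall>x \<in> \<psi> ` generate G S. \<forall>s \<in> \<psi> ` S. F (x \<otimes>\<^bsub>H\<^esub> s) = F x + c x s" for c :: "'c \<Rightarrow> 'c \<Rightarrow> int"
  proof -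
    obtain F :: "'a \<Rightarrow> int" where F: "\<forall>x \<in> generate G S. \<forall>s \<in> S. F (x \<otimes> s) = F x + c (\<psi> x) (\<psi> s)"
      using free_setD[OF free, of "\<lambda>x s. c (\<psi> x) (\<psi> s)"] by blast
    let ?F = "\<lambda>y. F (inv_into (generate G S) \<psi> y)"
    have "?F (\<psi> x \<otimes>\<^bsub>H\<^esub> \<psi> s) = ?F (\<psi> x) + c (\<psi> x) (\<psi> s)" if "x \<in> generate G S" "s \<in> S" for x s
    proof -
      have s: "s \<in> generate G S" and xs: "x \<otimes> s \<in> generate G S"
        using that by (auto intro: generate.intros)
      have "\<psi> x \<otimes>\<^bsub>H\<^esub> \<psi> s = \<psi> (x \<otimes> s)" using that s gc by simp
      then show ?thesis using F that xs inv_into_f_f[OF inj] by simp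
    qed
    then show ?thesis by (intro exI[of _ ?F]) blast
  qed
  then show ?thesis unfolding free_set_def gen using S by auto
qed

section \<open>Ranks, cosets and indices of subgroups\<close>

lemma fg_iff:
  assumes "subgroup U G"
  shows "fg G U \<longleftrightarrow> (\<exists>S. S \<subseteq> U \<and> finite S \<and> generate G S = U)"
  using generate_consistent[OF _ assms] unfolding finitely_generated_def by auto

lemma fgI:
  assumes "S \<subseteq> carrier G" "finite S" "generate G S = U"
  shows "fg G U"
  using fg_iff[of U] assms generate_is_subgroup[OF assms(1)] by (auto intro: generate.incl)

lemma rank_of_le:
  assumes "S \<subseteq> carrier G" "finite S" "generate G S = U"
  shows "rank_of G U \<le> card S"
proof -
  have "S \<subseteq> U" using assms by (auto intro: generate.incl)
  then have "generate (G\<lparr>carrier := U\<rparr>) S = U"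
    using generate_consistent[OF _ generate_is_subgroup[OF assms(1)], of S] assms by simp
  then show ?thesis
    unfolding group_rank_def using \<open>S \<subseteq> U\<close> assms(2) by (intro Least_le) auto
qed

lemma rank_of_generators:
  assumes U: "subgroup U G" and "fg G U"
  obtains S where "S \<subseteq> U" "finite S" "card S = rank_of G U" "generate G S = U"
proof -
  let ?P = "\<lambda>k. \<exists>S. S \<subseteq> carrier (G\<lparr>carrier := U\<rparr>) \<and> finite S \<and> card S = k \<and>
    generate (G\<lparr>carrier := U\<rparr>) S = carrier (G\<lparr>carrier := U\<rparr>)"
  have "\<exists>k. ?P k" using assms(2) unfolding finitely_generated_def by blast
  then have "?P (rank_of G U)" unfolding group_rank_def by (rule LeastI_ex)
  then show ?thesis using that generate_consistent[OF _ U] by auto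
qed

lemma rank_of_ge:
  assumes "subgroup U G" "fg G U" "T \<subseteq> U" "finite T" "extends_additively G T U"
  shows "card T \<le> rank_of G U"
proof -
  obtain S where S: "S \<subseteq> U" "finite S" "card S = rank_of G U" "generate G S = U"
    using rank_of_generators[OF assms(1,2)] .
  moreover have "S \<subseteq> carrier G" using S subgroup.subset[OF assms(1)] by blast
  ultimately show ?thesis using card_extends_additively_le[of S T] assms by metis
qed

lemma rank_of_free:
  assumes "free_set G S" "finite S"
  shows "rank_of G (generate G S) = card S"
proof (rule antisym)
  have S: "S \<subseteq> carrier G" using assms(1) by (rule free_set_carrier)
  show "rank_of G (generate G S) \<le> card S" by (rule rank_of_le[OF S assms(2)]) simp
  show "card S \<le> rank_of G (generate G S)"
  proof (rule rank_of_ge)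
    show "fg G (generate G S)" using fgI[OF S assms(2)] by simp
    show "extends_additively G S (generate G S)" using assms(1) by (rule free_set_extends_additively)
  qed (use S assms(2) in \<open>auto intro: generate_is_subgroup generate.incl\<close>)
qed

lemma free_basis:
  assumes S: "free_set G S" and U: "subgroup U G" "U \<subseteq> generate G S" and fg: "fg G U"
  obtains R where "free_set G R" "finite R" "generate G R = U" "card R = rank_of G U"
proof (rule nielsen_schreier[OF S U])
  fix R assume R: "free_set G R" "generate G R = U"
  obtain B where B: "B \<subseteq> U" "finite B" "generate G B = U"
    using fg fg_iff[OF U(1)] by blast
  have "finite R"
    using free_set_finite[OF R(1) _ B(2)] B R subgroup.subset[OF U(1)] by auto
  then show thesis using that[OF R(1) _ R(2)] rank_of_free[OF R(1)] R(2) by simp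
qed

text \<open>The Schreier index formula \<open>rank U - 1 = card T * (rank V - 1)\<close>, obtained
  from the two opposite estimates; adding \<open>card T\<close> on both sides avoids truncated
  subtraction.\<close>

lemma finite_index_subgroup:
  assumes S: "free_set G S" and V: "subgroup V G" "V \<subseteq> generate G S" "fg G V" 
    and U: "subgroup U G" "U \<subseteq> V" and T: "transversal G U V T" "finite T"
  shows "fg G U" and "rank_of G U + card T = card T * rank_of G V + 1"
proof -
  obtain B where B: "free_set G B" "finite B" "generate G B = V" "card B = rank_of G V"
    using free_basis[OF S V] .
  obtain R where R: "free_set G R" "generate G R = U"
    "finite R" "card R + card T \<le> card T * card B + 1"
    using nielsen_schreier[OF B(1) U(1)] U(2) B T by metis
  show "fg G U" using fgI[OF free_set_carrier[OF R(1)] R(3,2)] .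
  have "card T * card B + 1 \<le> card R + card T"
    using index_rank_lower_bound[OF B(1,2) _ free_set_carrier[OF R(1)] R(3,2), of T] B(3) U(2) T by simp
  then show "rank_of G U + card T = card T * rank_of G V + 1"
    using R(4) B(4) rank_of_free[OF R(1,3)] R(2) by simp
qed

lemma group_hom_conj:
  assumes "a \<in> carrier G"
  shows "group_hom G G (\<lambda>x. a \<otimes> x \<otimes> inv a)" "inj_on (\<lambda>x. a \<otimes> x \<otimes> inv a) (carrier G)"
  using assms by (auto intro!: group_hom.intro group_hom_axioms.intro homI inj_onI simp: m_assoc is_group)

lemma free_set_conj:
  assumes "a \<in> carrier G" "free_set G S"
  shows "free_set G ((\<lambda>x. a \<otimes> x \<otimes> inv a) ` S)"
  using free_set_image[OF assms(2) group_hom_conj(1)[OF assms(1)]] group_hom_conj(2)[OF assms(1)]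
    generate_incl[OF free_set_carrier[OF assms(2)]] by (blast intro: inj_on_subset)

lemma generate_conj:
  assumes "a \<in> carrier G" "S \<subseteq> carrier G"
  shows "generate G ((\<lambda>x. a \<otimes> x \<otimes> inv a) ` S) = (\<lambda>x. a \<otimes> x \<otimes> inv a) ` generate G S"
  using group_hom.generate_img[OF group_hom_conj(1)[OF assms(1)] assms(2)] by simp

lemma subgroup_conj:
  assumes "a \<in> carrier G" "subgroup U G"
  shows "subgroup ((\<lambda>x. a \<otimes> x \<otimes> inv a) ` U) G"
  using group_hom.subgroup_img_is_subgroup[OF group_hom_conj(1)[OF assms(1)] assms(2)] .

lemma one_notin_free_set:
  assumes "free_set G S" shows "\<one> \<notin> S"
proof
  assume "\<one> \<in> S"
  then show False
    using free_setD[OF assms, of "\<lambda>_ _. 1"] generate.one[of G S] free_set_carrier[OF assms] by fastforce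
qed

text \<open>It suffices to integrate the indicator functions of the edges \<open>\<one> \<rightarrow> s\<close> of the Cayley graph.\<close>

lemma free_setI_edges:
  assumes S: "S \<subseteq> carrier G"
    and ex: "\<And>s. s \<in> S \<Longrightarrow> \<exists>F :: 'a \<Rightarrow> int. \<forall>x \<in> generate G S. \<forall>t \<in> S.
      F (x \<otimes> t) = F x + (if x = \<one> \<and> t = s then 1 else 0)"
  shows "free_set G S"
  unfolding free_set_def
proof (intro conjI allI)
  fix c :: "'a \<Rightarrow> 'a \<Rightarrow> int"
  let ?V = "generate G S"
  have gc: "y \<in> carrier G" if "y \<in> ?V" for y
    using S that generate_in_carrier by blast
  obtain F :: "'a \<Rightarrow> 'a \<Rightarrow> int" where F: "\<And>s x t. s \<in> S \<Longrightarrow> x \<in> ?V \<Longrightarrow> t \<in> S \<Longrightarrow>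
      F s (x \<otimes> t) = F s x + (if x = \<one> \<and> t = s then 1 else 0)"
    using ex by metis
  \<comment> \<open>\<open>\<delta> g p\<close> is the signed number of crossings of the edge
    \<open>p = (x, s)\<close> on any path from \<open>\<one>\<close> to \<open>g\<close>. Only
    finitely many edges are crossed, so any labelling can be integrated by summing over
    them.\<close>
  define \<delta> where "\<delta> g p = (if p \<in> ?V \<times> S then F (snd p) (inv (fst p) \<otimes> g) - F (snd p) (inv (fst p)) else 0)" for g p
  have \<delta>_mult: "\<delta> (g \<otimes> t) p = \<delta> g p + (if p = (g, t) then 1 else 0)" if "g \<in> ?V" "t \<in> S" for g t p
  proof (cases "p \<in> ?V \<times> S")
    case True
    then obtain x s where p: "p = (x, s)" "x \<in> ?V" "s \<in> S" by blast
    have xg: "inv x \<otimes> g \<in> ?V" using p that generate_m_inv_closed[OF S] by (simp add: generate.eng)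
    have "inv x \<otimes> (g \<otimes> t) = inv x \<otimes> g \<otimes> t" using that p gc S by (simp add: m_assoc subsetD)
    moreover have "inv x \<otimes> g = \<one> \<longleftrightarrow> x = g"
      using that p gc by (metis inv_closed inv_equality inv_inv l_inv)
    ultimately show ?thesis using F[OF p(3) xg that(2)] p by (auto simp: \<delta>_def)
  next
    case False
    then show ?thesis using that by (auto simp: \<delta>_def)
  qed
  define supp where "supp g = {p. \<delta> g p \<noteq> 0}" for g
  have fin: "finite (supp g)" if "g \<in> ?V" for g
    using S that
  proof (induction rule: generate_right_induct)
    case one
    have "supp \<one> = {}" using gc by (auto simp: supp_def \<delta>_def)
    then show ?case by simp
  next
    case (mult y s)
    have "supp (y \<otimes> s) \<subseteq> insert (y, s) (supp y)"
      using \<delta>_mult[OF mult(1,2)] by (auto simp: supp_def)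
    then show ?case using mult(3) by (meson finite.insertI finite_subset)
  next
    case (mult_inv y s)
    let ?z = "y \<otimes> inv s"
    have z: "?z \<in> ?V" using mult_inv by (auto intro: generate.intros)
    have zs: "?z \<otimes> s = y" using mult_inv gc S by (simp add: m_assoc subsetD)
    have "supp ?z \<subseteq> insert (?z, s) (supp y)"
      using \<delta>_mult[OF z mult_inv(2)] unfolding zs by (auto simp: supp_def)
    then show ?case using mult_inv(3) by (meson finite.insertI finite_subset)
  qed
  define \<Phi> where "\<Phi> g = (\<Sum>p \<in> supp g. c (fst p) (snd p) * \<delta> g p)" for g
  have "\<Phi> (g \<otimes> t) = \<Phi> g + c g t" if g: "g \<in> ?V" and t: "t \<in> S" for g t
  proof -
    have gt: "g \<otimes> t \<in> ?V" using g t by (auto intro: generate.intros)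
    define W where "W = insert (g, t) (supp g \<union> supp (g \<otimes> t))"
    have W: "finite W" using fin g gt by (simp add: W_def)
    have eq: "\<Phi> x = (\<Sum>p \<in> W. c (fst p) (snd p) * \<delta> x p)" if "supp x \<subseteq> W" for x
      unfolding \<Phi>_def using W that by (intro sum.mono_neutral_left) (auto simp: supp_def)
    have "\<Phi> (g \<otimes> t) = (\<Sum>p \<in> W. c (fst p) (snd p) * \<delta> (g \<otimes> t) p)"
      by (rule eq) (auto simp: W_def)
    also have "\<dots> = (\<Sum>p \<in> W. c (fst p) (snd p) * \<delta> g p + (if p = (g, t) then c g t else 0))"
      by (rule sum.cong) (auto simp: \<delta>_mult[OF g t] distrib_left)
    also have "\<dots> = (\<Sum>p \<in> W. c (fst p) (snd p) * \<delta> g p) + c g t"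
      using W by (simp add: sum.distrib W_def)
    also have "\<dots> = \<Phi> g + c g t" by (subst eq) (auto simp: W_def)
    finally show ?thesis .
  qed
  then show "\<exists>F. \<forall>x \<in> ?V. \<forall>s \<in> S. F (x \<otimes> s) = F x + c x s" by blast
qed (rule S)

text \<open>Distinct powers of \<open>x\<close> lie in distinct cosets of \<open>K\<close>, since
  \<open>h\<close> is constant on these cosets within \<open>W\<close> but injective on the
  powers.\<close>

lemma finite_index_powers:
  assumes h: "additive_on G W h" and W: "subgroup W G" and K: "K \<subseteq> W" "\<And>x. x \<in> K \<Longrightarrow> h x = 0"
    and x: "x \<in> P" "x \<in> W" "h x \<noteq> 0" and P: "subgroup P G" and KP: "subgroup K G"
  shows "\<not> finite_index G (P \<inter> K) P"
proof
  assume "finite_index G (P \<inter> K) P"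
  then obtain T where T: "finite T" "T \<subseteq> P" "\<forall>x \<in> P. \<exists>t \<in> T. x \<otimes> inv t \<in> P \<inter> K"
    unfolding finite_index_def by blast
  have powP: "x [^] (i::nat) \<in> P" for i
    using x(1) P by (induction i) (auto intro: subgroup.m_closed subgroup.one_closed)
  have powW: "x [^] (i::nat) \<in> W \<and> h (x [^] i) = int i * h x" for i
    using x(2) W additive_on_one[OF h]
    by (induction i) (auto intro: subgroup.m_closed subgroup.one_closed simp: additive_onD[OF h] distrib_right)
  have Wc: "y \<in> carrier G" if "y \<in> W" for y using that W subgroup.mem_carrier by metis
  have Pc: "y \<in> carrier G" if "y \<in> P" for y using that P subgroup.mem_carrier by metis
  have "\<forall>i :: nat. \<exists>t. t \<in> T \<and> x [^] i \<otimes> inv t \<in> K" using T(3) powP by blast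
  then obtain f where f: "\<And>i :: nat. f i \<in> T \<and> x [^] i \<otimes> inv (f i) \<in> K"
    by (metis choice)
  have "\<not> inj f"
    using T(1) f finite_subset[of "range f" T] infinite_UNIV_nat finite_imageD by blast
  then obtain i j where ij: "i \<noteq> j" "f i = f j" by (auto simp: inj_def)
  have fc: "f i \<in> carrier G" using f T Pc by blast
  have "(x [^] i \<otimes> inv (f i)) \<otimes> inv (x [^] j \<otimes> inv (f i)) \<in> K"
    using f[of i] f[of j] ij(2) subgroup.m_closed[OF KP] subgroup.m_inv_closed[OF KP] by simp
  moreover have "(x [^] i \<otimes> inv (f i)) \<otimes> inv (x [^] j \<otimes> inv (f i)) = x [^] i \<otimes> inv (x [^] j)"
    using fc Wc[OF x(2)] by (simp add: inv_mult_group m_assoc)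
  ultimately have "h (x [^] i \<otimes> inv (x [^] j)) = 0" using K(2) by simp
  moreover have "inv (x [^] j) \<in> W" using powW[of j] subgroup.m_inv_closed[OF W] by blast
  ultimately have "h (x [^] i) - h (x [^] j) = 0"
    using additive_onD[OF h, of "x [^] i" "inv (x [^] j)"] additive_on_inv[OF h W, of "x [^] j"] powW by simp
  then show False using powW[of i] powW[of j] ij(1) x(3) by (simp flip: left_diff_distrib)
qed

lemma transversal_of_map:
  assumes f: "\<And>x y. x \<in> V \<Longrightarrow> y \<in> V \<Longrightarrow> x \<otimes> inv y \<in> U \<longleftrightarrow> f x = f y"
  obtains T where "transversal G U V T" "card T = card (f ` V)" "finite T \<longleftrightarrow> finite (f ` V)"
proof -
  let ?T = "inv_into V f ` (f ` V)"
  have inj: "inj_on (inv_into V f) (f ` V)" by (rule inj_on_inv_into) simp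
  have TV: "?T \<subseteq> V" by (auto intro: inv_into_into)
  have "\<exists>!t. t \<in> ?T \<and> x \<otimes> inv t \<in> U" if x: "x \<in> V" for x
  proof (rule ex1I[of _ "inv_into V f (f x)"])
    have "inv_into V f (f x) \<in> V" "f (inv_into V f (f x)) = f x"
      using x by (auto intro: inv_into_into f_inv_into_f)
    then show "inv_into V f (f x) \<in> ?T \<and> x \<otimes> inv (inv_into V f (f x)) \<in> U"
      using f[OF x] x by simp
  next
    fix t assume t: "t \<in> ?T \<and> x \<otimes> inv t \<in> U"
    then have "f x = f t" using f[OF x] TV by blast
    moreover obtain y where "y \<in> V" "t = inv_into V f (f y)" using t by blast
    ultimately show "t = inv_into V f (f x)" by (simp add: f_inv_into_f)
  qed
  then have "transversal G U V ?T" using TV by (simp add: transversal_def)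
  then show ?thesis using that card_image[OF inj] finite_image_iff[OF inj] by blast
qed

lemma r_coset_eq_iff:
  assumes U: "subgroup U G" and x: "x \<in> carrier G" and y: "y \<in> carrier G"
  shows "x \<otimes> inv y \<in> U \<longleftrightarrow> U #> x = U #> y"
proof
  assume "x \<otimes> inv y \<in> U"
  moreover have "x = (x \<otimes> inv y) \<otimes> y" using x y by (simp add: m_assoc)
  ultimately have "x \<in> U #> y" unfolding r_coset_def by blast
  then show "U #> x = U #> y" using repr_independence[OF _ y U] by simp
next
  assume "U #> x = U #> y"
  then have "x \<in> U #> y" using rcos_self[OF x U] by simp
  then obtain u where u: "u \<in> U" "x = u \<otimes> y" by (auto simp: r_coset_def)
  moreover have "u \<in> carrier G" using U u subgroup.mem_carrier by metis
  ultimately show "x \<otimes> inv y \<in> U" using y by (simp add: m_assoc)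
qed

lemma transversal_card_le:
  assumes U: "subgroup U G" and V: "V \<subseteq> carrier G"
    and D: "finite D" "g ` V \<subseteq> D" and g: "\<And>x y. x \<in> V \<Longrightarrow> y \<in> V \<Longrightarrow> g x = g y \<Longrightarrow> x \<otimes> inv y \<in> U"
  obtains T where "transversal G U V T" "finite T" "card T \<le> card D"
proof -
  define f where "f x = U #> x" for x
  have f: "x \<otimes> inv y \<in> U \<longleftrightarrow> f x = f y" if "x \<in> V" "y \<in> V" for x y
    unfolding f_def using r_coset_eq_iff[OF U] that V by blast
  obtain T where T: "transversal G U V T" "card T = card (f ` V)" "finite T \<longleftrightarrow> finite (f ` V)"
    using transversal_of_map[OF f] by blast
  have "f ` V \<subseteq> (\<lambda>d. f (inv_into V g d)) ` (g ` V)"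
  proof
    fix z assume "z \<in> f ` V"
    then obtain x where x: "x \<in> V" "z = f x" by blast
    have "inv_into V g (g x) \<in> V" "g (inv_into V g (g x)) = g x"
      using x by (auto intro: inv_into_into f_inv_into_f)
    then have "f x = f (inv_into V g (g x))" using g f x by metis
    then show "z \<in> (\<lambda>d. f (inv_into V g d)) ` (g ` V)" using x by blast
  qed
  moreover have "finite (g ` V)" "card (g ` V) \<le> card D" using D finite_subset card_mono by blast+
  ultimately have "finite (f ` V)" "card (f ` V) \<le> card D"
    by (meson finite_imageI finite_subset, meson card_image_le card_mono finite_imageI le_trans)
  then show ?thesis using that T by simp
qed

lemma rcosets_index:
  "rcosets\<^bsub>G\<lparr>carrier := V\<rparr>\<^esub> U = (\<lambda>x. U #> x) ` V"
  by (auto simp: RCOSETS_def r_coset_def)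

lemma subgroup_index_transversal:
  assumes U: "subgroup U G" and V: "V \<subseteq> carrier G" and l: "subgroup_index (G\<lparr>carrier := V\<rparr>) U = enat l"
  obtains T where "transversal G U V T" "finite T" "card T = l"
proof -
  have fin: "finite ((\<lambda>x. U #> x) ` V)" and card: "card ((\<lambda>x. U #> x) ` V) = l"
    using l by (auto simp: subgroup_index_def rcosets_index split: if_splits)
  show ?thesis
  proof (rule transversal_of_map[of V U "\<lambda>x. U #> x"])
    show "x \<otimes> inv y \<in> U \<longleftrightarrow> U #> x = U #> y" if "x \<in> V" "y \<in> V" for x y
      using r_coset_eq_iff[OF U] that V by blast
  qed (use fin card that in simp)
qed

lemma subgroup_index_infinite_iff:
  assumes U: "subgroup U G" and V: "V \<subseteq> carrier G"
  shows "subgroup_index (G\<lparr>carrier := V\<rparr>) U = \<infinity> \<longleftrightarrow> \<not> finite_index G U V"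
proof
  assume inf: "subgroup_index (G\<lparr>carrier := V\<rparr>) U = \<infinity>"
  show "\<not> finite_index G U V"
  proof
    assume "finite_index G U V"
    then obtain T where T: "finite T" "T \<subseteq> V" "\<And>x. x \<in> V \<Longrightarrow> \<exists>t \<in> T. x \<otimes> inv t \<in> U"
      unfolding finite_index_def by blast
    have "(\<lambda>x. U #> x) ` V \<subseteq> (\<lambda>x. U #> x) ` T"
    proof
      fix z assume "z \<in> (\<lambda>x. U #> x) ` V"
      then obtain x where x: "x \<in> V" "z = U #> x" by blast
      then obtain t where "t \<in> T" "x \<otimes> inv t \<in> U" using T by blast
      then show "z \<in> (\<lambda>x. U #> x) ` T" using r_coset_eq_iff[OF U, of x t] x T(2) V by blast
    qed
    then have "finite ((\<lambda>x. U #> x) ` V)" using T(1) finite_subset by blast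
    then show False using inf by (simp add: subgroup_index_def rcosets_index)
  qed
next
  assume inf: "\<not> finite_index G U V"
  show "subgroup_index (G\<lparr>carrier := V\<rparr>) U = \<infinity>"
  proof (rule ccontr)
    assume "subgroup_index (G\<lparr>carrier := V\<rparr>) U \<noteq> \<infinity>"
    then obtain l where "subgroup_index (G\<lparr>carrier := V\<rparr>) U = enat l" by auto
    then obtain T where "transversal G U V T" "finite T" using subgroup_index_transversal[OF U V] by blast
    then show False using inf transversal_finite_index by blast
  qed
qed

text \<open>The potential of the single edge \<open>\<one> \<rightarrow> s\<close> separates the two
  products: the path spelled \<open>s\<close>, \<open>t\<close> crosses this edge and the path
  spelled \<open>t\<close>, \<open>s\<close> does not.\<close>

lemma free_set_not_commute:
  assumes "free_set G S" "s \<in> S" "t \<in> S" "s \<noteq> t"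
  shows "s \<otimes> t \<noteq> t \<otimes> s"
proof
  assume eq: "s \<otimes> t = t \<otimes> s"
  have S: "S \<subseteq> carrier G" using assms(1) by (rule free_set_carrier)
  obtain F :: "'a \<Rightarrow> int" where F: "\<And>x y. x \<in> generate G S \<Longrightarrow> y \<in> S \<Longrightarrow>
      F (x \<otimes> y) = F x + (if x = \<one> \<and> y = s then 1 else 0)"
    using free_setD[OF assms(1), of "\<lambda>x y. if x = \<one> \<and> y = s then 1 else 0"] by blast
  have g: "s \<in> generate G S" "t \<in> generate G S" "\<one> \<in> generate G S"
    using assms by (auto intro: generate.incl generate.one)
  have "s \<noteq> \<one>" "t \<noteq> \<one>" using one_notin_free_set[OF assms(1)] assms by auto
  then show False
    using F[OF g(1) assms(3)] F[OF g(2) assms(2)] F[OF g(3) assms(2)] F[OF g(3) assms(3)] eq assms S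
    by (auto simp: subsetD)
qed

lemma fg_finite_index_overgroup:
  assumes U: "subgroup U G" "fg G U" and V: "subgroup V G" "U \<subseteq> V" and fi: "finite_index G U V"
  shows "fg G V"
proof -
  obtain B where B: "B \<subseteq> U" "finite B" "generate G B = U" using fg_iff[OF U(1)] U(2) by blast
  obtain T where T: "finite T" "T \<subseteq> V" "\<And>x. x \<in> V \<Longrightarrow> \<exists>t \<in> T. x \<otimes> inv t \<in> U"
    using fi unfolding finite_index_def by blast
  have Vc: "x \<in> carrier G" if "x \<in> V" for x using V that subgroup.mem_carrier by metis
  have BT: "B \<union> T \<subseteq> V" using B T V by blast
  have "generate G (B \<union> T) = V"
  proof
    show "generate G (B \<union> T) \<subseteq> V" using generate_subgroup_incl[OF BT V(1)] .
    show "V \<subseteq> generate G (B \<union> T)"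
    proof
      fix x assume x: "x \<in> V"
      obtain t where t: "t \<in> T" "x \<otimes> inv t \<in> U" using T(3)[OF x] by blast
      have "x \<otimes> inv t \<in> generate G (B \<union> T)" using t(2) B(3) mono_generate[of B "B \<union> T"] by blast
      moreover have "t \<in> generate G (B \<union> T)" using t(1) by (auto intro: generate.incl)
      moreover have "x = (x \<otimes> inv t) \<otimes> t" using x t T(2) Vc by (auto simp: m_assoc)
      ultimately show "x \<in> generate G (B \<union> T)" using generate.eng by metis
    qed
  qed
  moreover have "B \<union> T \<subseteq> carrier G" using BT Vc by blast
  ultimately show ?thesis using fgI[of "B \<union> T"] B T by simp
qed

lemma virtually_cyclic_subgroup:
  assumes P: "subgroup P G" and vc: "virtually_cyclic (G\<lparr>carrier := P\<rparr>)"
  shows "\<exists>g \<in> P. finite_index G (generate G {g}) P"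
proof -
  obtain C where C: "subgroup C (G\<lparr>carrier := P\<rparr>)" "cyclic_group (G\<lparr>carrier := C\<rparr>)"
    "subgroup_index (G\<lparr>carrier := P\<rparr>) C \<noteq> \<infinity>"
    using vc unfolding virtually_cyclic_def by auto
  have CG: "subgroup C G" using incl_subgroup[OF P C(1)] .
  have CP: "C \<subseteq> P" using subgroup.subset[OF C(1)] by simp
  have "group (G\<lparr>carrier := C\<rparr>)" using subgroup_imp_group[OF CG] .
  then obtain g where g: "g \<in> C" "C = range (\<lambda>n::int. g [^]\<^bsub>G\<lparr>carrier := C\<rparr>\<^esub> n)"
    using C(2) group.cyclic_group[of "G\<lparr>carrier := C\<rparr>"] by auto
  have "g [^]\<^bsub>G\<lparr>carrier := C\<rparr>\<^esub> n = g [^] n" for n :: int using int_pow_consistent[OF CG g(1)] by simp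
  then have "C = range (\<lambda>n::int. g [^] n)" using g(2) by simp
  moreover have "g \<in> carrier G" using CG g(1) subgroup.mem_carrier by metis
  ultimately have "C = generate G {g}" using generate_pow[of g] by auto
  moreover have "finite_index G C P"
    using C(3) subgroup_index_infinite_iff[OF CG subgroup.subset[OF P]] by simp
  ultimately show ?thesis using g(1) CP by blast
qed

lemma cyclic_groupI:
  assumes g: "g \<in> carrier G" and P: "P = generate G {g}"
  shows "cyclic_group (G\<lparr>carrier := P\<rparr>)"
proof -
  have Pg: "subgroup P G" unfolding P using g by (intro generate_is_subgroup) simp
  have gP: "g \<in> P" unfolding P by (rule generate.incl) simp
  have "P = range (\<lambda>n::int. g [^] n)" unfolding P using generate_pow[OF g] by auto
  also have "\<dots> = range (\<lambda>n::int. g [^]\<^bsub>G\<lparr>carrier := P\<rparr>\<^esub> n)" using int_pow_consistent[OF Pg gP] by simp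
  finally show ?thesis
    using group.cyclic_group[OF subgroup_imp_group[OF Pg]] gP by auto
qed

lemma additive_on_derived:
  assumes \<phi>: "additive_on G (carrier G) \<phi>" and x: "x \<in> derived G (carrier G)"
  shows "\<phi> x = 0"
proof (rule additive_on_vanish[OF \<phi> subgroup_self _ _ x[unfolded derived_def]])
  fix s assume "s \<in> derived_set G (carrier G)"
  then obtain a b where ab: "a \<in> carrier G" "b \<in> carrier G" "s = a \<otimes> b \<otimes> inv a \<otimes> inv b" by blast
  have inv: "\<phi> (inv y) = - \<phi> y" if "y \<in> carrier G" for y
    using additive_on_inv[OF \<phi> subgroup_self that] .
  show "\<phi> s = 0" using ab additive_onD[OF \<phi>] inv by simp
qed (use derived_set_in_carrier in blast)

text \<open>As \<open>\<phi> w\<close> is a unit modulo \<open>d\<close>, the powers of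
  \<open>w\<close> reach every residue, so the index is \<open>d\<close> itself and not just a
  divisor. Any subgroup that contains \<open>w\<close> gives the same index.\<close>

lemma index_of_multiples:
  assumes V: "subgroup V G" and \<phi>: "additive_on G V \<phi>" and w: "w \<in> V" "coprime (\<phi> w) (int d)" and d: "d > 0"
  shows "subgroup {x \<in> V. int d dvd \<phi> x} G"
    and "\<exists>T. transversal G {x \<in> V. int d dvd \<phi> x} V T \<and> finite T \<and> card T = d"
proof -
  let ?U = "{x \<in> V. int d dvd \<phi> x}"
  have Vc: "x \<in> carrier G" if "x \<in> V" for x using V that subgroup.mem_carrier by metis
  show U: "subgroup ?U G"
  proof (rule subgroupI)
    show "?U \<noteq> {}" using additive_on_one[OF \<phi>] subgroup.one_closed[OF V] by auto
  qed (use V Vc additive_onD[OF \<phi>] additive_on_inv[OF \<phi> V] subgroup.m_closed[OF V]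
      subgroup.m_inv_closed[OF V] in auto)
  let ?f = "\<lambda>x. \<phi> x mod int d"
  have f: "x \<otimes> inv y \<in> ?U \<longleftrightarrow> ?f x = ?f y" if xy: "x \<in> V" "y \<in> V" for x y
  proof -
    have "x \<otimes> inv y \<in> V" using xy subgroup.m_closed[OF V] subgroup.m_inv_closed[OF V] by blast
    moreover have "\<phi> (x \<otimes> inv y) = \<phi> x - \<phi> y"
      using additive_onD[OF \<phi> xy(1) subgroup.m_inv_closed[OF V xy(2)]] additive_on_inv[OF \<phi> V xy(2)] by simp
    ultimately show ?thesis by (simp add: mod_eq_dvd_iff)
  qed
  have "?f ` V = {0..<int d}"
  proof
    show "{0..<int d} \<subseteq> ?f ` V"
    proof
      fix r assume r: "r \<in> {0..<int d}"
      obtain u v where "u * \<phi> w + v * int d = 1"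
        using bezout_int[of "\<phi> w" "int d"] w(2) by auto
      then have "r = (r * u) * \<phi> w + (r * v) * int d" by (metis distrib_left mult.assoc mult.right_neutral)
      then have "((r * u) * \<phi> w) mod int d = r mod int d" by (metis mod_mult_self1)
      moreover have "r mod int d = r" using r by simp
      moreover have "\<phi> (w [^] (r * u)) = (r * u) * \<phi> w" using additive_on_pow[OF \<phi> V w(1)] .
      moreover have "w [^] (r * u) \<in> V" using subgroup_int_pow_closed[OF V w(1)] .
      ultimately show "r \<in> ?f ` V" by (metis image_eqI)
    qed
  qed (use d in auto)
  then have "finite (?f ` V)" "card (?f ` V) = d" by simp_all
  then show "\<exists>T. transversal G ?U V T \<and> finite T \<and> card T = d"
    using transversal_of_map[of V ?U ?f, OF f] by metis
qed

end

section \<open>Finitely generated abelian groups\<close>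

context comm_group
begin

text \<open>The functionals \<open>f\<close> embed \<open>U\<close> into the integer vectors of
  length \<open>k\<close>. An element \<open>x\<close> of least positive value under the last
  functional splits off: \<open>U\<close> is the direct product of the kernel \<open>U0\<close> and
  the powers of \<open>x\<close>, with \<open>p\<close> and \<open>q\<close> as projections. The
  conclusion returns \<open>card T\<close> separating functionals, so the lemma can be applied again
  to subgroups of \<open>U\<close> with \<open>card T\<close> in place of \<open>k\<close>; this
  yields monotonicity of the rank.\<close>

lemma abelian_basis:
  assumes "subgroup U G" and "\<And>i. i < k \<Longrightarrow> additive_on G U (f i)"
    and "\<And>x. x \<in> U \<Longrightarrow> (\<forall>i < k. f i x = 0) \<Longrightarrow> x = \<one>"
  shows "\<exists>T g. T \<subseteq> U \<and> finite T \<and> card T \<le> k \<and> generate G T = U \<and> extends_additively G T U \<and>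
    (\<forall>i < card T. additive_on G U (g i)) \<and> (\<forall>x \<in> U. (\<forall>i < card T. g i x = 0) \<longrightarrow> x = \<one>)"
  using assms
proof (induction k arbitrary: U)
  case 0
  then have U: "U = {\<one>}" using subgroup.one_closed by blast
  have "extends_additively G {} U"
    unfolding extends_additively_def U by (auto simp: additive_on_def intro!: exI[of _ "\<lambda>_. 0"])
  then show ?case by (intro exI[of _ "{}"]) (auto simp: U generate_empty)
next
  case (Suc k)
  have U: "subgroup U G" by (rule Suc.prems)
  have Uc: "x \<in> carrier G" if "x \<in> U" for x using U that subgroup.mem_carrier by metis
  have fk: "additive_on G U (f k)" using Suc.prems(2) by simp
  define U0 where "U0 = {x \<in> U. f k x = 0}"
  have "subgroup U0 G"
  proof (rule subgroupI)
    show "U0 \<noteq> {}" using additive_on_one[OF fk] subgroup.one_closed[OF U] by (auto simp: U0_def)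
  qed (use U Uc additive_onD[OF fk] additive_on_inv[OF fk U] subgroup.m_closed[OF U]
      subgroup.m_inv_closed[OF U] in \<open>auto simp: U0_def\<close>)
  moreover have "additive_on G U0 (f i)" if "i < k" for i
    by (rule additive_on_subset[OF Suc.prems(2)]) (use that in \<open>auto simp: U0_def\<close>)
  moreover have "x = \<one>" if "x \<in> U0" "\<forall>i < k. f i x = 0" for x
    using Suc.prems(3)[of x] that by (auto simp: U0_def less_Suc_eq)
  ultimately obtain T g where T: "T \<subseteq> U0" "finite T" "card T \<le> k" "generate G T = U0" "extends_additively G T U0"
    "\<forall>i < card T. additive_on G U0 (g i)" "\<forall>x \<in> U0. (\<forall>i < card T. g i x = 0) \<longrightarrow> x = \<one>"
    using Suc.IH[of U0] by blast
  show ?case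
  proof (cases "\<exists>x \<in> U. f k x \<noteq> 0")
    case False
    then have "U0 = U" by (auto simp: U0_def)
    then show ?thesis using T by (intro exI[of _ T] exI[of _ g]) auto
  next
    case True
    have "\<exists>x \<in> U. f k x > 0"
    proof -
      obtain x where x: "x \<in> U" "f k x \<noteq> 0" using True by blast
      then show ?thesis
        using additive_on_inv[OF fk U x(1)] subgroup.m_inv_closed[OF U x(1)]
        by (intro bexI[of _ "if f k x > 0 then x else inv x"]) auto
    qed
    then obtain x where x: "x \<in> U" "f k x > 0" and
      min: "\<And>y. y \<in> U \<Longrightarrow> f k y > 0 \<Longrightarrow> nat (f k x) \<le> nat (f k y)"
      using ex_has_least_nat[of "\<lambda>x. x \<in> U \<and> f k x > 0" _ "\<lambda>x. nat (f k x)"] by blast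
    define q where "q y = f k y div f k x" for y
    define p where "p y = y \<otimes> x [^] (- q y)" for y
    have powU: "x [^] (j::int) \<in> U" for j
      using subgroup_int_pow_closed[OF U x(1)] .
    have pU: "p y \<in> U" if "y \<in> U" for y using that powU subgroup.m_closed[OF U] by (simp add: p_def)
    have fp: "f k (p y) = f k y mod f k x" if "y \<in> U" for y
    proof -
      have "f k (p y) = f k y + (- q y) * f k x"
        using additive_onD[OF fk that powU] additive_on_pow[OF fk U x(1)] by (simp add: p_def)
      then show ?thesis by (simp add: q_def minus_div_mult_eq_mod [symmetric])
    qed
    have mod0: "f k y mod f k x = 0" if "y \<in> U" for y
    proof (rule ccontr)
      assume "f k y mod f k x \<noteq> 0"
      then have "f k (p y) > 0" using fp[OF that] x(2) pos_mod_sign[of "f k x" "f k y"] by linarith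
      then have "f k x \<le> f k (p y)" using min[OF pU[OF that]] x(2) by simp
      then show False using fp[OF that] pos_mod_bound[OF x(2), of "f k y"] by linarith
    qed
    have pU0: "p y \<in> U0" if "y \<in> U" for y using pU fp mod0 that by (simp add: U0_def)
    have fq: "f k y = q y * f k x" if "y \<in> U" for y using mod0[OF that] by (auto simp: q_def)
    have q_mult: "q (y \<otimes> z) = q y + q z" if "y \<in> U" "z \<in> U" for y z
    proof -
      have "q (y \<otimes> z) * f k x = (q y + q z) * f k x"
        using fq that subgroup.m_closed[OF U] additive_onD[OF fk] by (simp add: distrib_right flip: fq)
      then show ?thesis using x(2) by simp
    qed
    have p_mult: "p (y \<otimes> z) = p y \<otimes> p z" if "y \<in> U" "z \<in> U" for y z
      using that Uc x(1) q_mult[OF that] unfolding p_def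
      by (simp add: int_pow_mult[symmetric] add.commute m_ac)
    have y_eq: "y = p y \<otimes> x [^] q y" if "y \<in> U" for y
      using that Uc x(1) by (simp add: p_def m_assoc int_pow_neg)
    have qx: "q x = 1" using x(2) by (simp add: q_def)
    have px: "p x = \<one>" using Uc x(1) qx by (simp add: p_def int_pow_neg)
    have q0: "q y = 0" "p y = y" if "y \<in> U0" for y
      using that Uc by (auto simp: U0_def q_def p_def)
    have xT: "x \<notin> T" using T(1) x(2) by (auto simp: U0_def)
    have p_add: "additive_on G U (\<lambda>y. h (p y))" if "additive_on G U0 h" for h
      using that pU0 p_mult by (simp add: additive_on_def)
    have q_add: "additive_on G U q" using q_mult by (simp add: additive_on_def)
    let ?T = "insert x T"
    have TU: "?T \<subseteq> U" using T(1) x(1) by (auto simp: U0_def)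
    have gen: "generate G ?T = U"
    proof
      show "generate G ?T \<subseteq> U" using generate_subgroup_incl[OF TU U] .
      show "U \<subseteq> generate G ?T"
      proof
        fix y assume y: "y \<in> U"
        have sg: "subgroup (generate G ?T) G" using TU Uc by (intro generate_is_subgroup) blast
        have "p y \<in> generate G ?T" using pU0[OF y] T(4) mono_generate[of T ?T] by blast
        moreover have "x [^] q y \<in> generate G ?T"
          by (rule subgroup_int_pow_closed[OF sg]) (auto intro: generate.incl)
        ultimately show "y \<in> generate G ?T" using y_eq[OF y] generate.eng by metis
      qed
    qed
    have ext: "extends_additively G ?T U"
      unfolding extends_additively_def
    proof
      fix v :: "'a \<Rightarrow> int"
      obtain h where h: "additive_on G U0 h" "\<forall>t \<in> T. h t = v t" using extends_additivelyD[OF T(5)] by blast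
      have "additive_on G U (\<lambda>y. h (p y) + q y * v x)"
        using p_add[OF h(1)] q_add by (simp add: additive_on_def distrib_right)
      moreover have "h \<one> = 0" using additive_on_one[OF h(1)] pU0[OF x(1)] px by simp
      then have "h (p t) + q t * v x = v t" if "t \<in> ?T" for t
        using that h(2) q0 T(1) px qx by auto
      ultimately show "\<exists>h. additive_on G U h \<and> (\<forall>t \<in> ?T. h t = v t)" by blast
    qed
    define g' where "g' i = (if i < card T then (\<lambda>y. g i (p y)) else q)" for i
    have card: "card ?T = Suc (card T)" using T(2) xT by simp
    have "additive_on G U (g' i)" for i
      using p_add T(6) q_add by (simp add: g'_def)
    moreover have "y = \<one>" if y: "y \<in> U" "\<forall>i < card ?T. g' i y = 0" for y
    proof -
      have g'0: "g' i y = 0" if "i < Suc (card T)" for i using y(2) card that by simp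
      have "q y = 0" using g'0[of "card T"] by (simp add: g'_def)
      then have "p y = y" using Uc y(1) by (simp add: p_def)
      moreover have "g i (p y) = 0" if "i < card T" for i
        using g'0[of i] that by (simp add: g'_def)
      ultimately show ?thesis using T(7) pU0[OF y(1)] by metis
    qed
    ultimately show ?thesis
      using TU T(2,3) gen ext card by (intro exI[of _ ?T] exI[of _ g'] conjI) simp_all
  qed
qed

text \<open>When the generator \<open>a\<close> is added, either some power \<open>a [^] k\<close>
  with \<open>k > 0\<close> already lies in the old group or the new group is its direct product
  with an infinite cyclic one. In the second case the exponent of \<open>a\<close> is the desired
  functional. In the first case finite index persists, and a functional \<open>h\<close> is replaced
  by \<open>y \<mapsto> h (y [^] k)\<close>, which avoids dividing by \<open>k\<close>.\<close>

lemma finite_index_or_additive: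
  assumes L: "subgroup L G" and S: "finite S" "S \<subseteq> carrier G"
  shows "finite_index G L (generate G (L \<union> S)) \<or>
    (\<exists>h. additive_on G (generate G (L \<union> S)) h \<and> (\<forall>x \<in> L. h x = 0) \<and> (\<exists>x \<in> generate G (L \<union> S). h x \<noteq> 0))"
  using S
proof (induction S rule: finite_induct)
  case empty
  have Lc: "L \<subseteq> carrier G" using L by (rule subgroup.subset)
  have "generate G L = L" using generate_subgroup_incl[OF subset_refl L] by (auto intro: generate.incl)
  moreover have "finite_index G L L"
    unfolding finite_index_def using subgroup.one_closed[OF L] Lc by (intro exI[of _ "{\<one>}"]) auto
  ultimately show ?case by simp
next
  case (insert a S)
  let ?V = "generate G (L \<union> S)" and ?V' = "generate G (L \<union> insert a S)"
  have Lc: "L \<subseteq> carrier G" using L by (rule subgroup.subset)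
  have a: "a \<in> carrier G" using insert.prems by blast
  have LSc: "L \<union> S \<subseteq> carrier G" "L \<union> insert a S \<subseteq> carrier G" using Lc insert.prems by auto
  have V: "subgroup ?V G" and V': "subgroup ?V' G" using LSc by (auto intro: generate_is_subgroup)
  have Vc: "x \<in> carrier G" if "x \<in> ?V" for x using V that subgroup.mem_carrier by metis
  have V'c: "x \<in> carrier G" if "x \<in> ?V'" for x using V' that subgroup.mem_carrier by metis
  have VV': "?V \<subseteq> ?V'" by (rule mono_generate) auto
  have LV: "L \<subseteq> ?V" by (auto intro: generate.incl)
  have aV': "a [^] (j::int) \<in> ?V'" for j
    by (rule subgroup_int_pow_closed[OF V']) (auto intro: generate.incl)
  have dec: "\<exists>v \<in> ?V. \<exists>j :: int. y = v \<otimes> a [^] j" if "y \<in> ?V'" for y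
    using LSc(2) that
  proof (induction rule: generate_right_induct)
    case one
    have "\<one> = \<one> \<otimes> a [^] (0::int)" by simp
    then show ?case using generate.one by blast
  next
    case (mult y s)
    then obtain v j where v: "v \<in> ?V" "y = v \<otimes> a [^] (j::int)" by blast
    show ?case
    proof (cases "s = a")
      case True
      then have "y \<otimes> s = v \<otimes> a [^] (j + 1)" using v Vc a by (simp add: int_pow_mult m_assoc)
      then show ?thesis using v by blast
    next
      case False
      then have s: "s \<in> ?V" using mult(2) by (auto intro: generate.incl)
      then have "y \<otimes> s = (v \<otimes> s) \<otimes> a [^] j" using v Vc a by (simp add: m_ac)
      then show ?thesis using v s subgroup.m_closed[OF V] by blast
    qed
  next
    case (mult_inv y s)
    then obtain v j where v: "v \<in> ?V" "y = v \<otimes> a [^] (j::int)" by blast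
    show ?case
    proof (cases "s = a")
      case True
      then have "y \<otimes> inv s = v \<otimes> a [^] (j + (-1))"
        using v Vc a int_pow_mult[OF a, of j "-1"] by (simp add: m_assoc int_pow_neg)
      then show ?thesis using v by blast
    next
      case False
      then have s: "inv s \<in> ?V" using mult_inv(2) by (auto intro: generate.inv)
      then have "y \<otimes> inv s = (v \<otimes> inv s) \<otimes> a [^] j" using v Vc a by (simp add: m_ac)
      then show ?thesis using v s subgroup.m_closed[OF V] by blast
    qed
  qed
  show ?case
  proof (cases "\<exists>k :: nat. k > 0 \<and> a [^] k \<in> ?V")
    case True
    then obtain k :: nat where k: "k > 0" "a [^] k \<in> ?V" by blast
    consider "finite_index G L ?V" | h where "additive_on G ?V h" "\<forall>x \<in> L. h x = 0" "\<exists>x \<in> ?V. h x \<noteq> 0"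
      using insert by blast
    then show ?thesis
    proof cases
      case 1
      then obtain T where T: "finite T" "T \<subseteq> ?V" "\<And>x. x \<in> ?V \<Longrightarrow> \<exists>t \<in> T. x \<otimes> inv t \<in> L"
        unfolding finite_index_def by blast
      let ?T = "(\<lambda>(t, j). t \<otimes> a [^] j) ` (T \<times> {..<k})"
      have nat: "a [^] (j::nat) \<in> ?V'" for j using aV'[of "int j"] by (simp add: int_pow_int)
      have T1: "?T \<subseteq> ?V'" using T(2) VV' nat subgroup.m_closed[OF V'] by auto
      have T2: "\<exists>t \<in> ?T. y \<otimes> inv t \<in> L" if y: "y \<in> ?V'" for y
      proof -
        obtain v j where v: "v \<in> ?V" "y = v \<otimes> a [^] (j::int)" using dec[OF y] by blast
        define i where "i = nat (j mod int k)"
        have i: "i < k" using k(1) by (simp add: i_def nat_less_iff)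
        have j: "j = int k * (j div int k) + int i" using k(1) by (simp add: i_def)
        have "a [^] j = (a [^] k) [^] (j div int k) \<otimes> a [^] i"
          using a by (subst j) (simp add: int_pow_mult int_pow_pow int_pow_int flip: int_pow_int)
        moreover have ak: "(a [^] k) [^] (j div int k) \<in> ?V" using subgroup_int_pow_closed[OF V k(2)] .
        ultimately have y: "y = (v \<otimes> (a [^] k) [^] (j div int k)) \<otimes> a [^] i"
          using v Vc a by (simp add: m_assoc)
        let ?w = "v \<otimes> (a [^] k) [^] (j div int k)"
        have w: "?w \<in> ?V" using v ak subgroup.m_closed[OF V] by blast
        then obtain t where t: "t \<in> T" "?w \<otimes> inv t \<in> L" using T(3) by blast
        have tc: "t \<in> carrier G" using t T Vc by blast
        have "y \<otimes> inv (t \<otimes> a [^] i) = ?w \<otimes> inv t"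
          using y tc Vc[OF w] a by (simp add: inv_mult_group m_assoc)
        then show ?thesis using t i by (intro bexI[of _ "t \<otimes> a [^] i"]) auto
      qed
      have "finite ?T" using T by simp
      then have "finite_index G L ?V'"
        unfolding finite_index_def by (intro exI[of _ ?T] conjI ballI T1 T2)
      then show ?thesis by blast
    next
      case 2
      have kV: "y [^] k \<in> ?V" if y: "y \<in> ?V'" for y
      proof -
        obtain v j where v: "v \<in> ?V" "y = v \<otimes> a [^] (j::int)" using dec[OF y] by blast
        have "y [^] k = v [^] k \<otimes> (a [^] k) [^] j"
          using v Vc a by (simp add: int_pow_distrib int_pow_pow mult.commute flip: int_pow_int)
        moreover have "v [^] k \<in> ?V" using v V nat_pow_closed by (induction k) (auto intro: subgroup.m_closed subgroup.one_closed)
        ultimately show ?thesis using subgroup_int_pow_closed[OF V k(2)] subgroup.m_closed[OF V] by simp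
      qed
      have "additive_on G ?V' (\<lambda>y. h (y [^] k))"
        unfolding additive_on_def
        using additive_onD[OF 2(1)] kV V'c by (simp add: pow_mult_distrib m_comm)
      moreover have "x [^] k \<in> L" if "x \<in> L" for x
        using that L by (induction k) (auto intro: subgroup.m_closed subgroup.one_closed)
      then have "\<forall>x \<in> L. h (x [^] k) = 0" using 2(2) by blast
      moreover obtain x where x: "x \<in> ?V" "h x \<noteq> 0" using 2(3) by blast
      have "h (x [^] k) = int k * h x" using additive_on_pow[OF 2(1) V x(1), of "int k"] by (simp add: int_pow_int)
      then have "h (x [^] k) \<noteq> 0" using x k by simp
      ultimately show ?thesis using x(1) VV' by (intro disjI2 exI[of _ "\<lambda>y. h (y [^] k)"]) auto
    qed
  next
    case False
    have j0: "j = 0" if "a [^] (j::int) \<in> ?V" for j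
    proof (rule ccontr)
      assume "j \<noteq> 0"
      have "a [^] (- j) \<in> ?V" using subgroup.m_inv_closed[OF V that] a by (simp add: int_pow_neg)
      then have "a [^] \<bar>j\<bar> \<in> ?V" using that by (simp add: abs_if)
      then have "a [^] nat \<bar>j\<bar> \<in> ?V" by (metis abs_ge_zero int_nat_eq int_pow_int)
      moreover have "nat \<bar>j\<bar> > 0" using \<open>j \<noteq> 0\<close> by simp
      ultimately show False using False by blast
    qed
    have uniq: "i = j" if "y \<in> carrier G" "y \<otimes> a [^] (- i) \<in> ?V" "y \<otimes> a [^] (- j) \<in> ?V" for y and i j :: int
    proof -
      have "inv (y \<otimes> a [^] (- i)) \<otimes> (y \<otimes> a [^] (- j)) \<in> ?V"
        using that subgroup.m_closed[OF V] subgroup.m_inv_closed[OF V] by blast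
      moreover have "inv (y \<otimes> a [^] (- i)) \<otimes> (y \<otimes> a [^] (- j)) = a [^] (i + (- j))"
        using that(1) a by (simp add: inv_mult_group m_assoc int_pow_neg int_pow_diff)
      ultimately show ?thesis using j0 by fastforce
    qed
    define h where "h y = (THE j :: int. y \<otimes> a [^] (- j) \<in> ?V)" for y
    have h_eq: "h y = j" if "y \<in> carrier G" "y \<otimes> a [^] (- j) \<in> ?V" for y j
      unfolding h_def using that uniq by blast
    have h: "y \<otimes> a [^] (- h y) \<in> ?V" if y: "y \<in> ?V'" for y
    proof -
      obtain v j where v: "v \<in> ?V" "y = v \<otimes> a [^] (j::int)" using dec[OF y] by blast
      then have "y \<otimes> a [^] (- j) \<in> ?V" using Vc a by (simp add: m_assoc int_pow_neg)
      then show ?thesis using h_eq V'c[OF y] by metis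
    qed
    have "additive_on G ?V' h"
      unfolding additive_on_def
    proof (intro ballI)
      fix y z assume yz: "y \<in> ?V'" "z \<in> ?V'"
      have "(y \<otimes> a [^] (- h y)) \<otimes> (z \<otimes> a [^] (- h z)) \<in> ?V" using h yz subgroup.m_closed[OF V] by blast
      moreover have "(y \<otimes> a [^] (- h y)) \<otimes> (z \<otimes> a [^] (- h z)) = (y \<otimes> z) \<otimes> (a [^] (- h y) \<otimes> a [^] (- h z))"
        using yz V'c a by (simp add: m_ac)
      moreover have "a [^] (- h y) \<otimes> a [^] (- h z) = a [^] (- (h y + h z))"
        using a by (simp add: int_pow_mult[symmetric])
      ultimately show "h (y \<otimes> z) = h y + h z" using h_eq[of "y \<otimes> z" "h y + h z"] yz V'c by simp
    qed
    moreover have "h x = 0" if "x \<in> L" for x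
      using h_eq[of x 0] that LV Vc by auto
    moreover have "h a = 1"
      using h_eq[of a 1] a generate.one[of G "L \<union> S"] by (simp add: int_pow_neg)
    moreover have "a \<in> ?V'" by (rule generate.incl) simp
    ultimately show ?thesis by (intro disjI2 exI[of _ h]) force
  qed
qed

end

section \<open>The quotient by the center\<close>

text \<open>A concrete model of the quotient by the center. Its two instances, the projection of the
  product and the identity of the free group, have the same target, so both degrees of inertia
  become suprema over conditions inside one free group.\<close>

locale center_epi = group_hom G F p for G (structure) and F and p +
  assumes onto: "p ` carrier G = carrier F" and ker: "kernel G F p = center G"
begin

definition \<theta> where "\<theta> A = the_elem (p ` A)"

lemma group_cq: "group (center_quotient G)"
  by (rule normal.factorgroup_is_group[OF G.center_normal])

lemma \<theta>_iso: "\<theta> \<in> iso (center_quotient G) F"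
  using FactGroup_iso_set[OF onto] unfolding ker \<theta>_def[abs_def] .

lemma \<theta>_proj:
  assumes "g \<in> carrier G"
  shows "\<theta> (center_proj G g) = p g"
proof -
  have "p (z \<otimes> g) = p g" if "z \<in> center G" for z
  proof -
    have "z \<in> kernel G F p" using that ker by simp
    then show ?thesis using assms by (simp add: kernel_def)
  qed
  moreover have "\<one> \<in> center G" by (simp add: center_def)
  then have "g \<in> (\<Union>z\<in>center G. {z \<otimes> g})" using G.l_one[OF assms] by (metis UN_iff singletonI)
  ultimately have "p ` center_proj G g = {p g}"
    unfolding center_proj_def r_coset_def by auto
  then show ?thesis by (simp add: \<theta>_def)
qed

lemma center_proj_carrier: "g \<in> carrier G \<Longrightarrow> center_proj G g \<in> carrier (center_quotient G)"
  unfolding center_proj_def carrier_FactGroup by blast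

lemma \<theta>_hom: "group_hom (center_quotient G) F \<theta>"
  using group_cq \<theta>_iso H.is_group by (auto simp: group_hom_def group_hom_axioms_def iso_def)

lemma \<theta>_inj: "inj_on \<theta> (carrier (center_quotient G))" and \<theta>_onto: "\<theta> ` carrier (center_quotient G) = carrier F"
  using \<theta>_iso by (auto simp: iso_def bij_betw_def)

lemma \<theta>_image: "A \<subseteq> carrier G \<Longrightarrow> \<theta> ` center_proj G ` A = p ` A"
  unfolding image_image by (rule image_cong) (auto simp: \<theta>_proj)

lemma \<theta>_Int:
  assumes "A \<subseteq> carrier G" "B \<subseteq> carrier G"
  shows "\<theta> ` (center_proj G ` A \<inter> center_proj G ` B) = p ` A \<inter> p ` B"
proof -
  have "center_proj G ` A \<subseteq> carrier (center_quotient G)" "center_proj G ` B \<subseteq> carrier (center_quotient G)"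
    using assms center_proj_carrier by blast+
  then show ?thesis using inj_on_image_Int[OF \<theta>_inj] \<theta>_image assms by simp
qed

lemma subgroup_center_proj:
  assumes "subgroup A G"
  shows "subgroup (center_proj G ` A) (center_quotient G)"
proof -
  interpret N: normal "center G" G by (rule G.center_normal)
  have "group_hom G (center_quotient G) (center_proj G)"
    unfolding group_hom_def group_hom_axioms_def center_proj_def[abs_def]
    using group_cq N.r_coset_hom_Mod by auto
  then show ?thesis using assms group_hom.subgroup_img_is_subgroup by metis
qed

lemma derived_iff:
  assumes "A \<subseteq> carrier G" "B \<subseteq> carrier G"
  shows "center_proj G ` A \<inter> center_proj G ` B \<subseteq> derived (center_quotient G) (carrier (center_quotient G))
    \<longleftrightarrow> p ` A \<inter> p ` B \<subseteq> derived F (carrier F)"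
proof -
  interpret Q: group "center_quotient G" by (rule group_cq)
  have d: "derived F (carrier F) = \<theta> ` derived (center_quotient G) (carrier (center_quotient G))"
    using group_hom.derived_img[OF \<theta>_hom subset_refl] \<theta>_onto by simp
  have "center_proj G ` A \<inter> center_proj G ` B \<subseteq> carrier (center_quotient G)"
    using center_proj_carrier assms by blast
  moreover have "derived (center_quotient G) (carrier (center_quotient G)) \<subseteq> carrier (center_quotient G)"
    by (rule Q.derived_in_carrier) simp
  ultimately show ?thesis
    unfolding d \<theta>_Int[OF assms, symmetric] by (rule image_subset_iff_on[OF \<theta>_inj, symmetric])
qed

lemma index_iff:
  assumes A: "subgroup A G" and B: "subgroup B G"
  shows "subgroup_index ((center_quotient G)\<lparr>carrier := center_proj G ` A\<rparr>)
      (center_proj G ` A \<inter> center_proj G ` B) = \<infinity> \<longleftrightarrow> \<not> finite_index F (p ` A \<inter> p ` B) (p ` A)"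
proof -
  interpret Q: group "center_quotient G" by (rule group_cq)
  let ?A = "center_proj G ` A" and ?B = "center_proj G ` B"
  have Ac: "A \<subseteq> carrier G" and Bc: "B \<subseteq> carrier G" using A B subgroup.subset by auto
  have sub: "subgroup ?A (center_quotient G)" "subgroup (?A \<inter> ?B) (center_quotient G)"
    using subgroup_center_proj A B Q.subgroups_Inter_pair by auto
  have Aq: "?A \<subseteq> carrier (center_quotient G)" using subgroup.subset[OF sub(1)] .
  define \<eta> where "\<eta> = inv_into (carrier (center_quotient G)) \<theta>"
  have \<eta>: "\<eta> \<in> iso F (center_quotient G)" unfolding \<eta>_def using Q.iso_set_sym[OF \<theta>_iso] .
  then have \<eta>_hom: "group_hom F (center_quotient G) \<eta>"
    using group_cq H.is_group by (auto simp: group_hom_def group_hom_axioms_def iso_def)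
  have \<eta>\<theta>: "\<eta> ` \<theta> ` Y = Y" if "Y \<subseteq> carrier (center_quotient G)" for Y
    unfolding \<eta>_def using inv_into_image_cancel[OF \<theta>_inj that] .
  have "finite_index (center_quotient G) (?A \<inter> ?B) ?A \<longleftrightarrow> finite_index F (p ` A \<inter> p ` B) (p ` A)"
  proof
    assume "finite_index (center_quotient G) (?A \<inter> ?B) ?A"
    then show "finite_index F (p ` A \<inter> p ` B) (p ` A)"
      using group_hom.finite_index_image[OF \<theta>_hom _ Aq] \<theta>_Int[OF Ac Bc] \<theta>_image[OF Ac] by metis
  next
    assume "finite_index F (p ` A \<inter> p ` B) (p ` A)"
    moreover have "p ` A \<subseteq> carrier F" using Ac by auto
    ultimately have "finite_index (center_quotient G) (\<eta> ` (p ` A \<inter> p ` B)) (\<eta> ` p ` A)"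
      using group_hom.finite_index_image[OF \<eta>_hom] by blast
    moreover have "\<eta> ` (p ` A \<inter> p ` B) = ?A \<inter> ?B"
      using \<eta>\<theta>[of "?A \<inter> ?B"] \<theta>_Int[OF Ac Bc] Aq by (metis inf.coboundedI1)
    moreover have "\<eta> ` p ` A = ?A" using \<eta>\<theta>[OF Aq] \<theta>_image[OF Ac] by simp
    ultimately show "finite_index (center_quotient G) (?A \<inter> ?B) ?A" by simp
  qed
  then show ?thesis using Q.subgroup_index_infinite_iff[OF sub(2) Aq] by simp
qed

lemma inertia_test_subgroups_eq:
  assumes "subgroup H' G"
  shows "inertia_test_subgroups G H' = {K. subgroup K G \<and> fg G K \<and> fg G (H' \<inter> K) \<and>
    \<not> finite_index F (p ` H' \<inter> p ` K) (p ` H') \<and> \<not> p ` H' \<inter> p ` K \<subseteq> derived F (carrier F)}"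
  unfolding inertia_test_subgroups_def
  by (rule Collect_cong)
    (metis index_iff[OF assms] derived_iff[OF subgroup.subset[OF assms]] subgroup.subset)

lemma inertia_admissibleI:
  assumes A: "subgroup A G" "fg G A" and nvc: "\<And>g. g \<in> p ` A \<Longrightarrow> \<not> finite_index F (generate F {g}) (p ` A)"
    and der: "\<not> p ` A \<subseteq> derived F (carrier F)"
  shows "inertia_admissible G A"
proof -
  interpret Q: group "center_quotient G" by (rule group_cq)
  have Ac: "A \<subseteq> carrier G" using A subgroup.subset by auto
  let ?A = "center_proj G ` A"
  have sub: "subgroup ?A (center_quotient G)" using subgroup_center_proj[OF A(1)] .
  have Aq: "?A \<subseteq> carrier (center_quotient G)" using subgroup.subset[OF sub] .
  have "\<not> virtually_cyclic ((center_quotient G)\<lparr>carrier := ?A\<rparr>)"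
  proof
    assume "virtually_cyclic ((center_quotient G)\<lparr>carrier := ?A\<rparr>)"
    then obtain g where g: "g \<in> ?A" "finite_index (center_quotient G) (generate (center_quotient G) {g}) ?A"
      using Q.virtually_cyclic_subgroup[OF sub] by blast
    have "\<theta> ` generate (center_quotient G) {g} = generate F {\<theta> g}"
      using group_hom.generate_img[OF \<theta>_hom, of "{g}"] g(1) Aq by auto
    then have "finite_index F (generate F {\<theta> g}) (p ` A)"
      using group_hom.finite_index_image[OF \<theta>_hom g(2) Aq] \<theta>_image[OF Ac] by simp
    moreover have "\<theta> g \<in> p ` A" using g(1) \<theta>_image[OF Ac] by blast
    ultimately show False using nvc by blast
  qed
  moreover have "\<not> ?A \<subseteq> derived (center_quotient G) (carrier (center_quotient G))"
    using derived_iff[OF Ac Ac] der by simp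
  ultimately show ?thesis using A by (simp add: inertia_admissible_def)
qed

end

section \<open>Reduced words\<close>

definition winv :: "letter list \<Rightarrow> letter list" where
  "winv w = rev (map letter_inv w)"

lemma winv_simps [simp]:
  "winv [] = []" "winv (u @ v) = winv v @ winv u" "winv (winv w) = w" "length (winv w) = length w"
  "winv w = [] \<longleftrightarrow> w = []"
  by (auto simp: winv_def rev_map o_def)

lemma hd_winv: "w \<noteq> [] \<Longrightarrow> hd (winv w) = letter_inv (last w)"
  and last_winv: "w \<noteq> [] \<Longrightarrow> last (winv w) = letter_inv (hd w)"
  by (simp_all add: winv_def hd_rev last_rev last_map hd_map)

lemma reduced_append:
  "reduced (u @ v) \<longleftrightarrow> reduced u \<and> reduced v \<and> (u = [] \<or> v = [] \<or> hd v \<noteq> letter_inv (last u))"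
  by (auto simp: reduced_def successively_append_iff)

lemma foldr_cons_red_append: "reduced (u @ v) \<Longrightarrow> foldr cons_red u v = u @ v"
proof (induction u)
  case (Cons x u)
  then show ?case by (cases "u @ v") (auto simp: reduced_Cons cons_red_def)
qed simp

text \<open>\<open>c\<close> is the maximal part of \<open>u\<close> that cancels against the
  beginning of \<open>v\<close>. All later arguments on first and last letters of products rest on
  this decomposition.\<close>

lemma foldr_cons_red_cancel:
  "reduced u \<Longrightarrow> reduced v \<Longrightarrow> \<exists>p c q. u = p @ c \<and> v = winv c @ q \<and> foldr cons_red u v = p @ q \<and> reduced (p @ q)"
proof (induction u arbitrary: v rule: rev_induct)
  case Nil
  then show ?case by (intro exI[of _ "[]"] exI[of _ v]) auto
next
  case (snoc x u)
  show ?case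
  proof (cases "v \<noteq> [] \<and> hd v = letter_inv x")
    case True
    then obtain v' where v: "v = letter_inv x # v'" by (cases v) auto
    then obtain p c q where pcq: "u = p @ c" "v' = winv c @ q" "foldr cons_red u v' = p @ q" "reduced (p @ q)"
      using snoc by (metis reduced_Cons reduced_append)
    moreover have "cons_red x v = v'"
      by (simp add: v cons_red_def)
    ultimately show ?thesis
      using v by (intro exI[of _ p] exI[of _ "c @ [x]"] exI[of _ q]) (auto simp: winv_def)
  next
    case False
    then have "reduced ((u @ [x]) @ v)" using snoc.prems unfolding reduced_append by auto
    then show ?thesis
      using foldr_cons_red_append[of "u @ [x]" v]
      by (intro exI[of _ "u @ [x]"] exI[of _ "[]"] exI[of _ v]) simp
  qed
qed

context
  fixes n :: nat
begin

interpretation group "free_group n" by simp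

abbreviation (input) F where "F \<equiv> free_group n"

abbreviation (input) mulF (infixl "\<cdot>" 70) where "u \<cdot> v \<equiv> u \<otimes>\<^bsub>free_group n\<^esub> v"

abbreviation (input) invF where "invF u \<equiv> inv\<^bsub>free_group n\<^esub> u"

lemma F_carrier: "w \<in> carrier F \<longleftrightarrow> reduced w \<and> set w \<subseteq> {..<n} \<times> UNIV"
  by (simp add: free_group_def)

lemma F_one: "\<one>\<^bsub>F\<^esub> = []"
  by (simp add: free_group_def)

lemma F_mult: "u \<cdot> v = foldr cons_red u v"
  by (simp add: free_group_def)

lemma F_append: "u @ v \<in> carrier F \<longleftrightarrow> u \<in> carrier F \<and> v \<in> carrier F \<and> (u = [] \<or> v = [] \<or> hd v \<noteq> letter_inv (last u))"
  by (auto simp: F_carrier reduced_append)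

lemma F_mult_append: "u @ v \<in> carrier F \<Longrightarrow> u \<cdot> v = u @ v"
  by (simp add: F_mult F_carrier foldr_cons_red_append)

lemma F_winv: "w \<in> carrier F \<Longrightarrow> winv w \<in> carrier F"
  by (force simp: F_carrier winv_def reduced_inverse letter_inv_def)

lemma F_inv: "w \<in> carrier F \<Longrightarrow> invF w = winv w"
  using inv_equality[of "winv w" w] F_winv[of w] foldr_inverse[of w]
  by (simp add: F_mult F_one winv_def)

lemma F_cancel:
  assumes "u \<in> carrier F" "v \<in> carrier F"
  obtains p c q where "u = p @ c" "v = winv c @ q" "u \<cdot> v = p @ q" "p @ q \<in> carrier F"
proof -
  have "u \<cdot> v \<in> carrier F" using assms by simp
  then show ?thesis
    using that foldr_cons_red_cancel[of u v] assms by (auto simp: F_mult F_carrier)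
qed

lemma F_length_mult:
  assumes "u \<in> carrier F" "v \<in> carrier F"
  shows "length (u \<cdot> v) \<le> length u + length v"
proof -
  obtain p c q where "u = p @ c" "v = winv c @ q" "u \<cdot> v = p @ q" using F_cancel[OF assms] .
  then show ?thesis by simp
qed

lemma F_finite_ball: "finite {w \<in> carrier F. length w \<le> k}"
proof (rule finite_subset)
  show "{w \<in> carrier F. length w \<le> k} \<subseteq> {w. set w \<subseteq> {..<n} \<times> UNIV \<and> length w \<le> k}"
    by (auto simp: F_carrier)
qed (simp add: finite_lists_length_le)

definition letters :: "letter list set" where
  "letters = (\<lambda>i. [(i, True)]) ` {..<n}"

lemma letters_carrier: "letters \<subseteq> carrier F"
  by (auto simp: letters_def F_carrier reduced_Cons)

lemma F_letter: "i < n \<Longrightarrow> [(i, b)] \<in> generate F letters"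
proof (cases b)
  case False
  assume "i < n"
  then have "[(i, True)] \<in> letters" by (simp add: letters_def)
  moreover from this have "invF [(i, True)] = [(i, b)]"
    using letters_carrier False by (auto simp: F_inv winv_def letter_inv_def)
  ultimately show ?thesis by (metis generate.inv)
qed (auto simp: letters_def intro: generate.incl)

lemma generate_letters: "generate F letters = carrier F"
proof
  show "carrier F \<subseteq> generate F letters"
  proof
    fix w assume "w \<in> carrier F"
    then show "w \<in> generate F letters"
    proof (induction w)
      case Nil
      then show ?case using generate.one[of F letters] by (simp add: F_one)
    next
      case (Cons x w)
      then have "[x] @ w \<in> carrier F" by simp
      then have "w \<in> carrier F" "[x] \<cdot> w = x # w"
        using F_append[of "[x]" w] F_mult_append[of "[x]" w] by simp_all
      moreover have "fst x < n" using Cons.prems by (auto simp: F_carrier)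
      ultimately show ?case
        using generate.eng[OF F_letter[of "fst x" "snd x"]] Cons.IH by (metis prod.collapse)
    qed
  qed
qed (rule generate_incl[OF letters_carrier])

text \<open>The sum of the labels along the path from the identity to a vertex. The argument is the
  reversed word, so that recursion removes the last edge; an edge passed backwards counts negatively
  at its origin.\<close>

primrec word_potential :: "(letter list \<Rightarrow> letter list \<Rightarrow> int) \<Rightarrow> letter list \<Rightarrow> int" where
  "word_potential c [] = 0"
| "word_potential c (x # w) = word_potential c w +
     (if snd x then c (rev w) [x] else - c (rev (x # w)) [letter_inv x])"

text \<open>Appending a generator to a reduced word either prolongs the path by one edge or undoes
  its last edge; in both cases the sum changes by the label of the edge.\<close>

lemma free_set_letters: "free_set F letters"
  unfolding free_set_def
proof (intro conjI allI exI ballI)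
  fix c w s
  assume w: "w \<in> generate F letters" and "s \<in> letters"
  then obtain i where s: "s = [(i, True)]" "i < n" by (auto simp: letters_def)
  have wc: "w \<in> carrier F" using w generate_letters by simp
  show "word_potential c (rev (w \<cdot> s)) = word_potential c (rev w) + c w s"
  proof (cases "w \<noteq> [] \<and> last w = (i, False)")
    case True
    then obtain v where v: "w = v @ [(i, False)]" by (metis append_butlast_last_id)
    have "w \<cdot> s = v \<cdot> ([(i, False)] \<cdot> s)"
      using F_mult_append[of v "[(i, False)]"] wc v s letters_carrier
      by (auto simp: F_append letters_def simp flip: m_assoc)
    also have "[(i, False)] \<cdot> s = []" by (simp add: F_mult s cons_red_def letter_inv_def)
    finally have "w \<cdot> s = v" using wc v r_one[of v] by (simp add: F_append F_one)
    then show ?thesis using s v by (simp add: letter_inv_def)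
  next
    case False
    then have "w @ s \<in> carrier F"
      using wc s letters_carrier by (auto simp: F_append letters_def letter_inv_def prod_eq_iff)
    then show ?thesis using s by (simp add: F_mult_append)
  qed
qed (rule letters_carrier)

section \<open>Subtrees of the Cayley tree and Howson's theorem\<close>

text \<open>The prefixes of the elements of \<open>K\<close>: the vertices of the minimal \<open>K\<close>-invariant subtree
  spanned by \<open>K\<close> in the Cayley tree.\<close>

definition subtree :: "letter list set \<Rightarrow> letter list set" where
  "subtree K = {u. \<exists>v. u @ v \<in> K}"

lemma subtree_prefix: "u @ v \<in> subtree K \<Longrightarrow> u \<in> subtree K"
  by (auto simp: subtree_def)

text \<open>Either \<open>a\<close> is absorbed and \<open>k \<cdot> a\<close> is a prefix of
  \<open>k\<close>, or a nonempty end of \<open>a\<close> survives and the word completing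
  \<open>a\<close> to an element of \<open>K\<close> also completes
  \<open>k \<cdot> a\<close>.\<close>

lemma subtree_translate:
  assumes K: "subgroup K F" and k: "k \<in> K" and a: "a \<in> subtree K"
  shows "k \<cdot> a \<in> subtree K"
proof -
  have Kc: "K \<subseteq> carrier F" using K by (rule subgroup.subset)
  obtain a' where a': "a @ a' \<in> K" using a by (auto simp: subtree_def)
  have c: "k \<in> carrier F" "a \<in> carrier F" "a' \<in> carrier F" "a @ a' \<in> carrier F"
    using k a' Kc by (auto simp: F_append dest: subsetD)
  obtain p e q where e: "k = p @ e" "a = winv e @ q" "k \<cdot> a = p @ q" "p @ q \<in> carrier F"
    using F_cancel[OF c(1,2)] .
  show ?thesis
  proof (cases "q = []")
    case True
    then show ?thesis using k e by (auto simp: subtree_def)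
  next
    case False
    have "(p @ q) @ a' \<in> carrier F"
      using c(4) e(2,4) False unfolding F_append by auto
    from F_mult_append[OF this] have "k \<cdot> (a \<cdot> a') = (p @ q) @ a'"
      using c(1-3) e(3) by (metis m_assoc)
    moreover have "k \<cdot> (a \<cdot> a') \<in> K"
      using subgroup.m_closed[OF K k a'] F_mult_append[OF c(4)] by simp
    ultimately show ?thesis using e(3) by (auto simp: subtree_def)
  qed
qed

text \<open>\<open>c\<close> bounds the lengths of the generators. A prefix of
  \<open>w \<cdot> s\<close> is a prefix of \<open>w\<close> or ends inside the surviving part of
  \<open>s\<close>; in the latter case the rest of \<open>s\<close> is a short completion.\<close>

lemma quasiconvex:
  assumes S: "S \<subseteq> carrier F" "finite S"
  obtains c where "\<And>u. u \<in> subtree (generate F S) \<Longrightarrow>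
    \<exists>v \<in> carrier F. length v \<le> c \<and> u \<cdot> v \<in> generate F S"
proof -
  let ?K = "generate F S"
  have gc: "y \<in> carrier F" if "y \<in> ?K" for y
    using S(1) that generate_in_carrier by blast
  obtain c where c: "\<And>s. s \<in> S \<Longrightarrow> length s \<le> c"
    using finite_imageI[OF S(2), of length] by (metis finite_nat_set_iff_bounded_le imageI)
  have step: "\<exists>v \<in> carrier F. length v \<le> c \<and> u \<cdot> v \<in> ?K"
    if w: "w \<in> ?K" "\<And>u t. w = u @ t \<Longrightarrow> \<exists>v \<in> carrier F. length v \<le> c \<and> u \<cdot> v \<in> ?K"
      and s: "s \<in> ?K" "length s \<le> c" and ut: "w \<cdot> s = u @ t" for w s u t
  proof -
    obtain p e q where e: "w = p @ e" "s = winv e @ q" "w \<cdot> s = p @ q" "p @ q \<in> carrier F"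
      using F_cancel[OF gc[OF w(1)] gc[OF s(1)]] .
    consider r where "p = u @ r" | r where "u = p @ r" "q = r @ t"
      using ut e(3) by (auto simp: append_eq_append_conv2)
    then show ?thesis
    proof cases
      case 1
      then show ?thesis using w(2)[of u "r @ e"] e(1) by simp
    next
      case 2
      have "u @ t \<in> carrier F" using e ut by simp
      then have "t \<in> carrier F" "u \<cdot> t = w \<cdot> s" using ut by (auto simp: F_append F_mult_append)
      moreover have "length t \<le> c" using s(2) e(2) 2 by simp
      ultimately show ?thesis using generate.eng[OF w(1) s(1)] by metis
    qed
  qed
  have main: "\<forall>u t. w = u @ t \<longrightarrow> (\<exists>v \<in> carrier F. length v \<le> c \<and> u \<cdot> v \<in> ?K)" if "w \<in> ?K" for w
    using S(1) that
  proof (induction rule: generate_right_induct)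
    case one
    have "[] \<in> carrier F" "[] \<cdot> [] \<in> ?K"
      by (metis F_one generate.one one_closed r_one)+
    then show ?case by (auto simp: F_one intro!: bexI[of _ "[]"])
  next
    case (mult y s)
    have "s \<in> ?K" using mult(2) by (rule generate.incl)
    then show ?case using step[OF mult(1) _ _ c[OF mult(2)]] mult(3) by blast
  next
    case (mult_inv y s)
    have s: "invF s \<in> ?K" using mult_inv(2) by (rule generate.inv)
    moreover have "length (invF s) \<le> c" using c[OF mult_inv(2)] S mult_inv(2) by (auto simp: F_inv)
    ultimately show ?case using step[OF mult_inv(1)] mult_inv(3) by blast
  qed
  then show ?thesis by (intro that[of c]) (auto simp: subtree_def)
qed

text \<open>Howson's theorem: an element of the intersection with a long reduced word has two prefixes with
  the same pair of bounded completions to the two subgroups, and can be shortened between them.\<close>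

theorem howson:
  assumes K: "subgroup K F" "fg F K" and L: "subgroup L F" "fg F L"
  shows "fg F (K \<inter> L)"
proof -
  let ?U = "K \<inter> L"
  have Kc: "K \<subseteq> carrier F" and Lc: "L \<subseteq> carrier F" using K L subgroup.subset by blast+
  have U: "subgroup ?U F" using subgroups_Inter_pair[OF K(1) L(1)] .
  obtain A B where A: "A \<subseteq> K" "finite A" "generate F A = K" and B: "B \<subseteq> L" "finite B" "generate F B = L"
    using fg_iff[OF K(1)] fg_iff[OF L(1)] K L by blast
  obtain c where c: "\<And>u. u \<in> subtree K \<Longrightarrow> \<exists>v \<in> carrier F. length v \<le> c \<and> u \<cdot> v \<in> K"
    using quasiconvex[of A] A Kc by (metis subset_trans)
  obtain d where d: "\<And>u. u \<in> subtree L \<Longrightarrow> \<exists>v \<in> carrier F. length v \<le> d \<and> u \<cdot> v \<in> L"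
    using quasiconvex[of B] B Lc by (metis subset_trans)
  obtain f where f: "\<And>u. u \<in> subtree K \<Longrightarrow> f u \<in> carrier F \<and> length (f u) \<le> c \<and> u \<cdot> f u \<in> K"
    using c by metis
  obtain g where g: "\<And>u. u \<in> subtree L \<Longrightarrow> g u \<in> carrier F \<and> length (g u) \<le> d \<and> u \<cdot> g u \<in> L"
    using d by metis
  define V where "V = {w \<in> carrier F. length w \<le> c} \<times> {w \<in> carrier F. length w \<le> d}"
  have finV: "finite V" using F_finite_ball by (simp add: V_def)
  define N where "N = card V"
  \<comment> \<open>The pigeonhole principle is applied to the \<open>N + 1\<close> prefixes of
    length at most \<open>N\<close>; the quotient of two of them has length at most
    \<open>2 * N\<close>.\<close>
  define D where "D = {u \<in> ?U. length u \<le> 2 * N}"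
  have finD: "finite D" using Kc by (intro finite_subset[OF _ F_finite_ball[of "2 * N"]]) (auto simp: D_def)
  have Dc: "D \<subseteq> carrier F" using Kc by (auto simp: D_def)
  have diff: "x \<cdot> invF y \<in> M" if "subgroup M F" "x \<cdot> v \<in> M" "y \<cdot> v \<in> M"
    "x \<in> carrier F" "y \<in> carrier F" "v \<in> carrier F" for M x y v
  proof -
    have "(x \<cdot> v) \<cdot> invF (y \<cdot> v) \<in> M"
      using that subgroup.m_closed subgroup.m_inv_closed by metis
    then show ?thesis using that by (simp add: inv_mult_group m_assoc)
  qed
  have "w \<in> generate F D" if "w \<in> ?U" for w
    using that
  proof (induction "length w" arbitrary: w rule: less_induct)
    case less
    show ?case
    proof (cases "length w \<le> N")
      case True
      then have "w \<in> D" using less.prems by (simp add: D_def)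
      then show ?thesis by (rule generate.incl)
    next
      case False
      have wc: "w \<in> carrier F" using less.prems Kc by blast
      have tk: "take i w \<in> subtree K" "take i w \<in> subtree L" "take i w \<in> carrier F" "drop i w \<in> carrier F" for i
        using less.prems append_take_drop_id[of i w] wc by (auto simp: subtree_def F_append) (metis F_append append_take_drop_id)+
      let ?\<phi> = "\<lambda>i. (f (take i w), g (take i w))"
      have "?\<phi> ` {..N} \<subseteq> V" using f g tk by (auto simp: V_def)
      then have "card (?\<phi> ` {..N}) \<le> N" using finV by (simp add: N_def card_mono)
      then have "\<not> inj_on ?\<phi> {..N}" by (auto dest: card_image)
      then obtain i j where ij: "i < j" "j \<le> N" "?\<phi> i = ?\<phi> j"
        unfolding inj_on_def by (metis atMost_iff linorder_neqE_nat)
      let ?u = "take i w" and ?u' = "take j w" and ?y = "drop j w"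
      let ?t = "?u' \<cdot> invF ?u" and ?w = "?u \<cdot> ?y"
      have "?t \<in> K" using diff[OF K(1), of ?u' "f ?u'" ?u] f[OF tk(1)] ij(3) tk by (metis prod.inject)
      moreover have "?t \<in> L" using diff[OF L(1), of ?u' "g ?u'" ?u] g[OF tk(2)] ij(3) tk by (metis prod.inject)
      ultimately have t: "?t \<in> ?U" by blast
      have w: "w = ?u' \<cdot> ?y" using F_mult_append[of ?u' ?y] wc by simp
      have "?u \<cdot> ?y = invF ?t \<cdot> (?u' \<cdot> ?y)" "?u' \<cdot> ?y = ?t \<cdot> (?u \<cdot> ?y)"
        using tk(3)[of i] tk(3)[of j] tk(4)[of j] by (simp_all add: inv_mult_group m_assoc)
      then have w': "?w = invF ?t \<cdot> w" and w'': "w = ?t \<cdot> ?w" using w by simp_all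
      have "?w \<in> ?U" unfolding w' using t less.prems subgroup.m_closed[OF U] subgroup.m_inv_closed[OF U] by blast
      moreover have "length ?w < length w"
        using F_length_mult[OF tk(3)[of i] tk(4)[of j]] ij False by simp
      ultimately have "?w \<in> generate F D" using less.hyps by blast
      moreover have "?t \<in> D"
        using t F_length_mult[OF tk(3)[of j] F_winv[OF tk(3)[of i]]] ij by (auto simp: D_def F_inv[OF tk(3)])
      ultimately show ?thesis using w'' generate.eng[OF generate.incl] by metis
    qed
  qed
  moreover have "generate F D \<subseteq> ?U" by (rule generate_subgroup_incl[OF _ U]) (auto simp: D_def)
  ultimately show ?thesis using fgI[OF Dc finD] by blast
qed

section \<open>Ping-pong and the construction of new free factors\<close>

text \<open>Ping-pong: no cancellation occurs in a product whose factors belong alternately to \<open>A\<close> and \<open>B\<close>.\<close>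

lemma free_product_free_set:
  fixes S :: "bool \<Rightarrow> letter list set" and b :: letter
  assumes S: "\<And>k. free_set F (S k)"
    and ty: "\<And>k w. w \<in> generate F (S k) \<Longrightarrow> w \<noteq> [] \<Longrightarrow> (hd w = b \<longleftrightarrow> k) \<and> (last w = letter_inv b \<longleftrightarrow> k)"
  shows "free_set F (S True \<union> S False)"
proof -
  define A where "A k = generate F (S k)" for k
  let ?S = "S True \<union> S False"
  let ?V = "generate F ?S"
  have Sc: "S k \<subseteq> carrier F" for k using S free_set_carrier by blast
  then have SSc: "?S \<subseteq> carrier F" by blast
  have A: "subgroup (A k) F" for k unfolding A_def using Sc by (rule generate_is_subgroup)
  have Ac: "w \<in> carrier F" if "w \<in> A k" for w k using A that subgroup.mem_carrier by metis
  have AV: "w \<in> ?V" if "w \<in> A k" for w k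
    using that mono_generate[of "S k" ?S] by (cases k) (auto simp: A_def)
  have Vc: "w \<in> carrier F" if "w \<in> ?V" for w using SSc that generate_in_carrier by blast
  have SA: "s \<in> A k" if "s \<in> S k" for s k using that by (auto simp: A_def intro: generate.incl)
  define tp where "tp w \<longleftrightarrow> hd w = b" for w :: "letter list"
  define ed where "ed w \<longleftrightarrow> last w = letter_inv b" for w :: "letter list"
  have tpA: "tp w = k" and edA: "ed w = k" if "w \<in> A k" "w \<noteq> []" for w k
    using ty[of w k] that by (auto simp: A_def tp_def ed_def)
  have conc: "u \<cdot> v = u @ v" if "u \<in> carrier F" "v \<in> carrier F" "u = [] \<or> v = [] \<or> ed u \<noteq> tp v" for u v
  proof -
    have "hd v \<noteq> letter_inv (last u)" if "ed u \<noteq> tp v"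
      using that letter_inv_invol by (metis tp_def ed_def)
    then have "u @ v \<in> carrier F" using that by (auto simp: F_append)
    then show ?thesis by (rule F_mult_append)
  qed
  define step where "step g g' \<longleftrightarrow> g' = [] \<or> tp g' = tp g" for g g'
  \<comment> \<open>\<open>g\<close> is a concatenation of nonempty factors from alternating groups,
    and \<open>Y\<close> is the type of the last factor.\<close>
  define NF where "NF g Y \<longleftrightarrow> (\<exists>zs. zs \<noteq> [] \<and> g = concat (map snd zs) \<and> fst (last zs) = Y \<and>
      (\<forall>(k, z) \<in> set zs. z \<in> A k \<and> z \<noteq> []) \<and> successively (\<lambda>x y. fst x \<noteq> fst y) zs)" for g Y
  have NF_base: "NF z Y" if "z \<in> A Y" "z \<noteq> []" for z Y
    unfolding NF_def using that by (intro exI[of _ "[(Y, z)]"]) auto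
  have NF_step: "NF (g @ z) (\<not> Y)" if "NF g Y" "z \<in> A (\<not> Y)" "z \<noteq> []" for g z Y
  proof -
    obtain zs where "zs \<noteq> [] \<and> g = concat (map snd zs) \<and> fst (last zs) = Y \<and>
      (\<forall>(k, z) \<in> set zs. z \<in> A k \<and> z \<noteq> []) \<and> successively (\<lambda>x y. fst x \<noteq> fst y) zs"
      using \<open>NF g Y\<close> unfolding NF_def by blast
    then show ?thesis unfolding NF_def using that
      by (intro exI[of _ "zs @ [(\<not> Y, z)]"]) (auto simp: successively_append_iff)
  qed
  have NF_cases: "g \<in> A Y \<and> g \<noteq> [] \<or> (\<exists>h z. g = h @ z \<and> NF h (\<not> Y) \<and> z \<in> A Y \<and> z \<noteq> [])" if "NF g Y" for g Y
  proof -
    obtain zs where zs: "zs \<noteq> []" "g = concat (map snd zs)" "fst (last zs) = Y"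
      "\<forall>(k, z) \<in> set zs. z \<in> A k \<and> z \<noteq> []" "successively (\<lambda>x y. fst x \<noteq> fst y) zs"
      using \<open>NF g Y\<close> unfolding NF_def by (elim exE conjE) (rule that)
    obtain ys y where ys: "zs = ys @ [y]" using zs(1) by (metis append_butlast_last_id)
    obtain z where y: "y = (Y, z)" using zs(3) ys by (cases y) auto
    have z: "z \<in> A Y" "z \<noteq> []" using zs(4) ys y by auto
    show ?thesis
    proof (cases "ys = []")
      case True
      then show ?thesis using zs(2) ys y z by simp
    next
      case False
      then have "fst (last ys) = (\<not> Y)" using zs(5) ys y by (auto simp: successively_append_iff)
      moreover have "\<forall>(k, z) \<in> set ys. z \<in> A k \<and> z \<noteq> []" using zs(4) ys by simp
      moreover have "successively (\<lambda>x y. fst x \<noteq> fst y) ys"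
        using zs(5) ys by (simp add: successively_append_iff)
      ultimately have "NF (concat (map snd ys)) (\<not> Y)"
        unfolding NF_def using False by blast
      then show ?thesis using zs(2) ys y z by auto
    qed
  qed
  have NF_word: "g \<noteq> [] \<and> ed g = Y \<and> g \<in> carrier F" if "NF g Y" for g Y
    using that
  proof (induction "length g" arbitrary: g Y rule: less_induct)
    case less
    consider "g \<in> A Y" "g \<noteq> []" | h z where "g = h @ z" "NF h (\<not> Y)" "z \<in> A Y" "z \<noteq> []"
      using NF_cases[OF less.prems] by blast
    then show ?case
    proof cases
      case 1
      then show ?thesis using edA Ac by blast
    next
      case 2
      then have h: "h \<noteq> [] \<and> ed h = (\<not> Y) \<and> h \<in> carrier F" using less.hyps[of h "\<not> Y"] by simp
      then have "h \<cdot> z = g" using conc[of h z] tpA[OF 2(3,4)] Ac[OF 2(3)] 2(1) by simp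
      then show ?thesis using h m_closed[of h z] Ac[OF 2(3)] edA[OF 2(3,4)] 2 by (auto simp: ed_def)
    qed
  qed
  have NF_mult: "g \<cdot> t = [] \<or> ((\<exists>Y'. NF (g \<cdot> t) Y') \<and> tp (g \<cdot> t) = tp g)"
    if g: "NF g Y" and t: "t \<in> A Z" for g Y t Z
  proof -
    have gc: "g \<in> carrier F" "g \<noteq> []" "ed g = Y" using NF_word[OF g] by auto
    have tc: "t \<in> carrier F" using t Ac by blast
    consider "t = []" | "t \<noteq> []" "Z \<noteq> Y" | "t \<noteq> []" "Z = Y" by blast
    then show ?thesis
    proof cases
      case 1
      then have "g \<cdot> t = g" using gc r_one[of g] by (simp add: F_one)
      then show ?thesis using g by auto
    next
      case 2
      then have "g \<cdot> t = g @ t" using conc gc tc tpA[OF t] by auto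
      then show ?thesis using NF_step[OF g, of t] 2 t gc by (auto simp: tp_def)
    next
      case 3
      consider "g \<in> A Y" | h z where "g = h @ z" "NF h (\<not> Y)" "z \<in> A Y" "z \<noteq> []"
        using NF_cases[OF g] by blast
      then show ?thesis
      proof cases
        case 1
        then have "g \<cdot> t \<in> A Y" using t 3 subgroup.m_closed[OF A] by blast
        then show ?thesis using NF_base tpA 1 gc by metis
      next
        case 2
        have h: "h \<noteq> []" "ed h = (\<not> Y)" "h \<in> carrier F" using NF_word[OF 2(2)] by auto
        have zc: "z \<in> carrier F" using 2 Ac by blast
        have zt: "z \<cdot> t \<in> A Y" using t 2 3 subgroup.m_closed[OF A] by blast
        have "h \<cdot> z = g" using conc[of h z] tpA[OF 2(3,4)] h zc 2(1) by simp
        then have gt: "g \<cdot> t = h \<cdot> (z \<cdot> t)" using h zc tc m_assoc by metis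
        show ?thesis
        proof (cases "z \<cdot> t = []")
          case True
          then have "g \<cdot> t = h" using gt h r_one[of h] by (simp add: F_one)
          then show ?thesis using 2 h by (auto simp: tp_def)
        next
          case False
          then have "g \<cdot> t = h @ (z \<cdot> t)"
            unfolding gt using conc[of h "z \<cdot> t"] tpA[OF zt] h Ac[OF zt] by simp
          then show ?thesis using NF_step[OF 2(2), of "z \<cdot> t"] zt False 2 h by (auto simp: tp_def)
        qed
      qed
    qed
  qed
  have V_NF: "g = [] \<or> (\<exists>Y. NF g Y)" if "g \<in> ?V" for g
  proof -
    have mult': "g \<cdot> t = [] \<or> (\<exists>Y. NF (g \<cdot> t) Y)" if "g = [] \<or> (\<exists>Y. NF g Y)" "t \<in> A k" for g t k
    proof (cases "g = []")
      case True
      then have "g \<cdot> t = t" using l_one[of t] Ac[OF that(2)] by (simp add: F_one)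
      then show ?thesis using NF_base that(2) by metis
    next
      case False
      then show ?thesis using NF_mult that by blast
    qed
    show ?thesis
      using SSc that
    proof (induction rule: generate_right_induct)
      case (mult y s)
      then obtain k where "s \<in> A k" using SA by blast
      then show ?case using mult'[OF mult(3)] mult(1) by blast
    next
      case (mult_inv y s)
      then obtain k where "s \<in> A k" using SA by blast
      then have "invF s \<in> A k" using subgroup.m_inv_closed[OF A] by blast
      then show ?case using mult'[OF mult_inv(3)] mult_inv(1) by blast
    qed (simp add: F_one)
  qed
  have key: "g \<cdot> t = [] \<or> tp (g \<cdot> t) = tp g" if "g \<in> ?V" "g \<noteq> []" "t \<in> A Z" for g t Z
    using V_NF[OF that(1)] NF_mult that by blast
  \<comment> \<open>\<open>a\<close> is the point of \<open>A k\<close> at which the path towards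
    \<open>g\<close> leaves \<open>A k\<close>. It is unique and defines a retraction
    \<open>\<alpha> k\<close> of the generated subgroup onto \<open>A k\<close>.\<close>
  define P where "P k g a \<longleftrightarrow> a \<in> A k \<and> (invF a \<cdot> g = [] \<or> tp (invF a \<cdot> g) \<noteq> k)" for k g a
  have P_unique: "a = a'" if P: "P k g a" "P k g a'" and g: "g \<in> carrier F" for k g a a'
  proof (rule ccontr)
    assume "a \<noteq> a'"
    define x where "x = invF a' \<cdot> a"
    have a: "a \<in> A k" "a' \<in> A k" "a \<in> carrier F" "a' \<in> carrier F" using P Ac by (auto simp: P_def)
    have x: "x \<in> A k" using a subgroup.m_closed[OF A] subgroup.m_inv_closed[OF A] by (simp add: x_def)
    have "x \<noteq> []" using \<open>a \<noteq> a'\<close> a unfolding x_def by (metis F_one inv_closed inv_equality inv_inv)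
    let ?v = "invF a \<cdot> g" and ?v' = "invF a' \<cdot> g"
    have v: "?v \<in> carrier F" using a g by simp
    have "?v' = x \<cdot> ?v" using a g by (simp add: x_def m_assoc)
    also have "\<dots> = x @ ?v" using conc[of x ?v] P(1) edA[OF x \<open>x \<noteq> []\<close>] Ac[OF x] v by (auto simp: P_def)
    finally have "?v' = x @ ?v" .
    then show False using P(2) tpA[OF x \<open>x \<noteq> []\<close>] \<open>x \<noteq> []\<close> by (auto simp: P_def tp_def)
  qed
  have P_self: "P k a a" if "a \<in> A k" for k a
    using that Ac F_one by (simp add: P_def)
  have P_mult: "P k (g \<cdot> t) a" if "P k g a" "g \<in> ?V" "t \<in> A Z" "g \<notin> A k \<or> Z \<noteq> k" for k g a t Z
  proof -
    have a: "a \<in> A k" "a \<in> carrier F" using that Ac by (auto simp: P_def)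
    have gc: "g \<in> carrier F" and tc: "t \<in> carrier F" using that Vc Ac by blast+
    let ?v = "invF a \<cdot> g"
    have v: "?v \<in> ?V" using a that AV subgroup.m_inv_closed[OF A] by (blast intro: generate.eng)
    have vt: "invF a \<cdot> (g \<cdot> t) = ?v \<cdot> t" using a gc tc by (simp add: m_assoc)
    show ?thesis
    proof (cases "?v = []")
      case True
      then have "g = a" using a gc by (metis F_one inv_closed inv_equality inv_inv)
      then have "Z \<noteq> k" using that a by blast
      moreover have "?v \<cdot> t = t" using True tc l_one[of t] by (simp add: F_one)
      ultimately show ?thesis using tpA[OF that(3)] a vt by (auto simp: P_def)
    next
      case False
      then show ?thesis using key[OF v False that(3)] that(1) vt by (auto simp: P_def)
    qed
  qed
  have P_ex: "\<exists>a. P k g a" if "g \<in> ?V" for k g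
  proof -
    have mult': "\<exists>a. P k (g \<cdot> t) a" if "\<exists>a. P k g a" "g \<in> ?V" "t \<in> A Z" for g t Z
    proof (cases "g \<in> A k \<and> Z = k")
      case True
      then have "g \<cdot> t \<in> A k" using that subgroup.m_closed[OF A] by blast
      then show ?thesis using P_self by blast
    next
      case False
      then show ?thesis using P_mult that by blast
    qed
    show ?thesis
      using SSc that
    proof (induction rule: generate_right_induct)
      case one
      have "\<one>\<^bsub>F\<^esub> \<in> A k" using subgroup.one_closed[OF A] .
      then show ?case using P_self by blast
    next
      case (mult y s)
      then obtain Z where "s \<in> A Z" using SA by blast
      then show ?case using mult'[OF mult(3)] mult(1) by blast
    next
      case (mult_inv y s)
      then obtain Z where "s \<in> A Z" using SA by blast
      then have "invF s \<in> A Z" using subgroup.m_inv_closed[OF A] by blast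
      then show ?case using mult'[OF mult_inv(3)] mult_inv(1) by blast
    qed
  qed
  define \<alpha> where "\<alpha> k g = (THE a. P k g a)" for k g
  have \<alpha>: "\<alpha> k g = a" if "P k g a" "g \<in> carrier F" for k g a
    unfolding \<alpha>_def using that P_unique by (intro the_equality) auto
  have P_\<alpha>: "P k g (\<alpha> k g)" if "g \<in> ?V" for k g
    using P_ex[OF that] \<alpha> Vc[OF that] by metis
  show ?thesis
  proof (rule free_setI_edges[OF SSc])
    fix s assume "s \<in> ?S"
    then obtain k where sX: "s \<in> S k" by blast
    obtain f :: "letter list \<Rightarrow> int" where f: "\<And>x t. x \<in> A k \<Longrightarrow> t \<in> S k \<Longrightarrow>
        f (x \<cdot> t) = f x + (if x = \<one>\<^bsub>F\<^esub> \<and> t = s then 1 else 0)"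
      using free_setD[OF S[of k], of "\<lambda>x t. if x = \<one>\<^bsub>F\<^esub> \<and> t = s then 1 else 0"] unfolding A_def by blast
    \<comment> \<open>The retraction is constant along all edges except those of the Cayley graph of
      \<open>A k\<close>, which it fixes. Composing with it therefore extends the potential of one
      edge from \<open>A k\<close> to the whole group.\<close>
    have "f (\<alpha> k (x \<cdot> t)) = f (\<alpha> k x) + (if x = \<one>\<^bsub>F\<^esub> \<and> t = s then 1 else 0)"
      if x: "x \<in> ?V" and t: "t \<in> ?S" for x t
    proof -
      obtain Z where tZ: "t \<in> S Z" using t by blast
      have tA: "t \<in> A Z" using SA tZ by blast
      have xt: "x \<cdot> t \<in> carrier F" using Vc[OF x] Ac[OF tA] by simp
      show ?thesis
      proof (cases "x \<in> A k \<and> Z = k")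
        case True
        then have "x \<cdot> t \<in> A k" using tA subgroup.m_closed[OF A] by blast
        then show ?thesis using f[of x t] True tZ \<alpha>[OF P_self] Ac by auto
      next
        case False
        have "\<alpha> k (x \<cdot> t) = \<alpha> k x"
          using \<alpha>[OF P_mult[OF P_\<alpha>[OF x] x tA] xt] False by blast
        moreover have "\<not> (x = \<one>\<^bsub>F\<^esub> \<and> t = s)"
        proof
          assume "x = \<one>\<^bsub>F\<^esub> \<and> t = s"
          then have "Z \<noteq> k" "s \<in> A Z" "s \<in> A k"
            using False subgroup.one_closed[OF A] tA SA[OF sX] by auto
          then have "s = []" using tpA by metis
          then show False using one_notin_free_set[OF S[of k]] sX by (simp add: F_one)
        qed
        ultimately show ?thesis by simp
      qed
    qed
    then show "\<exists>h :: letter list \<Rightarrow> int. \<forall>x \<in> ?V. \<forall>t \<in> ?S. h (x \<cdot> t) = h x + (if x = \<one>\<^bsub>F\<^esub> \<and> t = s then 1 else 0)"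
      by (intro exI[of _ "\<lambda>x. f (\<alpha> k x)"]) blast
  qed
qed

definition avoids_start :: "letter \<Rightarrow> letter list set \<Rightarrow> bool" where
  "avoids_start b K \<longleftrightarrow> (\<forall>w \<in> K. w \<noteq> [] \<longrightarrow> hd w \<noteq> b)"

text \<open>Such a word cancels on neither side against nonempty elements of a subgroup that avoids
  the start \<open>b\<close>; these are the two types of ping-pong.\<close>

definition loop_at :: "letter \<Rightarrow> letter list \<Rightarrow> bool" where
  "loop_at b w \<longleftrightarrow> w \<noteq> [] \<and> hd w = b \<and> last w = letter_inv b"

lemma avoids_start_last:
  assumes "subgroup K F" "avoids_start b K" "w \<in> K" "w \<noteq> []"
  shows "last w \<noteq> letter_inv b"
proof -
  have "w \<in> carrier F" using assms subgroup.mem_carrier by metis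
  then have "winv w \<in> K" using subgroup.m_inv_closed[OF assms(1,3)] F_inv by simp
  then have "hd (winv w) \<noteq> b" using assms by (simp add: avoids_start_def)
  then show ?thesis using hd_winv[OF assms(4)] by auto
qed

text \<open>No cancellation occurs in \<open>y x y\<inverse>\<close> for nonempty \<open>x\<close>
  in \<open>K\<close>, so the nontrivial elements of the conjugate of \<open>generate F {u}\<close>
  are loops at \<open>b\<close>, while \<open>K\<close> avoids \<open>b\<close>. The result
  \<open>r\<close> is again a loop at \<open>b\<close>, so the lemma can be iterated with
  \<open>r\<close> in place of \<open>y\<close>.\<close>

lemma exists_free_generator:
  assumes K: "K = generate F S" "free_set F S" "avoids_start b K"
    and y: "y \<in> carrier F" "loop_at b y" and u: "u \<in> K" "u \<noteq> []"
    and W: "subgroup W F" "y \<in> W" "u \<in> W"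
  obtains r where "r \<in> W" "loop_at b r" "r \<notin> K" "free_set F (insert r S)"
    "r \<in> generate F {y \<cdot> u \<cdot> invF y}"
proof -
  have Sc: "S \<subseteq> carrier F" using K free_set_carrier by blast
  have Kg: "subgroup K F" using generate_is_subgroup[OF Sc] K by simp
  have uc: "u \<in> carrier F" using Kg u subgroup.mem_carrier by metis
  let ?q = "y \<cdot> u \<cdot> invF y"
  let ?Q = "generate F {?q}"
  have qc: "?q \<in> carrier F" using y uc by simp
  have Q: "subgroup ?Q F" using qc by (intro generate_is_subgroup) simp
  have "?Q = (\<lambda>x. y \<cdot> x \<cdot> invF y) ` generate F {u}"
    using generate_conj[OF y(1), of "{u}"] uc by simp
  moreover have "generate F {u} \<subseteq> K" using generate_subgroup_incl[OF _ Kg] u by simp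
  ultimately have Q_ex: "\<exists>x \<in> K. w = y \<cdot> x \<cdot> invF y" if "w \<in> ?Q" for w using that by blast
  have Qloop: "loop_at b w" if w: "w \<in> ?Q" "w \<noteq> []" for w
  proof -
    obtain x where x: "x \<in> K" "w = y \<cdot> x \<cdot> invF y" using Q_ex[OF w(1)] by blast
    have xc: "x \<in> carrier F" using Kg x subgroup.mem_carrier by metis
    have "x \<noteq> []"
    proof
      assume "x = []"
      then have "w = []" using x(2) y(1) r_one[OF y(1)] by (simp add: F_one)
      then show False using w by simp
    qed
    have xb: "hd x \<noteq> b" "last x \<noteq> letter_inv b"
      using K(3) avoids_start_last[OF Kg K(3)] x \<open>x \<noteq> []\<close> by (auto simp: avoids_start_def)
    have yx: "y @ x \<in> carrier F" using y xc xb by (simp add: F_append loop_at_def)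
    have "(y @ x) @ winv y \<in> carrier F"
      using yx y F_winv[OF y(1)] xb \<open>x \<noteq> []\<close> by (auto simp: F_append hd_winv loop_at_def)
    then have "(y @ x) \<cdot> winv y = (y @ x) @ winv y" by (rule F_mult_append)
    then have "w = y @ x @ winv y" using x(2) F_mult_append[OF yx] F_inv[OF y(1)] by simp
    then show ?thesis using y by (auto simp: loop_at_def last_winv)
  qed
  have fgQ: "fg F ?Q" by (rule fgI[of "{?q}"]) (use qc in auto)
  \<comment> \<open>Ping-pong needs a free basis of the cyclic group \<open>?Q\<close>.
    Nielsen-Schreier provides one, and the rank shows that it consists of a single element
    \<open>r\<close>.\<close>
  obtain R where R: "free_set F R" "finite R" "generate F R = ?Q" "card R = rank_of F ?Q"
    using free_basis[OF free_set_letters Q _ fgQ] generate_letters generate_incl[of "{?q}"] qc by auto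
  have "card R \<le> 1" using R(4) rank_of_le[of "{?q}" ?Q] qc by simp
  have q1: "?q \<noteq> []"
  proof
    assume "?q = []"
    then have "?q = \<one>\<^bsub>F\<^esub>" by (simp add: F_one)
    moreover have "u = invF y \<cdot> ?q \<cdot> y" using y uc by (simp add: m_assoc)
    ultimately have "u = \<one>\<^bsub>F\<^esub>" using y by simp
    then show False using u by (simp add: F_one)
  qed
  moreover have "?q \<in> ?Q" by (rule generate.incl) simp
  ultimately have "R \<noteq> {}" using R(3) generate_empty by (auto simp: F_one)
  then have "card R = 1" using \<open>card R \<le> 1\<close> R(2) by (simp add: le_antisym Suc_leI card_gt_0_iff)
  then obtain r where r: "R = {r}" by (auto simp: card_1_singleton_iff)
  have rQ: "r \<in> ?Q" using R(3) r by (auto intro: generate.incl)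
  have "r \<noteq> []" using one_notin_free_set[OF R(1)] r by (auto simp: F_one)
  then have rl: "loop_at b r" using Qloop rQ by blast
  have "r \<notin> K"
    using rl K(3) by (auto simp: loop_at_def avoids_start_def)
  have "free_set F ((\<lambda>k. if k then R else S) True \<union> (\<lambda>k. if k then R else S) False)"
  proof (rule free_product_free_set[of "\<lambda>k. if k then R else S" b])
    fix k w assume w: "w \<in> generate F (if k then R else S)" "w \<noteq> []"
    show "(hd w = b \<longleftrightarrow> k) \<and> (last w = letter_inv b \<longleftrightarrow> k)"
    proof (cases k)
      case True
      then show ?thesis using Qloop[of w] w R(3) by (simp add: loop_at_def)
    next
      case False
      then have "w \<in> K" using w K by simp
      then show ?thesis using False w K(3) avoids_start_last[OF Kg K(3)] by (auto simp: avoids_start_def)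
    qed
  qed (use R K in simp)
  then have "free_set F (insert r S)" using r by simp
  moreover have "r \<in> W"
  proof -
    have "?q \<in> W" using W subgroup.m_closed subgroup.m_inv_closed by metis
    then show ?thesis using generate_subgroup_incl[OF _ W(1), of "{?q}"] rQ by blast
  qed
  ultimately show ?thesis using that rl \<open>r \<notin> K\<close> rQ by blast
qed

text \<open>If \<open>P\<close> contains no loop at \<open>b\<close>, then any two of its elements starting with \<open>b\<close> are comparable for
  the suffix order, hence all of them are powers of the shortest one.\<close>

lemma exists_loop_at:
  assumes P: "subgroup P F" and ncyc: "\<And>g. P \<noteq> generate F {g}"
    and x: "x \<in> P" "x \<noteq> []" "hd x = b"
  obtains y where "y \<in> P" "loop_at b y"
proof (rule ccontr)
  note result = that
  assume "\<not> thesis"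
  then have no: "\<not> loop_at b y" if "y \<in> P" for y using that result by blast
  define C where "C = {g \<in> P. g \<noteq> [] \<and> hd g = b}"
  have Pc: "g \<in> carrier F" if "g \<in> P" for g using P that subgroup.mem_carrier by metis
  have CP: "g \<in> P" "g \<in> carrier F" if "g \<in> C" for g using that Pc by (auto simp: C_def)
  have suf: "(\<exists>p. g = p @ h) \<or> (\<exists>p. h = p @ g)" if gh: "g \<in> C" "h \<in> C" for g h
  proof -
    have hi: "winv h \<in> carrier F" using CP gh F_winv by blast
    obtain p c q where e: "g = p @ c" "winv h = winv c @ q" "g \<cdot> winv h = p @ q"
      using F_cancel[OF CP(2)[OF gh(1)] hi] by metis
    have h: "h = winv q @ c" using arg_cong[OF e(2), of winv] by simp
    have pq: "p @ q \<in> P"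
      using e(3) subgroup.m_closed[OF P CP(1)[OF gh(1)] subgroup.m_inv_closed[OF P CP(1)[OF gh(2)]]]
      F_inv[OF CP(2)[OF gh(2)]] by simp
    consider "p = []" | "q = []" | "p \<noteq> []" "q \<noteq> []" by blast
    then show ?thesis
    proof cases
      case 3
      have "hd (p @ q) = b" using 3 e(1) gh by (auto simp: C_def)
      moreover have "last (p @ q) = letter_inv b" using 3 h gh last_winv[of "winv q"] by (auto simp: C_def)
      ultimately show ?thesis using no[OF pq] 3 by (simp add: loop_at_def)
    qed (use e(1) h in auto)
  qed
  have "x \<in> C" using x by (simp add: C_def)
  then obtain g0 where g0: "g0 \<in> C" and min: "\<And>h. h \<in> C \<Longrightarrow> length g0 \<le> length h"
    using ex_has_least_nat[of "\<lambda>g. g \<in> C" x length] by blast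
  let ?Q = "generate F {g0}"
  have Q: "subgroup ?Q F" using CP g0 by (intro generate_is_subgroup) simp
  have g0Q: "g0 \<in> ?Q" by (rule generate.incl) simp
  have CQ: "h \<in> ?Q" if "h \<in> C" for h
    using that
  proof (induction "length h" arbitrary: h rule: less_induct)
    case less
    have hc: "h \<in> carrier F" using less.prems CP by blast
    show ?case
    proof (cases "h = g0")
      case False
      then obtain p where p: "h = p @ g0" "p \<noteq> []"
        using suf[OF less.prems g0] min[OF less.prems] by auto
      have pc: "p \<in> carrier F" using hc p by (simp add: F_append)
      have hp: "h = p \<cdot> g0" using F_mult_append[of p g0] hc p by simp
      then have "p = h \<cdot> invF g0" using pc CP[OF g0] by (simp add: m_assoc)
      then have "p \<in> P" using CP[OF g0] CP[OF less.prems] subgroup.m_closed[OF P] subgroup.m_inv_closed[OF P] by simp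
      moreover have "hd p = b" using less.prems p by (auto simp: C_def)
      ultimately have "p \<in> C" using p by (simp add: C_def)
      moreover have "length p < length h" using p g0 by (simp add: C_def)
      ultimately have "p \<in> ?Q" using less.hyps by blast
      then show ?thesis using hp g0Q subgroup.m_closed[OF Q] by simp
    qed (use g0Q in simp)
  qed
  \<comment> \<open>By assumption no element of \<open>C\<close> ends with the inverse of
    \<open>b\<close>, so appending \<open>g0\<close>, which starts with \<open>b\<close>, causes no
    cancellation: \<open>C\<close> contains arbitrarily long words.\<close>
  have long: "\<exists>g \<in> C. k < length g" for k
  proof (induction k)
    case 0
    then show ?case using g0 by (auto simp: C_def)
  next
    case (Suc k)
    then obtain g where g: "g \<in> C" "k < length g" by blast
    have "last g \<noteq> letter_inv b" using no[OF CP(1)[OF g(1)]] g(1) by (simp add: loop_at_def C_def)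
    then have "g @ g0 \<in> carrier F"
      using CP[OF g(1)] CP[OF g0] g0 g(1) by (auto simp: F_append C_def)
    then have "g \<cdot> g0 = g @ g0" by (rule F_mult_append)
    then have "g @ g0 \<in> P" using subgroup.m_closed[OF P CP(1)[OF g(1)] CP(1)[OF g0]] by simp
    then have "g @ g0 \<in> C" using g(1) by (simp add: C_def)
    moreover have "Suc k < length (g @ g0)" using g(2) g0 by (cases g0) (auto simp: C_def)
    ultimately show ?case by blast
  qed
  \<comment> \<open>A word \<open>g\<close> of \<open>C\<close> longer than \<open>u\<close> keeps
    its first letter in \<open>g \<cdot> u\<close>. Hence both \<open>g\<close> and
    \<open>g \<cdot> u\<close> lie in \<open>C\<close>, and \<open>u\<close> is their
    quotient.\<close>
  have "P \<subseteq> ?Q"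
  proof
    fix u assume u: "u \<in> P"
    obtain g where g: "g \<in> C" "length u < length g" using long by blast
    obtain p c q where e: "g = p @ c" "u = winv c @ q" "g \<cdot> u = p @ q"
      using F_cancel[OF CP(2)[OF g(1)] Pc[OF u]] by metis
    have "p \<noteq> []" using e g(2) by auto
    then have "g \<cdot> u \<noteq> [] \<and> hd (g \<cdot> u) = b" using e g(1) by (simp add: C_def)
    then have "g \<cdot> u \<in> C" using subgroup.m_closed[OF P CP(1)[OF g(1)] u] by (simp add: C_def)
    then have "invF g \<cdot> (g \<cdot> u) \<in> ?Q"
      using CQ g(1) subgroup.m_closed[OF Q] subgroup.m_inv_closed[OF Q] by blast
    then show "u \<in> ?Q" using CP(2)[OF g(1)] Pc[OF u] by simp
  qed
  moreover have "?Q \<subseteq> P" using generate_subgroup_incl[OF _ P] CP(1)[OF g0] by simp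
  ultimately show False using ncyc by blast
qed

text \<open>Since \<open>g\<close> is shorter than \<open>w\<close>, the product
  \<open>w \<cdot> g\<close> still starts with \<open>b\<close>. If the multiplication by the
  inverse of \<open>w\<close> then swallows all of it, what remains is the inverse of a nonempty
  prefix of \<open>w\<close>, and its inverse starts with \<open>b\<close>.\<close>

lemma exists_start:
  assumes w: "w \<in> carrier F" "w \<noteq> []" "hd w = b" and g: "g \<in> carrier F" "g \<noteq> []" "length g < length w"
    and P: "subgroup P F" "w \<cdot> g \<cdot> invF w \<in> P"
  obtains x where "x \<in> P" "x \<noteq> []" "hd x = b"
proof -
  obtain p c q where e: "w = p @ c" "g = winv c @ q" "w \<cdot> g = p @ q" "p @ q \<in> carrier F"
    using F_cancel[OF w(1) g(1)] .
  have "p \<noteq> []" using e g(3) by auto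
  then have b: "hd (p @ q) = b" "p @ q \<noteq> []" using e w by auto
  obtain p' c' q' where e': "p @ q = p' @ c'" "winv w = winv c' @ q'" "(p @ q) \<cdot> winv w = p' @ q'"
    using F_cancel[OF e(4) F_winv[OF w(1)]] by metis
  have x: "p' @ q' \<in> P" using P(2) e(3) e'(3) F_inv[OF w(1)] by simp
  show ?thesis
  proof (cases "p' = []")
    case False
    then have "hd (p' @ q') = b" using e' b by auto
    then show ?thesis using that x False by blast
  next
    case True
    have w': "w = winv q' @ c'" using arg_cong[OF e'(2), of winv] by simp
    have "q' \<noteq> []"
    proof
      assume "q' = []"
      then have "w \<cdot> g = w" using w' e' True e(3) by simp
      then have "g = \<one>\<^bsub>F\<^esub>" using w(1) g(1) by (metis inv_mult_cancel(1) l_inv)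
      then show False using g by (simp add: F_one)
    qed
    have q'P: "q' \<in> P" using x True by simp
    then have "q' \<in> carrier F" using P subgroup.mem_carrier by metis
    then have "winv q' \<in> P" using subgroup.m_inv_closed[OF P(1) q'P] F_inv by simp
    moreover have "hd (winv q') = b" using w' w \<open>q' \<noteq> []\<close> by auto
    ultimately show ?thesis using that[of "winv q'"] \<open>q' \<noteq> []\<close> by simp
  qed
qed

text \<open>If \<open>p \<cdot> v\<close> and \<open>p' \<cdot> v\<close> both lie in
  \<open>K\<close>, then \<open>p\<close> and \<open>p'\<close> are in the same coset of
  \<open>K\<close>. Completions from a finite ball would thus leave only finitely many
  cosets.\<close>

lemma exists_far:
  assumes P: "subgroup P F" and K: "subgroup K F" and inf: "\<not> finite_index F (P \<inter> K) P"
  obtains p where "p \<in> P" "\<And>v. v \<in> carrier F \<Longrightarrow> length v \<le> d \<Longrightarrow> p \<cdot> v \<notin> K"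
proof (rule ccontr)
  note result = that
  assume "\<not> thesis"
  then have ex: "\<exists>v. v \<in> carrier F \<and> length v \<le> d \<and> p \<cdot> v \<in> K" if "p \<in> P" for p
    using result that by blast
  have Pc: "g \<in> carrier F" if "g \<in> P" for g using P that subgroup.mem_carrier by metis
  let ?V = "{v \<in> carrier F. length v \<le> d}"
  define f where "f v = (SOME p. p \<in> P \<and> p \<cdot> v \<in> K)" for v
  have f: "f v \<in> P \<and> f v \<cdot> v \<in> K" if "p \<in> P" "p \<cdot> v \<in> K" for p v
    unfolding f_def using that by (intro someI[of "\<lambda>p. p \<in> P \<and> p \<cdot> v \<in> K"]) blast
  let ?T = "{t \<in> f ` ?V. t \<in> P}"
  have "\<exists>t \<in> ?T. x \<cdot> invF t \<in> P \<inter> K" if x: "x \<in> P" for x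
  proof -
    obtain v where v: "v \<in> carrier F" "length v \<le> d" "x \<cdot> v \<in> K" using ex[OF x] by blast
    have fv: "f v \<in> P" "f v \<cdot> v \<in> K" using f[OF x v(3)] by auto
    have "(x \<cdot> v) \<cdot> invF (f v \<cdot> v) \<in> K"
      using v(3) fv subgroup.m_closed[OF K] subgroup.m_inv_closed[OF K] by blast
    moreover have "(x \<cdot> v) \<cdot> invF (f v \<cdot> v) = x \<cdot> invF (f v)"
      using Pc[OF x] Pc[OF fv(1)] v(1) by (simp add: inv_mult_group m_assoc)
    moreover have "x \<cdot> invF (f v) \<in> P"
      using x fv subgroup.m_closed[OF P] subgroup.m_inv_closed[OF P] by blast
    ultimately show ?thesis using v fv by auto
  qed
  moreover have "finite ?T" using F_finite_ball[of d] by simp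
  ultimately have "finite_index F (P \<inter> K) P" unfolding finite_index_def by (intro exI[of _ ?T]) auto
  then show False using inf by blast
qed

text \<open>
  Let \<open>p \<in> P\<close> be far from \<open>K = \<langle>S\<rangle>\<close>, \<open>\<alpha>\<close> its longest prefix in the subtree of \<open>K\<close> and \<open>b\<close> the next letter.
  After conjugation by \<open>\<alpha>\<close>, no element of \<open>K\<close> starts with \<open>b\<close>, whereas \<open>P\<close> contains some \<open>y\<close> of the form
  \<open>b\<dots>b\<inverse>\<close>.  Conjugating \<open>u \<in> P \<inter> K\<close> by \<open>y\<close> gives \<open>r\<close> free from \<open>K\<close>, and conjugating it by \<open>r\<close> gives \<open>z\<close>;
  the powers of \<open>r\<close> lie in distinct cosets of \<open>\<langle>K, z\<rangle>\<close>.
\<close>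

lemma exists_free_element:
  assumes S: "free_set F S" "finite S" and P: "subgroup P F" and ncyc: "\<And>g. P \<noteq> generate F {g}"
    and inf: "\<not> finite_index F (P \<inter> generate F S) P" and u: "u \<in> P" "u \<in> generate F S" "u \<noteq> []"
  obtains z where "z \<in> P" "z \<notin> generate F S" "free_set F (insert z S)"
    "\<not> finite_index F (P \<inter> generate F (insert z S)) P"
proof -
  define K where "K = generate F S"
  have Sc: "S \<subseteq> carrier F" using S free_set_carrier by blast
  have K: "subgroup K F" unfolding K_def using Sc by (rule generate_is_subgroup)
  have Kc: "x \<in> carrier F" if "x \<in> K" for x using K that subgroup.mem_carrier by metis
  have Pc: "x \<in> carrier F" if "x \<in> P" for x using P that subgroup.mem_carrier by metis
  have uc: "u \<in> carrier F" using u Pc by blast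
  obtain c where c: "\<And>v. v \<in> subtree K \<Longrightarrow> \<exists>v' \<in> carrier F. length v' \<le> c \<and> v \<cdot> v' \<in> K"
    using quasiconvex[OF Sc S(2)] unfolding K_def by blast
  \<comment> \<open>The branching vertex \<open>\<alpha>\<close> is within distance \<open>c\<close>
    of \<open>K\<close>, so being farther than \<open>length u + c\<close> forces the remaining part
    \<open>w\<close> of \<open>p\<close> to be longer than \<open>u\<close>, as
    \<open>exists_start\<close> demands.\<close>
  obtain p where p: "p \<in> P" and far: "\<And>v. v \<in> carrier F \<Longrightarrow> length v \<le> length u + c \<Longrightarrow> p \<cdot> v \<notin> K"
    using exists_far[OF P K, of "length u + c"] inf unfolding K_def by blast
  have "take 0 p \<in> subtree K"
    using subgroup.one_closed[OF K] by (auto simp: subtree_def F_one intro: exI[of _ "[]"])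
  then obtain i where i: "i \<le> length p" "take i p \<in> subtree K"
    and max: "\<And>j. j \<le> length p \<Longrightarrow> take j p \<in> subtree K \<Longrightarrow> j \<le> i"
    using ex_has_greatest_nat[of "\<lambda>j. j \<le> length p \<and> take j p \<in> subtree K" 0 "\<lambda>j. j" "Suc (length p)"] by auto
  define \<alpha> w where "\<alpha> = take i p" and "w = drop i p"
  have pw: "p = \<alpha> @ w" by (simp add: \<alpha>_def w_def)
  have pc: "\<alpha> @ w \<in> carrier F" using Pc[OF p] pw by simp
  then have \<alpha>c: "\<alpha> \<in> carrier F" and wc: "w \<in> carrier F" by (simp_all add: F_append)
  have pm: "p = \<alpha> \<cdot> w" using F_mult_append[OF pc] pw by simp
  have long: "length u < length w"
  proof (rule ccontr)
    assume short: "\<not> length u < length w"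
    obtain v where v: "v \<in> carrier F" "length v \<le> c" "\<alpha> \<cdot> v \<in> K" using c[OF i(2)] by (auto simp: \<alpha>_def)
    have "p \<cdot> (invF w \<cdot> v) = \<alpha> \<cdot> v" using pm \<alpha>c wc v by (simp add: m_assoc)
    moreover have "length (invF w \<cdot> v) \<le> length u + c"
      using F_length_mult[OF F_winv[OF wc] v(1)] v(2) short F_inv[OF wc] by simp
    ultimately show False using far[of "invF w \<cdot> v"] v wc by simp
  qed
  then have w0: "w \<noteq> []" by auto
  define b where "b = hd w"
  have out: "\<alpha> @ [b] \<notin> subtree K"
  proof
    assume "\<alpha> @ [b] \<in> subtree K"
    moreover have "i < length p" using w0 by (simp add: w_def)
    then have "\<alpha> @ [b] = take (Suc i) p" by (simp add: \<alpha>_def b_def w_def hd_drop_conv_nth take_Suc_conv_app_nth)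
    ultimately show False using max[of "Suc i"] \<open>i < length p\<close> by simp
  qed
  \<comment> \<open>Conjugation which moves the branching vertex \<open>\<alpha>\<close> to the
    identity; \<open>bk\<close> undoes it.\<close>
  define cj where "cj x = invF \<alpha> \<cdot> x \<cdot> \<alpha>" for x
  define bk where "bk x = \<alpha> \<cdot> x \<cdot> invF \<alpha>" for x
  have cj: "cj = (\<lambda>x. invF \<alpha> \<cdot> x \<cdot> invF (invF \<alpha>))" using \<alpha>c by (simp add: cj_def fun_eq_iff)
  have bk_cj: "bk (cj x) = x" if "x \<in> carrier F" for x
    using that \<alpha>c by (simp add: bk_def cj_def m_assoc)
  have bk_img: "bk ` cj ` A = A" if "A \<subseteq> carrier F" for A
  proof -
    have "bk ` cj ` A = (\<lambda>x. x) ` A"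
      unfolding image_image by (rule image_cong) (use that bk_cj in auto)
    then show ?thesis by simp
  qed
  define S1 K1 P1 where "S1 = cj ` S" and "K1 = cj ` K" and "P1 = cj ` P"
  have S1: "free_set F S1" unfolding S1_def cj using free_set_conj[OF _ S(1), of "invF \<alpha>"] \<alpha>c by simp
  have K1: "K1 = generate F S1"
    unfolding S1_def K1_def K_def cj using generate_conj[OF _ Sc, of "invF \<alpha>"] \<alpha>c by simp
  have P1: "subgroup P1 F" unfolding P1_def cj using subgroup_conj[OF _ P, of "invF \<alpha>"] \<alpha>c by simp
  have avoid: "avoids_start b K1"
    unfolding avoids_start_def
  proof (intro ballI impI notI)
    fix k assume k: "k \<in> K1" "k \<noteq> []" "hd k = b"
    then obtain x where x: "x \<in> K" "k = cj x" by (auto simp: K1_def)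
    have xc: "x \<in> carrier F" using Kc x by blast
    have kc: "k \<in> carrier F" using x xc \<alpha>c by (simp add: cj_def)
    have "\<alpha> @ k \<in> carrier F" using pc kc k w0 by (auto simp: F_append b_def)
    then have "\<alpha> \<cdot> k = \<alpha> @ k" by (rule F_mult_append)
    moreover have "\<alpha> \<cdot> k = x \<cdot> \<alpha>" using x xc \<alpha>c by (simp add: cj_def m_assoc)
    moreover have "x \<cdot> \<alpha> \<in> subtree K" using subtree_translate[OF K x(1)] i(2) by (simp add: \<alpha>_def)
    moreover have "\<alpha> @ k = (\<alpha> @ [b]) @ tl k" using k by (cases k) auto
    ultimately show False using out subtree_prefix by metis
  qed
  have "w \<cdot> u \<cdot> invF w = cj (p \<cdot> u \<cdot> invF p)"
    using pm \<alpha>c wc uc by (simp add: cj_def m_assoc inv_mult_group)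
  moreover have "p \<cdot> u \<cdot> invF p \<in> P"
    using p u subgroup.m_closed[OF P] subgroup.m_inv_closed[OF P] by simp
  ultimately have "w \<cdot> u \<cdot> invF w \<in> P1" by (simp add: P1_def)
  then obtain x where x: "x \<in> P1" "x \<noteq> []" "hd x = b"
    using exists_start[OF wc w0 _ uc u(3) long P1] b_def by blast
  have ncyc1: "P1 \<noteq> generate F {g}" for g
  proof
    assume g: "P1 = generate F {g}"
    then have "g \<in> P1" by (auto intro: generate.incl)
    then have gc: "g \<in> carrier F" using P1 subgroup.mem_carrier by metis
    have "P = bk ` P1" unfolding P1_def using bk_img[of P] Pc by blast
    also have "\<dots> = generate F {bk g}"
      using generate_conj[OF \<alpha>c, of "{g}"] gc g by (simp add: bk_def[abs_def])
    finally show False using ncyc by blast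
  qed
  obtain y where y: "y \<in> P1" "loop_at b y" using exists_loop_at[OF P1 ncyc1 x] .
  define v where "v = cj u"
  have v: "v \<in> K1" "v \<in> P1" using u by (auto simp: v_def K1_def P1_def K_def)
  have bkv: "bk v = u" using bk_cj uc by (simp add: v_def)
  have "v \<noteq> []"
  proof
    assume "v = []"
    then have "bk v = []" using \<alpha>c r_one[OF \<alpha>c] r_inv[OF \<alpha>c] by (simp add: bk_def F_one)
    then show False using bkv u by simp
  qed
  have P1c: "x \<in> carrier F" if "x \<in> P1" for x using P1 that subgroup.mem_carrier by metis
  obtain r where r: "r \<in> P1" "loop_at b r" "r \<notin> K1" "free_set F (insert r S1)"
    using exists_free_generator[OF K1 S1 avoid P1c[OF y(1)] y(2) v(1) \<open>v \<noteq> []\<close> P1 y(1) v(2)] .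
  \<comment> \<open>The element to be adjoined is a conjugate of powers of \<open>v\<close> by
    \<open>r\<close>: the functional on \<open>generate F (insert (bk r) S)\<close> that is 1 on
    \<open>bk r\<close> and 0 on \<open>S\<close> then vanishes on \<open>bk z1\<close>, and the
    powers of \<open>bk r\<close> witness infinite index.\<close>
  obtain z1 where z1: "z1 \<in> P1" "loop_at b z1" "z1 \<notin> K1" "free_set F (insert z1 S1)"
    "z1 \<in> generate F {r \<cdot> v \<cdot> invF r}"
    using exists_free_generator[OF K1 S1 avoid P1c[OF r(1)] r(2) v(1) \<open>v \<noteq> []\<close> P1 r(1) v(2)] .
  have bkP: "bk a \<in> P" if "a \<in> P1" for a using that bk_cj Pc by (auto simp: P1_def)
  have bk_ins: "bk ` insert a S1 = insert (bk a) S" for a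
    using bk_img[OF Sc] by (simp add: S1_def)
  have free: "free_set F (insert (bk a) S)" if "free_set F (insert a S1)" for a
    using free_set_conj[OF \<alpha>c that] bk_ins[of a] by (simp add: bk_def[abs_def])
  have zr: "bk z1 \<in> generate F {bk r \<cdot> u \<cdot> invF (bk r)}"
  proof -
    have rc: "r \<in> carrier F" and vc: "v \<in> carrier F" using P1c r v by auto
    have "bk (r \<cdot> v \<cdot> invF r) = bk r \<cdot> bk v \<cdot> invF (bk r)"
      using \<alpha>c rc vc by (simp add: bk_def m_assoc inv_mult_group)
    moreover have "generate F {bk (r \<cdot> v \<cdot> invF r)} = bk ` generate F {r \<cdot> v \<cdot> invF r}"
      using generate_conj[OF \<alpha>c, of "{r \<cdot> v \<cdot> invF r}"] rc vc by (simp add: bk_def[abs_def])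
    ultimately show ?thesis using z1(5) bkv by auto
  qed
  have notin: "bk a \<notin> K" if "a \<in> P1" "a \<notin> K1" for a
  proof
    assume "bk a \<in> K"
    moreover have "cj (bk a) = a" using P1c[OF that(1)] \<alpha>c by (simp add: cj_def bk_def m_assoc)
    ultimately show False using that(2) unfolding K1_def by (metis imageI)
  qed
  let ?r = "bk r" and ?z = "bk z1"
  let ?W = "generate F (insert ?r S)"
  have Wfree: "free_set F (insert ?r S)" using free r by blast
  have W: "subgroup ?W F" using free_set_carrier[OF Wfree] by (rule generate_is_subgroup)
  have rW: "?r \<in> ?W" by (rule generate.incl) simp
  have SW: "generate F S \<subseteq> ?W" by (rule mono_generate) auto
  have rS: "?r \<notin> S" using notin[OF r(1,3)] by (auto simp: K_def intro: generate.incl)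
  obtain h where h: "additive_on F ?W h" "\<forall>t \<in> insert ?r S. h t = (if t = ?r then 1 else 0)"
    using extends_additivelyD[OF free_set_extends_additively[OF Wfree], of "\<lambda>t. if t = ?r then 1 else 0"] by blast
  have hS: "h x = 0" if "x \<in> generate F S" for x
    by (rule additive_on_vanish[OF h(1) W _ _ that]) (use SW h(2) rS in \<open>auto intro: generate.incl\<close>)
  have uW: "u \<in> ?W" using u SW by blast
  have ruW: "?r \<cdot> u \<cdot> invF ?r \<in> ?W" "?r \<cdot> u \<in> ?W" "invF ?r \<in> ?W"
    using rW uW subgroup.m_closed[OF W] subgroup.m_inv_closed[OF W] by simp_all
  have "h (?r \<cdot> u \<cdot> invF ?r) = 0"
    using additive_onD[OF h(1) ruW(2,3)] additive_onD[OF h(1) rW uW] additive_on_inv[OF h(1) W rW] hS[OF u(2)]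
    by simp
  then have hz: "h ?z = 0"
    using additive_on_vanish[OF h(1) W _ _ zr] ruW by simp
  have zW: "?z \<in> ?W" using zr generate_subgroup_incl[OF _ W, of "{?r \<cdot> u \<cdot> invF ?r}"] ruW by blast
  have zSW: "insert ?z S \<subseteq> ?W" using zW by (auto intro: generate.incl)
  show ?thesis
  proof (rule that[of ?z])
    show "?z \<in> P" using bkP z1 by blast
    show "?z \<notin> generate F S" using notin z1 by (simp add: K_def)
    show "free_set F (insert ?z S)" using free z1 by blast
    show "\<not> finite_index F (P \<inter> generate F (insert ?z S)) P"
    proof (rule finite_index_powers[OF h(1) W, where x="?r"])
      show "generate F (insert ?z S) \<subseteq> ?W" using generate_subgroup_incl[OF zSW W] .
      show "h x = 0" if "x \<in> generate F (insert ?z S)" for x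
        by (rule additive_on_vanish[OF h(1) W zSW _ that]) (use hz hS in \<open>auto intro: generate.incl\<close>)
      show "h ?r \<noteq> 0" using h(2) by simp
      show "subgroup (generate F (insert ?z S)) F"
        using Sc Pc bkP z1 by (intro generate_is_subgroup) blast
    qed (use bkP r rW P in auto)
  qed
qed

lemma exists_free_extension:
  assumes S: "free_set F S" "finite S" and P: "subgroup P F" and ncyc: "\<And>g. P \<noteq> generate F {g}"
    and inf: "\<not> finite_index F (P \<inter> generate F S) P" and u: "u \<in> P" "u \<in> generate F S" "u \<noteq> []"
  shows "\<exists>Z. Z \<subseteq> P \<and> finite Z \<and> card Z = k \<and> S \<inter> Z = {} \<and> free_set F (S \<union> Z) \<and>
    \<not> finite_index F (P \<inter> generate F (S \<union> Z)) P"
proof (induction k)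
  case 0
  then show ?case using S inf by (intro exI[of _ "{}"]) auto
next
  case (Suc k)
  then obtain Z where Z: "Z \<subseteq> P" "finite Z" "card Z = k" "S \<inter> Z = {}" "free_set F (S \<union> Z)"
    "\<not> finite_index F (P \<inter> generate F (S \<union> Z)) P" by blast
  have "u \<in> generate F (S \<union> Z)" using u mono_generate[of S "S \<union> Z"] by blast
  then obtain z where z: "z \<in> P" "z \<notin> generate F (S \<union> Z)" "free_set F (insert z (S \<union> Z))"
    "\<not> finite_index F (P \<inter> generate F (insert z (S \<union> Z))) P"
    using exists_free_element[OF Z(5) _ P ncyc Z(6) u(1) _ u(3)] S(2) Z(2) by auto
  have "z \<notin> S \<union> Z" using z(2) generate.incl by metis
  then show ?case using Z z S by (intro exI[of _ "insert z Z"]) auto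
qed

section \<open>Derived subgroup, cyclic subgroups and center of the free group\<close>

lemma F_free_basis:
  assumes "subgroup U F" "fg F U"
  obtains R where "free_set F R" "finite R" "generate F R = U" "card R = rank_of F U"
  using free_basis[OF free_set_letters assms(1) _ assms(2)] generate_letters subgroup.subset[OF assms(1)]
  by metis

text \<open>Modulo the derived subgroup, an element is the product of the letters raised to its
  exponent sums \<open>\<epsilon> i\<close>. If all additive maps vanish at \<open>w\<close>, then
  so do these sums, and \<open>w\<close> is trivial in the quotient.\<close>

lemma exists_additive_notin_derived:
  assumes w: "w \<in> carrier F" "w \<notin> derived F (carrier F)"
  shows "\<exists>\<phi>. additive_on F (carrier F) \<phi> \<and> \<phi> w \<noteq> 0"
proof (rule ccontr)
  assume "\<not> ?thesis"
  then have zero: "\<phi> w = 0" if "additive_on F (carrier F) \<phi>" for \<phi> using that by blast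
  define D where "D = derived F (carrier F)"
  interpret D: normal D F unfolding D_def by (rule derived_self_is_normal)
  interpret Q: comm_group "F Mod D" unfolding D_def by (rule derived_quot_is_comm_group)
  let ?h = "\<lambda>w. D #>\<^bsub>F\<^esub> w"
  interpret h: group_hom F "F Mod D" ?h
    using D.r_coset_hom_Mod by unfold_locales auto
  define x where "x i = [(i, True)]" for i :: nat
  have xl: "x i \<in> letters" if "i < n" for i using that by (simp add: x_def letters_def)
  have xc: "x i \<in> carrier F" if "i < n" for i using xl[OF that] letters_carrier by blast
  have "\<exists>\<epsilon>. additive_on F (carrier F) \<epsilon> \<and> (\<forall>s \<in> letters. \<epsilon> s = (if s = x i then 1 else 0))" for i
    using extends_additivelyD[OF free_set_extends_additively[OF free_set_letters], of "\<lambda>s. if s = x i then 1 else 0"]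
    unfolding generate_letters .
  then obtain \<epsilon> where \<epsilon>: "\<And>i. additive_on F (carrier F) (\<epsilon> i)"
    "\<And>i s. s \<in> letters \<Longrightarrow> \<epsilon> i s = (if s = x i then 1 else 0)" by metis
  have \<epsilon>x: "\<epsilon> i (x j) = (if j = i then 1 else 0)" if "j < n" for i j
    using \<epsilon>(2)[OF xl[OF that], of i] by (simp add: x_def)
  define prd where "prd e = finprod (F Mod D) (\<lambda>i. ?h (x i) [^]\<^bsub>F Mod D\<^esub> (e i :: int)) {..<n}" for e
  have hxc: "?h (x i) \<in> carrier (F Mod D)" if "i < n" for i using xc[OF that] h.hom_closed by blast
  have prd_add: "prd (\<lambda>i. e i + e' i) = prd e \<otimes>\<^bsub>F Mod D\<^esub> prd e'" for e e'
  proof -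
    have "prd (\<lambda>i. e i + e' i) = finprod (F Mod D) (\<lambda>i. ?h (x i) [^]\<^bsub>F Mod D\<^esub> e i \<otimes>\<^bsub>F Mod D\<^esub> ?h (x i) [^]\<^bsub>F Mod D\<^esub> e' i) {..<n}"
      unfolding prd_def using hxc by (intro Q.finprod_cong') (auto simp: Q.int_pow_mult simp del: mult_FactGroup)
    also have "\<dots> = prd e \<otimes>\<^bsub>F Mod D\<^esub> prd e'"
      unfolding prd_def using hxc by (intro Q.finprod_multf) auto
    finally show ?thesis .
  qed
  have prd_0: "prd (\<lambda>i. 0) = \<one>\<^bsub>F Mod D\<^esub>" unfolding prd_def by (rule Q.finprod_one_eqI) simp
  have prd_x: "prd (\<lambda>i. \<epsilon> i (x j)) = ?h (x j)" if "j < n" for j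
  proof -
    have "prd (\<lambda>i. \<epsilon> i (x j)) = finprod (F Mod D) (\<lambda>i. if j = i then ?h (x i) else \<one>\<^bsub>F Mod D\<^esub>) {..<n}"
      unfolding prd_def using hxc \<epsilon>x[OF that] Q.one_closed by (intro Q.finprod_cong') auto
    also have "\<dots> = ?h (x j)"
      using that hxc Q.one_closed by (intro Q.finprod_singleton) auto
    finally show ?thesis .
  qed
  have prdc: "prd e \<in> carrier (F Mod D)" for e unfolding prd_def using hxc by (intro Q.finprod_closed) auto
  have main: "?h v = prd (\<lambda>i. \<epsilon> i v)" if "v \<in> generate F (letters)" for v
    using letters_carrier that
  proof (induction rule: generate_right_induct)
    case one
    then show ?case using additive_on_one[OF \<epsilon>(1)] prd_0 h.hom_one by simp
  next
    case (mult y s)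
    then obtain j where j: "j < n" "s = x j" by (auto simp: letters_def x_def)
    have yc: "y \<in> carrier F" using mult(1) generate_letters by blast
    have "(\<lambda>i. \<epsilon> i (y \<cdot> s)) = (\<lambda>i. \<epsilon> i y + \<epsilon> i (x j))"
      using additive_onD[OF \<epsilon>(1) yc xc[OF j(1)]] j(2) by simp
    then have "prd (\<lambda>i. \<epsilon> i (y \<cdot> s)) = ?h y \<otimes>\<^bsub>F Mod D\<^esub> ?h (x j)"
      using prd_add prd_x[OF j(1)] mult(3) by simp
    then show ?case using h.hom_mult[OF yc xc[OF j(1)]] j(2) by simp
  next
    case (mult_inv y s)
    then obtain j where j: "j < n" "s = x j" by (auto simp: letters_def x_def)
    let ?z = "y \<cdot> invF s"
    have yc: "y \<in> carrier F" using mult_inv(1) generate_letters by blast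
    have zc: "?z \<in> carrier F" using yc xc j by simp
    have zs: "?z \<cdot> x j = y" using yc xc[OF j(1)] j(2) by (simp add: m_assoc)
    have "(\<lambda>i. \<epsilon> i y) = (\<lambda>i. \<epsilon> i ?z + \<epsilon> i (x j))"
      using additive_onD[OF \<epsilon>(1) zc xc[OF j(1)]] zs by simp
    then have "?h y = prd (\<lambda>i. \<epsilon> i ?z) \<otimes>\<^bsub>F Mod D\<^esub> ?h (x j)"
      using prd_add prd_x[OF j(1)] mult_inv(3) by simp
    moreover have "?h y = ?h ?z \<otimes>\<^bsub>F Mod D\<^esub> ?h (x j)"
      using h.hom_mult[OF zc xc[OF j(1)]] zs by simp
    ultimately have "?h ?z \<otimes>\<^bsub>F Mod D\<^esub> ?h (x j) = prd (\<lambda>i. \<epsilon> i ?z) \<otimes>\<^bsub>F Mod D\<^esub> ?h (x j)" by simp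
    then show ?case by (rule Q.r_cancel[OF _ h.hom_closed[OF zc] prdc hxc[OF j(1)]])
  qed
  have "?h w = \<one>\<^bsub>F Mod D\<^esub>"
    using main[of w] w(1) generate_letters zero[OF \<epsilon>(1)] prd_0 by simp
  then have "D #>\<^bsub>F\<^esub> w = D" by simp
  then have "w \<in> D" using rcos_self[OF w(1) D.is_subgroup] by simp
  then show False using w(2) by (simp add: D_def)
qed

lemma noncyclic_free_basis:
  assumes P: "subgroup P F" "fg F P" and ncyc: "\<And>g. P \<noteq> generate F {g}"
  shows "rank_of F P \<ge> 2"
proof (rule ccontr)
  assume "\<not> ?thesis"
  then have le: "rank_of F P \<le> 1" by simp
  obtain B where B: "B \<subseteq> P" "finite B" "card B = rank_of F P" "generate F B = P"
    using rank_of_generators[OF P] .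
  show False
  proof (cases "B = {}")
    case True
    then show False using ncyc[of "\<one>\<^bsub>F\<^esub>"] B(4) generate_empty generate_one by simp
  next
    case False
    then have "card B \<noteq> 0" using B(2) by simp
    then have "card B = 1" using B(3) le by linarith
    then show False using ncyc B(4) by (auto simp: card_1_singleton_iff)
  qed
qed

text \<open>A cyclic subgroup of finite index \<open>j\<close> would have reduced rank
  \<open>j * (rank P - 1)\<close>, which is positive because a noncyclic \<open>P\<close> has rank
  at least 2. This turns the noncyclicity assumed in the theorem into admissibility.\<close>

lemma not_virtually_cyclic:
  assumes P: "subgroup P F" "fg F P" and ncyc: "\<And>g. P \<noteq> generate F {g}" and g: "g \<in> P"
  shows "\<not> finite_index F (generate F {g}) P"
proof
  let ?C = "generate F {g}"
  assume "finite_index F ?C P"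
  then obtain T where T: "finite T" "T \<subseteq> P" "\<And>x. x \<in> P \<Longrightarrow> \<exists>t \<in> T. x \<cdot> invF t \<in> ?C"
    unfolding finite_index_def by blast
  have gc: "g \<in> carrier F" using P g subgroup.mem_carrier by metis
  have C: "subgroup ?C F" using gc by (intro generate_is_subgroup) simp
  have CP: "?C \<subseteq> P" using generate_subgroup_incl[OF _ P(1)] g by simp
  have Pc: "x \<in> carrier F" if "x \<in> P" for x using P(1) that subgroup.mem_carrier by metis
  obtain f where f: "\<And>x. x \<in> P \<Longrightarrow> f x \<in> T \<and> x \<cdot> invF (f x) \<in> ?C" using T(3) by metis
  have same: "x \<cdot> invF y \<in> ?C" if xy: "x \<in> P" "y \<in> P" "f x = f y" for x y
  proof -
    have "(x \<cdot> invF (f x)) \<cdot> invF (y \<cdot> invF (f x)) \<in> ?C"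
      using f[OF xy(1)] f[OF xy(2)] xy(3) subgroup.m_closed[OF C] subgroup.m_inv_closed[OF C] by simp
    moreover have "f x \<in> carrier F" using f[OF xy(1)] T(2) Pc by blast
    then have "(x \<cdot> invF (f x)) \<cdot> invF (y \<cdot> invF (f x)) = x \<cdot> invF y"
      using Pc xy by (simp add: inv_mult_group m_assoc)
    ultimately show ?thesis by simp
  qed
  obtain T' where T': "transversal F ?C P T'" "finite T'"
  proof (rule transversal_card_le[OF C subgroup.subset[OF P(1)] T(1), of f])
    show "f ` P \<subseteq> T" using f by blast
    show "x \<cdot> invF y \<in> ?C" if "x \<in> P" "y \<in> P" "f x = f y" for x y using same that by simp
  qed (rule that)
  have PL: "P \<subseteq> generate F (letters)" using generate_letters subgroup.subset[OF P(1)] by simp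
  have eq: "rank_of F ?C + card T' = card T' * rank_of F P + 1"
    using finite_index_subgroup(2)[OF free_set_letters P(1) PL P(2) C CP T'] .
  have "rank_of F ?C \<le> 1" using rank_of_le[of "{g}" ?C] gc by simp
  moreover have "card T' * 2 \<le> card T' * rank_of F P" using noncyclic_free_basis[OF P ncyc] by simp
  moreover have "card T' > 0"
    using T' g by (auto simp: card_gt_0_iff transversal_def)
  ultimately show False using eq by linarith
qed

text \<open>Noncyclic \<open>P\<close> forces \<open>n \<ge> 2\<close>, as otherwise the free group
  is commutative. A nonempty \<open>z\<close> then cannot commute with a letter other than its first
  one, since the two products start differently.\<close>

lemma noncyclic_center:
  assumes P: "subgroup P F" "fg F P" and ncyc: "\<And>g. P \<noteq> generate F {g}"
  shows "center F = {\<one>\<^bsub>F\<^esub>}"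
proof -
  have n2: "n \<ge> 2"
  proof (rule ccontr)
    assume "\<not> ?thesis"
    then have "n \<le> 1" by simp
    then have le: "card (letters) \<le> 1" using card_image_le[of "{..<n}" "\<lambda>i. [(i, True)]"] by (simp add: letters_def)
    obtain R where R: "free_set F R" "finite R" "generate F R = P" "card R = rank_of F P"
      using F_free_basis[OF P] .
    have "finite (letters)" by (simp add: letters_def)
    have "\<not> card R \<le> Suc 0" using noncyclic_free_basis[OF P ncyc] R(4) by simp
    then obtain r s where rs: "r \<in> R" "s \<in> R" "r \<noteq> s"
      using card_le_Suc0_iff_eq[OF R(2)] by blast
    have "\<exists>x \<in> carrier F. letters \<subseteq> {x}"
    proof (cases "letters = {}")
      case False
      then obtain x where "x \<in> letters" by blast
      moreover from this have "letters \<subseteq> {x}"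
        using card_le_Suc0_iff_eq[OF \<open>finite (letters)\<close>] le by auto
      ultimately show ?thesis using letters_carrier by blast
    qed (use one_closed in blast)
    then obtain x where x: "x \<in> carrier F" "letters \<subseteq> {x}" by blast
    have "carrier F \<subseteq> generate F {x}" using mono_generate[OF x(2)] generate_letters by blast
    moreover have "R \<subseteq> carrier F" using free_set_carrier[OF R(1)] .
    ultimately have "r \<in> generate F {x}" "s \<in> generate F {x}" using rs by blast+
    then obtain i j :: int where "r = x [^]\<^bsub>F\<^esub> i" "s = x [^]\<^bsub>F\<^esub> j"
      unfolding generate_pow[OF x(1)] by auto
    then have "r \<cdot> s = s \<cdot> r" using x(1) by (simp add: int_pow_mult[symmetric] add.commute)
    then show False using free_set_not_commute[OF R(1) rs] by simp
  qed
  have "z = []" if z: "z \<in> center F" for z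
  proof (rule ccontr)
    assume "z \<noteq> []"
    have zc: "z \<in> carrier F" and comm: "\<And>x. x \<in> carrier F \<Longrightarrow> z \<cdot> x = x \<cdot> z" using z by (auto simp: center_def)
    define j :: nat where "j = (if fst (hd z) = 0 then 1 else 0)"
    have j: "j < n" "fst (hd z) \<noteq> j" using n2 by (auto simp: j_def)
    let ?x = "[(j, True)]"
    have xc: "?x \<in> carrier F" using j letters_carrier by (auto simp: letters_def)
    have "?x @ z \<in> carrier F" using xc zc j unfolding F_append by (auto simp: letter_inv_def)
    then have xz: "z \<cdot> ?x = ?x @ z" using F_mult_append comm[OF xc] by metis
    obtain p c q where e: "z = p @ c" "?x = winv c @ q" "z \<cdot> ?x = p @ q" using F_cancel[OF zc xc] by metis
    show False
    proof (cases "p = []")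
      case False
      then have "hd (z \<cdot> ?x) = hd z" using e by simp
      then have "hd z = (j, True)" using xz by simp
      then show False using j(2) by (metis fst_conv)
    next
      case True
      have "length ?x = length (winv c @ q)" using e(2) by (rule arg_cong)
      then have "length q \<le> 1" by simp
      then have "length (z \<cdot> ?x) \<le> 1" using True e(3) by simp
      then show False using xz \<open>z \<noteq> []\<close> by simp
    qed
  qed
  then have "center F \<subseteq> {\<one>\<^bsub>F\<^esub>}" by (auto simp: F_one)
  moreover have "\<one>\<^bsub>F\<^esub> \<in> center F" by (simp add: center_def)
  ultimately show ?thesis by blast
qed

end

section \<open>Limits of ratios\<close>

lemma ennreal_ratio_le_iff:
  assumes "y > 0" "q \<ge> 0"
  shows "(of_nat x :: ennreal) / of_nat y \<le> ennreal q \<longleftrightarrow> real x \<le> q * real y"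
  using assms by (simp add: ennreal_of_nat_eq_real_of_nat divide_ennreal pos_divide_le_eq)

lemma ratio_le_rank_ratio:
  assumes "c \<le> x" "y \<le> d" "c > 0"
  shows "(of_nat c :: ennreal) / of_nat d \<le> rank_ratio x y"
proof (cases "y = 0")
  case True
  then show ?thesis using assms by (simp add: rank_ratio_def ennreal_divide_zero)
next
  case False
  have "real c / real d \<le> real x / real y"
    using assms False by (intro frac_le) auto
  then show ?thesis using assms False
    by (simp add: rank_ratio_def ennreal_of_nat_eq_real_of_nat divide_ennreal)
qed

lemma linear_growth_bound:
  fixes u v :: real
  assumes "\<And>k :: nat. (1 + real e * real k) * u \<le> v" "e \<ge> 1"
  shows "u \<le> 0"
proof (rule ccontr)
  assume "\<not> u \<le> 0"
  then have u: "u > 0" by simp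
  obtain k :: nat where k: "v / u < real k" using reals_Archimedean2 by blast
  have "v < real k * u" using k u by (simp add: pos_divide_less_eq)
  also have "\<dots> \<le> (1 + real e * real k) * u"
  proof (rule mult_right_mono)
    have "1 * real k \<le> real e * real k" using assms(2) by (intro mult_right_mono) auto
    then show "real k \<le> 1 + real e * real k" by linarith
  qed (use u in simp)
  finally show False using assms(1)[of k] by linarith
qed

text \<open>As \<open>k\<close> grows, the inequality forces its leading coefficient
  \<open>l a - q b\<close> to be at most 0. For \<open>b = 0\<close> this leaves the case where
  \<open>a = 0\<close> and the ratio is 1 by convention; there \<open>k = 0\<close> gives
  \<open>l r \<le> q r\<close>, and \<open>r \<ge> 1\<close> is decisive.\<close>

lemma rank_ratio_limit:
  assumes le: "\<And>k. of_nat (l * ((1 + e * k) * a + r)) / of_nat ((1 + e * k) * b + r) \<le> (D :: ennreal)"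
    and e: "e \<ge> 1" and r: "r \<ge> 1"
  shows "of_nat l * rank_ratio a b \<le> D"
proof (cases D)
  case (real q)
  have q: "q \<ge> 0" using real by simp
  have ineq: "real l * ((1 + real e * real k) * real a + real r) \<le> q * ((1 + real e * real k) * real b + real r)" for k
  proof -
    have "of_nat (l * ((1 + e * k) * a + r)) / of_nat ((1 + e * k) * b + r) \<le> ennreal q"
      using le[of k] real by simp
    moreover have "(1 + e * k) * b + r > 0" using r by simp
    ultimately have "real (l * ((1 + e * k) * a + r)) \<le> q * real ((1 + e * k) * b + r)"
      by (simp only: ennreal_ratio_le_iff q)
    then show ?thesis by (simp add: distrib_right)
  qed
  have "(1 + real e * real k) * (real l * real a - q * real b) \<le> (q - real l) * real r" for k
    using ineq[of k] by (simp add: algebra_simps)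
  then have main: "real l * real a \<le> q * real b" using linear_growth_bound[OF _ e] by force
  show ?thesis
  proof (cases "b = 0")
    case False
    then have "of_nat (l * a) / of_nat b \<le> ennreal q"
      using ennreal_ratio_le_iff[of b q "l * a"] main real by simp
    then show ?thesis using False real by (simp add: rank_ratio_def ennreal_times_divide)
  next
    case True
    then have "l = 0 \<or> a = 0" using main by (auto simp: mult_le_0_iff)
    then show ?thesis
    proof
      assume "a = 0"
      then have "real l * real r \<le> q * real r" using ineq[of 0] True by simp
      then have "real l \<le> q" using r by simp
      then show ?thesis using \<open>a = 0\<close> True real by (simp add: rank_ratio_def ennreal_of_nat_eq_real_of_nat ennreal_leI)
    qed simp
  qed
qed simp

lemma unbounded_ratio:
  assumes le: "\<And>k. of_nat (1 + e * k) / of_nat r \<le> (D :: ennreal)" and e: "e \<ge> 1" and r: "r \<ge> 1"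
  shows "D = \<infinity>"
proof (cases D)
  case (real q)
  have "(1 + real e * real k) * 1 \<le> q * real r" for k
    using le[of k] ennreal_ratio_le_iff[of r q "1 + e * k"] r real by simp
  then show ?thesis using linear_growth_bound[of e 1 "q * real r", OF _ e] by simp
qed simp

text \<open>\<open>k\<close> will be the rank of the vertical part. Being added to numerator and
  denominator, it moves the fraction towards 1, and \<open>l D \<ge> 1\<close>. A vanishing
  \<open>b\<close> forces \<open>a = 0\<close> when \<open>D\<close> is finite, because
  \<open>rank_ratio a 0\<close> is infinite otherwise.\<close>

lemma rank_ratio_upper:
  fixes D :: ennreal
  assumes D: "1 \<le> D" "rank_ratio a b \<le> D" and l: "l \<ge> 1" and x: "x \<le> k + l * a" and y: "k + b \<le> y"
  shows "rank_ratio x y \<le> of_nat l * D"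
proof (cases D)
  case (real q)
  have q: "q \<ge> 1" using D(1) real by simp
  have aq: "real a \<le> q * real b"
  proof (cases "b = 0")
    case True
    have "a = 0"
    proof (rule ccontr)
      assume "a \<noteq> 0"
      then have "rank_ratio a b = \<infinity>" using True by (simp add: rank_ratio_def ennreal_divide_zero)
      then show False using D(2) real by (simp add: top_unique)
    qed
    then show ?thesis using q by simp
  next
    case False
    then show ?thesis using D(2) real ennreal_ratio_le_iff[of b q a] by (simp add: rank_ratio_def)
  qed
  have lD: "of_nat l * D = ennreal (real l * q)"
    using real by (simp add: ennreal_mult ennreal_of_nat_eq_real_of_nat)
  have lq: "real l * q \<ge> 1" using mult_mono[of 1 "real l" 1 q] l q by simp
  have "real x \<le> real k + real l * real a" using x by (metis of_nat_add of_nat_le_iff of_nat_mult)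
  also have "\<dots> \<le> (real l * q) * real k + real l * (q * real b)"
    using mult_right_mono[OF lq, of "real k"] mult_left_mono[OF aq, of "real l"] by simp
  also have "\<dots> = (real l * q) * real (k + b)" by (simp add: algebra_simps)
  also have "\<dots> \<le> (real l * q) * real y" using y lq by (intro mult_left_mono) auto
  finally have xy: "real x \<le> (real l * q) * real y" .
  show ?thesis
  proof (cases "y = 0")
    case True
    then have "x = 0" using xy by simp
    then show ?thesis using True lD lq by (simp add: rank_ratio_def)
  next
    case False
    then show ?thesis
      using xy lD lq ennreal_ratio_le_iff[of y "real l * q" x] by (simp add: rank_ratio_def)
  qed
next
  case top
  then show ?thesis using l by (simp add: ennreal_mult_top)
qed

section \<open>Subgroups of \<open>\<int>\<^sup>m \<times> F\<^sub>n\<close>\<close>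

context
  fixes m n :: nat
begin

abbreviation (input) "Zm \<equiv> Z_power m"
abbreviation (input) "Fn \<equiv> free_group n"
abbreviation (input) "ZF \<equiv> Z_power m \<times>\<times> free_group n"
abbreviation (input) addZ (infixl "\<boxplus>" 65) where "x \<boxplus> y \<equiv> x \<otimes>\<^bsub>Z_power m\<^esub> y"
abbreviation (input) negZ where "negZ x \<equiv> inv\<^bsub>Z_power m\<^esub> x"
abbreviation (input) mulFn (infixl "\<cdot>" 70) where "u \<cdot> v \<equiv> u \<otimes>\<^bsub>free_group n\<^esub> v"
abbreviation (input) invFn where "invFn u \<equiv> inv\<^bsub>free_group n\<^esub> u"

lemma comm_group_Z_power: "comm_group (Z_power k)"
  by (rule group.group_comm_groupI[OF group_Z_power]) (simp add: Z_power_def add.commute)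

interpretation Z: comm_group Zm by (rule comm_group_Z_power)
interpretation F: group Fn by simp
interpretation G: group ZF by (rule DirProd_group) simp_all

section \<open>Bases and ranks in the free abelian factor\<close>

lemma Z_additive: "i < m \<Longrightarrow> additive_on Zm (carrier Zm) (\<lambda>x. x i)"
  by (auto simp: additive_on_def Z_power_def)

lemma Z_eqI: "x \<in> carrier Zm \<Longrightarrow> y \<in> carrier Zm \<Longrightarrow> (\<And>i. i < m \<Longrightarrow> x i = y i) \<Longrightarrow> x = y"
  by (auto simp: Z_power_def intro: PiE_ext)

lemma Z_mult_apply: "i < m \<Longrightarrow> (x \<boxplus> y) i = x i + y i"
  by (simp add: Z_power_def)

lemma Z_basis:
  assumes U: "subgroup U Zm"
  obtains T g where "T \<subseteq> U" "finite T" "card T = rank_of Zm U" "card T \<le> m" "generate Zm T = U"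
    "extends_additively Zm T U" "\<And>i. i < card T \<Longrightarrow> additive_on Zm U (g i)"
    "\<And>x. x \<in> U \<Longrightarrow> (\<And>i. i < card T \<Longrightarrow> g i x = 0) \<Longrightarrow> x = \<one>\<^bsub>Zm\<^esub>"
proof -
  have Uc: "U \<subseteq> carrier Zm" using U by (rule subgroup.subset)
  have "\<exists>T g. T \<subseteq> U \<and> finite T \<and> card T \<le> m \<and> generate Zm T = U \<and> extends_additively Zm T U \<and>
    (\<forall>i < card T. additive_on Zm U (g i)) \<and> (\<forall>x \<in> U. (\<forall>i < card T. g i x = 0) \<longrightarrow> x = \<one>\<^bsub>Zm\<^esub>)"
  proof (rule Z.abelian_basis[OF U, of m "\<lambda>i x. x i"])
    show "additive_on Zm U (\<lambda>x. x i)" if "i < m" for i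
      using additive_on_subset[OF Z_additive[OF that] Uc] .
    show "x = \<one>\<^bsub>Zm\<^esub>" if "x \<in> U" "\<forall>i < m. x i = 0" for x
      using that Uc by (intro Z_eqI) (auto simp: Z_power_def)
  qed
  then obtain T g where T: "T \<subseteq> U" "finite T" "card T \<le> m" "generate Zm T = U" "extends_additively Zm T U"
    "\<forall>i < card T. additive_on Zm U (g i)" "\<forall>x \<in> U. (\<forall>i < card T. g i x = 0) \<longrightarrow> x = \<one>\<^bsub>Zm\<^esub>" by blast
  have Tc: "T \<subseteq> carrier Zm" using T Uc by blast
  have "card T = rank_of Zm U"
    using Z.rank_of_le[OF Tc T(2,4)] Z.rank_of_ge[OF U Z.fgI[OF Tc T(2,4)] T(1,2,5)] by simp
  then show ?thesis using that T by blast
qed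

lemma Z_fg: "subgroup U Zm \<Longrightarrow> fg Zm U"
  using Z_basis[of U] Z.fg_iff by metis

lemma Z_rank_le: "subgroup U Zm \<Longrightarrow> rank_of Zm U \<le> m"
  using Z_basis[of U] by metis

text \<open>The \<open>card T\<close> functionals that come with a basis of \<open>U\<close> still
  separate the elements of \<open>V\<close> from the identity.\<close>

lemma Z_rank_mono:
  assumes U: "subgroup U Zm" and V: "subgroup V Zm" "V \<subseteq> U"
  shows "rank_of Zm V \<le> rank_of Zm U"
proof (rule Z_basis[OF U])
  fix T and g :: "nat \<Rightarrow> (nat \<Rightarrow> int) \<Rightarrow> int"
  assume T: "T \<subseteq> U" "card T = rank_of Zm U" "\<And>i. i < card T \<Longrightarrow> additive_on Zm U (g i)"
    "\<And>x. x \<in> U \<Longrightarrow> (\<And>i. i < card T \<Longrightarrow> g i x = 0) \<Longrightarrow> x = \<one>\<^bsub>Zm\<^esub>"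
  have "\<exists>T' g'. T' \<subseteq> V \<and> finite T' \<and> card T' \<le> card T \<and> generate Zm T' = V \<and> extends_additively Zm T' V \<and>
    (\<forall>i < card T'. additive_on Zm V (g' i)) \<and> (\<forall>x \<in> V. (\<forall>i < card T'. g' i x = 0) \<longrightarrow> x = \<one>\<^bsub>Zm\<^esub>)"
    by (rule Z.abelian_basis[OF V(1), of "card T" g]) (use T V additive_on_subset in blast)+
  then obtain T' where T': "T' \<subseteq> V" "finite T'" "card T' \<le> card T" "generate Zm T' = V" by blast
  then have "rank_of Zm V \<le> card T'" using subgroup.subset[OF V(1)] by (intro Z.rank_of_le) auto
  then show ?thesis using T' T(2) by simp
qed

lemma hom_to_Z:
  assumes S: "free_set Fn S" and a: "a ` S \<subseteq> carrier Zm"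
  obtains A where "\<And>w. w \<in> generate Fn S \<Longrightarrow> A w \<in> carrier Zm"
    "\<And>v w. v \<in> generate Fn S \<Longrightarrow> w \<in> generate Fn S \<Longrightarrow> A (v \<cdot> w) = A v \<boxplus> A w"
    "\<And>w. w \<in> generate Fn S \<Longrightarrow> A (invFn w) = negZ (A w)" "A \<one>\<^bsub>Fn\<^esub> = \<one>\<^bsub>Zm\<^esub>"
    "\<And>s. s \<in> S \<Longrightarrow> A s = a s"
proof -
  let ?V = "generate Fn S"
  have Sc: "S \<subseteq> carrier Fn" using S by (rule free_set_carrier)
  have V: "subgroup ?V Fn" using Sc by (rule F.generate_is_subgroup)
  have "\<exists>h. additive_on Fn ?V h \<and> (\<forall>s \<in> S. h s = a s i)" for i
    using extends_additivelyD[OF F.free_set_extends_additively[OF S], of "\<lambda>s. a s i"] .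
  then obtain h where h: "\<And>i. additive_on Fn ?V (h i)" "\<And>i s. s \<in> S \<Longrightarrow> h i s = a s i" by metis
  define A where "A w = (\<lambda>i\<in>{..<m}. h i w)" for w
  have Ac: "A w \<in> carrier Zm" for w by (auto simp: A_def Z_power_def)
  show ?thesis
  proof (rule that[of A])
    show "A (v \<cdot> w) = A v \<boxplus> A w" if "v \<in> ?V" "w \<in> ?V" for v w
    proof (rule Z_eqI)
      fix i assume "i < m"
      then show "A (v \<cdot> w) i = (A v \<boxplus> A w) i"
        using additive_onD[OF h(1) that] by (simp add: Z_mult_apply) (simp add: A_def)
    qed (use Ac in auto)
    show "A (invFn w) = negZ (A w)" if "w \<in> ?V" for w
    proof (rule Z_eqI)
      fix i assume "i < m"
      moreover have "negZ (A w) i = - A w i"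
        using Z_mult_apply[OF \<open>i < m\<close>, of "negZ (A w)" "A w"] Ac \<open>i < m\<close> by (simp add: Z_power_def)
      ultimately show "A (invFn w) i = negZ (A w) i"
        using F.additive_on_inv[OF h(1) V that] by (simp add: A_def)
    qed (use Ac in auto)
    show "A \<one>\<^bsub>Fn\<^esub> = \<one>\<^bsub>Zm\<^esub>"
    proof (rule Z_eqI)
      fix i assume "i < m"
      then show "A \<one>\<^bsub>Fn\<^esub> i = \<one>\<^bsub>Zm\<^esub> i"
        using F.additive_on_one[OF h(1) generate.one] by (simp add: A_def Z_power_def)
    qed (use Ac in auto)
    show "A s = a s" if "s \<in> S" for s
    proof (rule Z_eqI)
      fix i assume "i < m"
      then show "A s i = a s i" using h(2)[OF that] by (simp add: A_def)
    qed (use Ac a that in auto)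
  qed (rule Ac)
qed

section \<open>Vertical part, section and rank of a subgroup of the product\<close>

text \<open>The subgroup \<open>L\<^sub>K = K \<inter> \<int>\<^sup>m\<close>, regarded as a subset of \<open>\<int>\<^sup>m\<close>.\<close>

definition vertical :: "((nat \<Rightarrow> int) \<times> letter list) set \<Rightarrow> (nat \<Rightarrow> int) set" where
  "vertical K = {x. (x, \<one>\<^bsub>Fn\<^esub>) \<in> K}"

lemma snd_hom: "group_hom ZF Fn snd"
  by (auto intro!: group_hom.intro group_hom_axioms.intro homI simp: DirProd_def G.is_group[simplified DirProd_def])

lemma subgroup_snd: "subgroup K ZF \<Longrightarrow> subgroup (snd ` K) Fn"
  using group_hom.subgroup_img_is_subgroup[OF snd_hom] .

lemma mem_ZF:
  assumes "subgroup K ZF" "(x, w) \<in> K"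
  shows "x \<in> carrier Zm" "w \<in> carrier Fn"
  using subgroup.mem_carrier[OF assms] by auto

lemma mult_mem:
  assumes "subgroup K ZF" "(x, w) \<in> K" "(y, v) \<in> K"
  shows "(x \<boxplus> y, w \<cdot> v) \<in> K"
  using subgroup.m_closed[OF assms] by simp

lemma inv_mem:
  assumes "subgroup K ZF" "(x, w) \<in> K"
  shows "(negZ x, invFn w) \<in> K"
  using subgroup.m_inv_closed[OF assms] mem_ZF[OF assms] by simp

lemma one_mem: "subgroup K ZF \<Longrightarrow> (\<one>\<^bsub>Zm\<^esub>, \<one>\<^bsub>Fn\<^esub>) \<in> K"
  using subgroup.one_closed[of K ZF] by simp

lemma vertical_diff:
  assumes K: "subgroup K ZF" and "(x, w) \<in> K" "(y, w) \<in> K"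
  shows "x \<boxplus> negZ y \<in> vertical K"
  using mult_mem[OF K assms(2) inv_mem[OF K assms(3)]] mem_ZF[OF K assms(2)] by (simp add: vertical_def)

lemma vertical_translate:
  assumes K: "subgroup K ZF" and d: "d \<in> vertical K" and x: "(x, w) \<in> K"
  shows "(d \<boxplus> x, w) \<in> K"
  using mult_mem[OF K _ x, of d "\<one>\<^bsub>Fn\<^esub>"] d mem_ZF[OF K x] by (simp add: vertical_def)

lemma subgroup_vertical: "subgroup K ZF \<Longrightarrow> subgroup (vertical K) Zm"
proof (rule Z.subgroupI)
  assume K: "subgroup K ZF"
  show "vertical K \<subseteq> carrier Zm" using mem_ZF[OF K] by (auto simp: vertical_def)
  show "vertical K \<noteq> {}" using one_mem[OF K] by (auto simp: vertical_def)
  show "negZ x \<in> vertical K" if "x \<in> vertical K" for x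
    using inv_mem[OF K, of x "\<one>\<^bsub>Fn\<^esub>"] that by (simp add: vertical_def)
  show "x \<boxplus> y \<in> vertical K" if "x \<in> vertical K" "y \<in> vertical K" for x y
    using mult_mem[OF K, of x "\<one>\<^bsub>Fn\<^esub>" y "\<one>\<^bsub>Fn\<^esub>"] that by (simp add: vertical_def)
qed

lemma section_exists:
  assumes K: "subgroup K ZF" and S: "free_set Fn S" and gen: "snd ` K = generate Fn S"
  obtains A where "\<And>w. w \<in> snd ` K \<Longrightarrow> (A w, w) \<in> K"
    "\<And>v w. v \<in> snd ` K \<Longrightarrow> w \<in> snd ` K \<Longrightarrow> A (v \<cdot> w) = A v \<boxplus> A w"
    "\<And>w. w \<in> snd ` K \<Longrightarrow> A (invFn w) = negZ (A w)" "A \<one>\<^bsub>Fn\<^esub> = \<one>\<^bsub>Zm\<^esub>"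
proof -
  have Sc: "S \<subseteq> carrier Fn" using S by (rule free_set_carrier)
  have "\<exists>x. (x, s) \<in> K" if "s \<in> S" for s
  proof -
    have "s \<in> snd ` K" unfolding gen using that by (rule generate.incl)
    then show ?thesis by auto
  qed
  then obtain a where a: "\<And>s. s \<in> S \<Longrightarrow> (a s, s) \<in> K" by metis
  have ac: "a ` S \<subseteq> carrier Zm" using mem_ZF(1)[OF K a] by blast
  obtain A where A: "\<And>w. w \<in> generate Fn S \<Longrightarrow> A w \<in> carrier Zm"
    "\<And>v w. v \<in> generate Fn S \<Longrightarrow> w \<in> generate Fn S \<Longrightarrow> A (v \<cdot> w) = A v \<boxplus> A w"
    "\<And>w. w \<in> generate Fn S \<Longrightarrow> A (invFn w) = negZ (A w)" "A \<one>\<^bsub>Fn\<^esub> = \<one>\<^bsub>Zm\<^esub>"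
    "\<And>s. s \<in> S \<Longrightarrow> A s = a s"
    by (rule hom_to_Z[OF S ac]) (rule that)
  have mem: "(A w, w) \<in> K" if "w \<in> generate Fn S" for w
    using Sc that
  proof (induction rule: F.generate_right_induct)
    case one
    then show ?case using one_mem[OF K] A(4) by simp
  next
    case (mult y s)
    then show ?case
      using mult_mem[OF K mult(3) a[OF mult(2)]] A(2)[OF mult(1) generate.incl[OF mult(2)]] A(5) by simp
  next
    case (mult_inv y s)
    have s: "s \<in> generate Fn S" "invFn s \<in> generate Fn S" using mult_inv(2) by (auto intro: generate.intros)
    show ?case
      using mult_mem[OF K mult_inv(3) inv_mem[OF K a[OF mult_inv(2)]]] A(2)[OF mult_inv(1) s(2)] A(3)[OF s(1)]
        A(5)[OF mult_inv(2)] by simp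
  qed
  show ?thesis using that[of A] mem A(2,3,4) unfolding gen by blast
qed

text \<open>Generators of the vertical part together with arbitrary lifts of generators of the
  projection generate \<open>K\<close>.\<close>

lemma fg_product:
  assumes K: "subgroup K ZF" and fg: "fg Fn (snd ` K)"
  shows "fg ZF K" and "rank_of ZF K \<le> rank_of Zm (vertical K) + rank_of Fn (snd ` K)"
proof -
  obtain S where S: "S \<subseteq> snd ` K" "finite S" "card S = rank_of Fn (snd ` K)" "generate Fn S = snd ` K"
    using F.rank_of_generators[OF subgroup_snd[OF K] fg] .
  obtain T where T: "T \<subseteq> vertical K" "finite T" "card T = rank_of Zm (vertical K)" "generate Zm T = vertical K"
    using Z.rank_of_generators[OF subgroup_vertical[OF K] Z_fg[OF subgroup_vertical[OF K]]] .
  have Sc: "S \<subseteq> carrier Fn" using S subgroup.subset[OF subgroup_snd[OF K]] by blast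
  have Tc: "T \<subseteq> carrier Zm" using T subgroup.subset[OF subgroup_vertical[OF K]] by blast
  have "\<forall>s \<in> S. \<exists>x. (x, s) \<in> K" using S(1) by force
  then obtain a where a: "\<And>s. s \<in> S \<Longrightarrow> (a s, s) \<in> K" by metis
  let ?B = "(\<lambda>t. (t, \<one>\<^bsub>Fn\<^esub>)) ` T \<union> (\<lambda>s. (a s, s)) ` S"
  let ?W = "generate ZF ?B"
  have BK: "?B \<subseteq> K" using T(1) a by (auto simp: vertical_def)
  then have Bc: "?B \<subseteq> carrier ZF" using subgroup.subset[OF K] by blast
  have W: "subgroup ?W ZF" using Bc by (rule G.generate_is_subgroup)
  have vert: "(d, \<one>\<^bsub>Fn\<^esub>) \<in> ?W" if "d \<in> vertical K" for d
    using Tc that[folded T(4)]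
  proof (induction rule: Z.generate_right_induct)
    case one
    then show ?case using one_mem[OF W] .
  next
    case (mult y s)
    have "(s, \<one>\<^bsub>Fn\<^esub>) \<in> ?W" using mult(2) by (intro generate.incl) auto
    then show ?case using mult_mem[OF W mult(3)] by fastforce
  next
    case (mult_inv y s)
    have "(s, \<one>\<^bsub>Fn\<^esub>) \<in> ?W" using mult_inv(2) by (intro generate.incl) auto
    then show ?case using mult_mem[OF W mult_inv(3) inv_mem[OF W]] by fastforce
  qed
  have lift: "\<exists>x. (x, w) \<in> ?W" if "w \<in> snd ` K" for w
    using Sc that[folded S(4)]
  proof (induction rule: F.generate_right_induct)
    case one
    then show ?case using one_mem[OF W] by blast
  next
    case (mult y s)
    have "(a s, s) \<in> ?W" using mult(2) by (intro generate.incl) auto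
    then show ?case using mult_mem[OF W] mult(3) by blast
  next
    case (mult_inv y s)
    have "(a s, s) \<in> ?W" using mult_inv(2) by (intro generate.incl) auto
    then show ?case using mult_mem[OF W] inv_mem[OF W] mult_inv(3) by blast
  qed
  have WK: "?W \<subseteq> K" using G.generate_subgroup_incl[OF BK K] .
  have "K \<subseteq> ?W"
  proof
    fix y assume "y \<in> K"
    then obtain x w where y: "y = (x, w)" "(x, w) \<in> K" by (cases y) auto
    then obtain x' where x': "(x', w) \<in> ?W" using lift[of w] by force
    have c: "x \<in> carrier Zm" "x' \<in> carrier Zm" using mem_ZF[OF K] y x' WK by blast+
    have "x \<boxplus> negZ x' \<in> vertical K" using vertical_diff[OF K y(2)] x' WK by blast
    then have "x \<boxplus> negZ x' \<in> vertical ?W" using vert by (simp add: vertical_def)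
    then have "((x \<boxplus> negZ x') \<boxplus> x', w) \<in> ?W" using vertical_translate[OF W _ x'] by blast
    moreover have "(x \<boxplus> negZ x') \<boxplus> x' = x" using c by (simp add: Z.m_assoc)
    ultimately show "y \<in> ?W" using y by simp
  qed
  then have gen: "generate ZF ?B = K" using WK by blast
  show "fg ZF K" using G.fgI[OF Bc _ gen] S(2) T(2) by simp
  have "rank_of ZF K \<le> card ?B" using G.rank_of_le[OF Bc _ gen] S(2) T(2) by simp
  also have "\<dots> \<le> card T + card S"
    by (rule order.trans[OF card_Un_le]) (intro add_mono card_image_le S T)
  finally show "rank_of ZF K \<le> rank_of Zm (vertical K) + rank_of Fn (snd ` K)" using S T by simp
qed

lemma fg_snd:
  assumes K: "subgroup K ZF" and fg: "fg ZF K"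
  shows "fg Fn (snd ` K)"
proof -
  obtain B where B: "B \<subseteq> K" "finite B" "generate ZF B = K" using fg G.fg_iff[OF K] by blast
  have Bc: "B \<subseteq> carrier ZF" using B subgroup.subset[OF K] by blast
  have "generate Fn (snd ` B) = snd ` K"
    using group_hom.generate_img[OF snd_hom Bc] B(3) by simp
  moreover have "snd ` B \<subseteq> carrier Fn" using Bc by auto
  ultimately show ?thesis using F.fgI[of "snd ` B"] B(2) by simp
qed

text \<open>The section splits \<open>(x, w)\<close> into the vertical element
  \<open>x - A w\<close> and \<open>(A w, w)\<close>. Additive maps on the vertical part and on the
  projection can therefore be prescribed independently and added.\<close>

lemma rank_product_ge:
  assumes K: "subgroup K ZF" and fg: "fg ZF K"
  shows "rank_of Zm (vertical K) + rank_of Fn (snd ` K) \<le> rank_of ZF K"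
proof -
  obtain R where R: "free_set Fn R" "finite R" "generate Fn R = snd ` K" "card R = rank_of Fn (snd ` K)"
    using F_free_basis[OF subgroup_snd[OF K] fg_snd[OF K fg]] .
  obtain A where A: "\<And>w. w \<in> snd ` K \<Longrightarrow> (A w, w) \<in> K"
    "\<And>v w. v \<in> snd ` K \<Longrightarrow> w \<in> snd ` K \<Longrightarrow> A (v \<cdot> w) = A v \<boxplus> A w"
    "A \<one>\<^bsub>Fn\<^esub> = \<one>\<^bsub>Zm\<^esub>"
    using section_exists[OF K R(1) R(3)[symmetric]] by metis
  obtain T where T: "T \<subseteq> vertical K" "finite T" "card T = rank_of Zm (vertical K)"
    "extends_additively Zm T (vertical K)"
    by (rule Z_basis[OF subgroup_vertical[OF K]]) (rule that)
  let ?B = "(\<lambda>t. (t, \<one>\<^bsub>Fn\<^esub>)) ` T \<union> (\<lambda>s. (A s, s)) ` R"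
  have RK: "s \<in> snd ` K" if "s \<in> R" for s using generate.incl[OF that] R(3) by metis
  have one: "\<one>\<^bsub>Fn\<^esub> \<notin> R" using F.one_notin_free_set[OF R(1)] .
  have BK: "?B \<subseteq> K" using T(1) A(1) RK by (auto simp: vertical_def)
  have card: "card ?B = card T + card R"
  proof (subst card_Un_disjoint)
    show "(\<lambda>t. (t, \<one>\<^bsub>Fn\<^esub>)) ` T \<inter> (\<lambda>s. (A s, s)) ` R = {}" using one by auto
    show "card ((\<lambda>t. (t, \<one>\<^bsub>Fn\<^esub>)) ` T) + card ((\<lambda>s. (A s, s)) ` R) = card T + card R"
      by (simp add: card_image inj_on_def)
  qed (use T R in auto)
  have Ac: "A w \<in> carrier Zm" if "w \<in> snd ` K" for w using mem_ZF(1)[OF K A(1)[OF that]] .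
  have "extends_additively ZF ?B K"
    unfolding extends_additively_def
  proof
    fix f :: "(nat \<Rightarrow> int) \<times> letter list \<Rightarrow> int"
    obtain h where h: "additive_on Zm (vertical K) h" "\<forall>t \<in> T. h t = f (t, \<one>\<^bsub>Fn\<^esub>)"
      using extends_additivelyD[OF T(4), of "\<lambda>t. f (t, \<one>\<^bsub>Fn\<^esub>)"] by blast
    obtain g where g: "additive_on Fn (snd ` K) g" "\<forall>s \<in> R. g s = f (A s, s)"
      using extends_additivelyD[OF F.free_set_extends_additively[OF R(1)], of "\<lambda>s. f (A s, s)"] R(3) by metis
    let ?h = "\<lambda>(x, w). h (x \<boxplus> negZ (A w)) + g w"
    have "additive_on ZF K ?h"
      unfolding additive_on_def
    proof (intro ballI)
      fix p q assume pq: "p \<in> K" "q \<in> K"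
      obtain x w where p: "p = (x, w)" by (cases p)
      obtain y v where q: "q = (y, v)" by (cases q)
      have w: "w \<in> snd ` K" "v \<in> snd ` K" using pq p q by force+
      have c: "x \<in> carrier Zm" "y \<in> carrier Zm" "A w \<in> carrier Zm" "A v \<in> carrier Zm"
        using mem_ZF[OF K] pq p q Ac w by blast+
      have d: "x \<boxplus> negZ (A w) \<in> vertical K" "y \<boxplus> negZ (A v) \<in> vertical K"
        using vertical_diff[OF K] A(1) w pq p q by blast+
      have "x \<boxplus> y \<boxplus> negZ (A w \<boxplus> A v) = (x \<boxplus> negZ (A w)) \<boxplus> (y \<boxplus> negZ (A v))"
        using c by (simp add: Z.inv_mult Z.m_ac)
      then show "?h (p \<otimes>\<^bsub>ZF\<^esub> q) = ?h p + ?h q"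
        using p q A(2)[OF w] additive_onD[OF h(1) d] additive_onD[OF g(1) w] by simp
    qed
    moreover have "?h t = f t" if "t \<in> ?B" for t
    proof -
      have "g \<one>\<^bsub>Fn\<^esub> = 0" using F.additive_on_one[OF g(1)] subgroup.one_closed[OF subgroup_snd[OF K]] by blast
      moreover have "h \<one>\<^bsub>Zm\<^esub> = 0"
        using Z.additive_on_one[OF h(1)] subgroup.one_closed[OF subgroup_vertical[OF K]] by blast
      moreover have "x \<in> carrier Zm" if "x \<in> T" for x
        using that T(1) subgroup.subset[OF subgroup_vertical[OF K]] by blast
      ultimately show ?thesis using that h(2) g(2) A(3) Ac RK by auto
    qed
    ultimately show "\<exists>h. additive_on ZF K h \<and> (\<forall>t \<in> ?B. h t = f t)" by blast
  qed
  then have "card ?B \<le> rank_of ZF K" using G.rank_of_ge[OF K fg BK] T R by simp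
  then show ?thesis using card T R by simp
qed

text \<open>Since \<open>L\<^sub>H\<close> has index \<open>l\<close>, the projection of \<open>H \<inter> K\<close> has index at most \<open>l\<close> in \<open>H\<pi> \<inter> K\<pi>\<close>.\<close>

lemma intersection_rank_upper:
  assumes H: "subgroup H ZF" and K: "subgroup K ZF" and fgHK: "fg ZF (H \<inter> K)"
    and TL: "transversal Zm (vertical H) (carrier Zm) TL" "finite TL"
  shows "fg Fn (snd ` H \<inter> snd ` K)"
    and "rank_of Fn (snd ` H \<inter> snd ` K) \<ge> 1 \<Longrightarrow>
      rank_of ZF (H \<inter> K) \<le> rank_of Zm (vertical K) + 1 + card TL * (rank_of Fn (snd ` H \<inter> snd ` K) - 1)"
proof -
  let ?U = "snd ` H \<inter> snd ` K" and ?U' = "snd ` (H \<inter> K)"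
  have HK: "subgroup (H \<inter> K) ZF" using G.subgroups_Inter_pair[OF H K] .
  have U: "subgroup ?U Fn" using F.subgroups_Inter_pair[OF subgroup_snd[OF H] subgroup_snd[OF K]] .
  have U': "subgroup ?U' Fn" using subgroup_snd[OF HK] .
  have "\<forall>w \<in> ?U. \<exists>x y. (x, w) \<in> H \<and> (y, w) \<in> K" by force
  then obtain x y where xy: "\<And>w. w \<in> ?U \<Longrightarrow> (x w, w) \<in> H" "\<And>w. w \<in> ?U \<Longrightarrow> (y w, w) \<in> K" by metis
  have c: "x w \<in> carrier Zm" "y w \<in> carrier Zm" if "w \<in> ?U" for w
    using mem_ZF(1)[OF H xy(1)[OF that]] mem_ZF(1)[OF K xy(2)[OF that]] by auto
  \<comment> \<open>The difference of a lift of \<open>w\<close> to \<open>H\<close> and a lift to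
    \<open>K\<close>. Elements whose differences agree modulo the vertical part of \<open>H\<close>
    lie in the same coset of the projection of \<open>H \<inter> K\<close>.\<close>
  define \<delta> where "\<delta> w = x w \<boxplus> negZ (y w)" for w
  have \<delta>c: "\<delta> w \<in> carrier Zm" if "w \<in> ?U" for w using c[OF that] by (simp add: \<delta>_def)
  define g where "g w = (SOME t. t \<in> TL \<and> \<delta> w \<boxplus> negZ t \<in> vertical H)" for w
  have TLc: "TL \<subseteq> carrier Zm" using TL by (simp add: transversal_def)
  have g: "g w \<in> TL" "\<delta> w \<boxplus> negZ (g w) \<in> vertical H" if "w \<in> ?U" for w
  proof -
    have "\<exists>t. t \<in> TL \<and> \<delta> w \<boxplus> negZ t \<in> vertical H" using TL \<delta>c[OF that] unfolding transversal_def by blast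
    then have "g w \<in> TL \<and> \<delta> w \<boxplus> negZ (g w) \<in> vertical H" unfolding g_def by (rule someI_ex)
    then show "g w \<in> TL" "\<delta> w \<boxplus> negZ (g w) \<in> vertical H" by auto
  qed
  have vH: "subgroup (vertical H) Zm" using subgroup_vertical[OF H] .
  have same: "w \<cdot> invFn v \<in> ?U'" if w: "w \<in> ?U" and v: "v \<in> ?U" and eq: "g w = g v" for w v
  proof -
    have gc: "g v \<in> carrier Zm" using g(1)[OF v] TLc by blast
    let ?d = "\<delta> w \<boxplus> negZ (\<delta> v)"
    have "(\<delta> w \<boxplus> negZ (g v)) \<boxplus> negZ (\<delta> v \<boxplus> negZ (g v)) \<in> vertical H"
      using g(2)[OF w] g(2)[OF v] eq subgroup.m_closed[OF vH] subgroup.m_inv_closed[OF vH] by simp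
    moreover have "(\<delta> w \<boxplus> negZ (g v)) \<boxplus> negZ (\<delta> v \<boxplus> negZ (g v)) = ?d"
      using \<delta>c w v gc by (simp add: Z.inv_mult_group Z.m_assoc)
    ultimately have "negZ ?d \<in> vertical H" using subgroup.m_inv_closed[OF vH] by simp
    moreover have "(x w \<boxplus> negZ (x v), w \<cdot> invFn v) \<in> H"
      using mult_mem[OF H xy(1)[OF w] inv_mem[OF H xy(1)[OF v]]] .
    ultimately have "(negZ ?d \<boxplus> (x w \<boxplus> negZ (x v)), w \<cdot> invFn v) \<in> H"
      using vertical_translate[OF H] by blast
    moreover have "negZ ?d \<boxplus> (x w \<boxplus> negZ (x v)) = y w \<boxplus> negZ (y v)"
    proof -
      let ?p = "x w \<boxplus> negZ (x v)" and ?q = "y w \<boxplus> negZ (y v)"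
      have "?d = ?p \<boxplus> negZ ?q" using c[OF w] c[OF v] by (simp add: \<delta>_def Z.inv_mult Z.m_ac)
      then show ?thesis using c[OF w] c[OF v] by (simp add: Z.inv_mult_group Z.m_assoc)
    qed
    moreover have "(y w \<boxplus> negZ (y v), w \<cdot> invFn v) \<in> K"
      using mult_mem[OF K xy(2)[OF w] inv_mem[OF K xy(2)[OF v]]] .
    ultimately show ?thesis by force
  qed
  obtain T where T: "transversal Fn ?U' ?U T" "finite T" "card T \<le> card TL"
    using F.transversal_card_le[OF U' subgroup.subset[OF U] TL(2), of g] g(1) same by blast
  have sub: "?U' \<subseteq> ?U" by auto
  have fgU': "fg Fn ?U'" using fg_snd[OF HK fgHK] .
  show fgU: "fg Fn ?U"
    using F.fg_finite_index_overgroup[OF U' fgU' U sub transversal_finite_index[OF T(1,2)]] .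
  assume "rank_of Fn ?U \<ge> 1"
  then obtain a where a: "rank_of Fn ?U = Suc a" by (cases "rank_of Fn ?U") auto
  have "rank_of Fn ?U' + card T = card T * rank_of Fn ?U + 1"
    using F.finite_index_subgroup(2)[OF free_set_letters U _ fgU U' sub T(1,2)]
      generate_letters[of n] subgroup.subset[OF U] by simp
  then have "rank_of Fn ?U' = card T * a + 1" using a by simp
  moreover have "rank_of ZF (H \<inter> K) \<le> rank_of Zm (vertical (H \<inter> K)) + rank_of Fn ?U'"
    using fg_product(2)[OF HK fgU'] .
  moreover have "rank_of Zm (vertical (H \<inter> K)) \<le> rank_of Zm (vertical K)"
    by (rule Z_rank_mono[OF subgroup_vertical[OF K] subgroup_vertical[OF HK]]) (auto simp: vertical_def)
  moreover have "card T * a \<le> card TL * a" using T(3) by (rule mult_right_mono) simp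
  ultimately have "rank_of ZF (H \<inter> K) \<le> rank_of Zm (vertical K) + 1 + card TL * a" by linarith
  then show "rank_of ZF (H \<inter> K) \<le> rank_of Zm (vertical K) + 1 + card TL * (rank_of Fn ?U - 1)"
    using a by simp
qed

text \<open>Choosing the values of \<open>B\<close> on the free generators \<open>z \<in> W\<close> makes \<open>A - B\<close> surjective onto \<open>\<int>\<^sup>m/L\<close>, so that
  the projection of \<open>H \<inter> K\<close> has index exactly \<open>[\<int>\<^sup>m : L]\<close> in \<open>H\<pi> \<inter> K\<pi>\<close>.\<close>

lemma exists_twisted_subgroup:
  assumes H: "subgroup H ZF" "fg ZF H"
    and L: "subgroup L Zm" "vertical H \<subseteq> L" and M: "subgroup M Zm" "M \<subseteq> L"
    and LM: "\<And>x. x \<in> L \<Longrightarrow> \<exists>p \<in> vertical H. \<exists>q \<in> M. x = p \<boxplus> q"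
    and TL: "transversal Zm L (carrier Zm) TL" "finite TL"
    and S: "finite S" and W: "finite W" "card W = m + 1" "W \<subseteq> snd ` H" "S \<inter> W = {}"
    and free: "free_set Fn (S \<union> W)"
  obtains K where "subgroup K ZF" "fg ZF K" "fg ZF (H \<inter> K)" "snd ` K = generate Fn (S \<union> W)"
    "rank_of ZF K \<le> rank_of Zm M + card S + (m + 1)"
    "card TL * (rank_of Fn (snd ` H \<inter> generate Fn S) + (m + 1)) + 1 \<le> rank_of ZF (H \<inter> K) + card TL"
proof -
  define P where "P = snd ` H"
  define V where "V = generate Fn (S \<union> W)"
  define U where "U = P \<inter> V"
  have SWc: "S \<union> W \<subseteq> carrier Fn" using free by (rule free_set_carrier)
  have P: "subgroup P Fn" "fg Fn P" unfolding P_def using subgroup_snd fg_snd H by auto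
  have V: "subgroup V Fn" unfolding V_def using SWc by (rule F.generate_is_subgroup)
  have fgV: "fg Fn V" using F.fgI[OF SWc] S W by (simp add: V_def)
  have U: "subgroup U Fn" unfolding U_def using F.subgroups_Inter_pair[OF P(1) V] .
  have fgU: "fg Fn U" unfolding U_def using howson[OF P V fgV] .
  obtain R where R: "free_set Fn R" "finite R" "generate Fn R = P"
    using F_free_basis[OF P] by metis
  obtain A where A: "\<And>w. w \<in> P \<Longrightarrow> (A w, w) \<in> H"
    "\<And>v w. v \<in> P \<Longrightarrow> w \<in> P \<Longrightarrow> A (v \<cdot> w) = A v \<boxplus> A w"
    "\<And>w. w \<in> P \<Longrightarrow> A (invFn w) = negZ (A w)" "A \<one>\<^bsub>Fn\<^esub> = \<one>\<^bsub>Zm\<^esub>"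
    using section_exists[OF H(1) R(1)] R(3) unfolding P_def by metis
  have Ac: "A w \<in> carrier Zm" if "w \<in> P" for w using mem_ZF(1)[OF H(1) A(1)[OF that]] .
  obtain E where E: "E \<subseteq> carrier Zm" "finite E" "card E \<le> m" "generate Zm E = carrier Zm"
    by (rule Z_basis[OF Z.subgroup_self]) (rule that)
  obtain j where j: "j ` E \<subseteq> W" "inj_on j E"
    using card_le_inj[OF E(2) W(1)] E(3) W(2) by auto
  \<comment> \<open>The at most \<open>m\<close> generators of the free abelian factor are
    distributed over distinct elements of \<open>W\<close>; the remaining elements of
    \<open>W\<close> get the value zero. With \<open>b\<close> as below, \<open>\<epsilon>\<close>
    is the restriction of \<open>A - B\<close> to \<open>W\<close>.\<close>
  define \<epsilon> where "\<epsilon> w = (if w \<in> j ` E then inv_into E j w else \<one>\<^bsub>Zm\<^esub>)" for w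
  have \<epsilon>c: "\<epsilon> w \<in> carrier Zm" for w
    using E(1) inv_into_into[of w j E] by (auto simp: \<epsilon>_def)
  have \<epsilon>j: "\<epsilon> (j e) = e" if "e \<in> E" for e
    using that j(2) by (simp add: \<epsilon>_def)
  define b where "b s = (if s \<in> W then A s \<boxplus> negZ (\<epsilon> s) else \<one>\<^bsub>Zm\<^esub>)" for s
  have WP: "w \<in> P" if "w \<in> W" for w using W(3) that by (auto simp: P_def)
  have bc: "b ` (S \<union> W) \<subseteq> carrier Zm" using Ac WP \<epsilon>c by (auto simp: b_def)
  obtain B where B: "\<And>w. w \<in> V \<Longrightarrow> B w \<in> carrier Zm"
    "\<And>v w. v \<in> V \<Longrightarrow> w \<in> V \<Longrightarrow> B (v \<cdot> w) = B v \<boxplus> B w"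
    "\<And>w. w \<in> V \<Longrightarrow> B (invFn w) = negZ (B w)" "B \<one>\<^bsub>Fn\<^esub> = \<one>\<^bsub>Zm\<^esub>"
    "\<And>s. s \<in> S \<union> W \<Longrightarrow> B s = b s"
    by (rule hom_to_Z[OF free bc, folded V_def]) (rule that)
  \<comment> \<open>The graph of \<open>B\<close> thickened by \<open>M\<close>: an extension of
    \<open>V\<close> with vertical part \<open>M\<close>.\<close>
  define K where "K = {(x, w). x \<in> carrier Zm \<and> w \<in> V \<and> x \<boxplus> negZ (B w) \<in> M}"
  have Vc: "w \<in> carrier Fn" if "w \<in> V" for w using V that subgroup.mem_carrier by metis
  have K: "subgroup K ZF"
  proof (rule G.subgroupI)
    show "K \<subseteq> carrier ZF" using Vc by (auto simp: K_def)
    have "(\<one>\<^bsub>Zm\<^esub>, \<one>\<^bsub>Fn\<^esub>) \<in> K"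
      using subgroup.one_closed[OF V] subgroup.one_closed[OF M(1)] B(4) by (simp add: K_def)
    then show "K \<noteq> {}" by blast
  next
    fix p assume "p \<in> K"
    then obtain x w where p: "p = (x, w)" "x \<in> carrier Zm" "w \<in> V" "x \<boxplus> negZ (B w) \<in> M"
      by (auto simp: K_def)
    have "negZ (x \<boxplus> negZ (B w)) \<in> M" using p(4) subgroup.m_inv_closed[OF M(1)] by blast
    moreover have "negZ (x \<boxplus> negZ (B w)) = negZ x \<boxplus> negZ (B (invFn w))"
      using p B(1,3) by (simp add: Z.inv_mult)
    ultimately show "inv\<^bsub>ZF\<^esub> p \<in> K"
      using p Vc subgroup.m_inv_closed[OF V] by (simp add: K_def)
  next
    fix p q assume "p \<in> K" "q \<in> K"
    then obtain x w y v where p: "p = (x, w)" "x \<in> carrier Zm" "w \<in> V" "x \<boxplus> negZ (B w) \<in> M"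
      and q: "q = (y, v)" "y \<in> carrier Zm" "v \<in> V" "y \<boxplus> negZ (B v) \<in> M"
      by (auto simp: K_def)
    have "(x \<boxplus> negZ (B w)) \<boxplus> (y \<boxplus> negZ (B v)) \<in> M" using p(4) q(4) subgroup.m_closed[OF M(1)] by blast
    moreover have "(x \<boxplus> negZ (B w)) \<boxplus> (y \<boxplus> negZ (B v)) = (x \<boxplus> y) \<boxplus> negZ (B (w \<cdot> v))"
      using p q B(1,2) by (simp add: Z.inv_mult Z.m_ac)
    ultimately show "p \<otimes>\<^bsub>ZF\<^esub> q \<in> K"
      using p q subgroup.m_closed[OF V] by (simp add: K_def)
  qed
  have BK: "(B w, w) \<in> K" if "w \<in> V" for w
    using that B(1) subgroup.one_closed[OF M(1)] by (simp add: K_def)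
  have sndK: "snd ` K = V"
  proof
    show "V \<subseteq> snd ` K"
    proof
      fix w assume "w \<in> V"
      then show "w \<in> snd ` K" using image_eqI[of w snd "(B w, w)" K] BK by simp
    qed
  qed (auto simp: K_def)
  have vK: "vertical K = M"
    using subgroup.one_closed[OF V] B(4) subgroup.subset[OF M(1)] by (auto simp: vertical_def K_def)
  have fgK: "fg ZF K" using fg_product(1)[OF K] fgV sndK by simp
  have "rank_of Fn V = card (S \<union> W)" unfolding V_def using F.rank_of_free[OF free] S W(1) by simp
  then have rankV: "rank_of Fn V = card S + (m + 1)" using S W by (simp add: card_Un_disjoint)
  have rankK: "rank_of ZF K \<le> rank_of Zm M + card S + (m + 1)"
    using fg_product(2)[OF K] fgV sndK rankV vK by simp
  have HK: "subgroup (H \<inter> K) ZF" using G.subgroups_Inter_pair[OF H(1) K] .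
  define \<delta> where "\<delta> w = A w \<boxplus> negZ (B w)" for w
  have \<delta>c: "\<delta> w \<in> carrier Zm" if "w \<in> U" for w using that Ac B(1) by (simp add: \<delta>_def U_def)
  have \<delta>m: "\<delta> (v \<cdot> w) = \<delta> v \<boxplus> \<delta> w" if "v \<in> U" "w \<in> U" for v w
    using that Ac A(2) B(1,2) by (simp add: \<delta>_def U_def Z.inv_mult Z.m_ac)
  have \<delta>i: "\<delta> (invFn w) = negZ (\<delta> w)" if "w \<in> U" for w
    using that Ac A(3) B(1,3) by (simp add: \<delta>_def U_def Z.inv_mult)
  \<comment> \<open>The fibres of \<open>H\<close> and \<open>K\<close> over \<open>w\<close> are
    the cosets of \<open>vertical H\<close> and \<open>M\<close> through \<open>A w\<close> and
    \<open>B w\<close>. They meet exactly if the difference \<open>\<delta> w\<close> lies in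
    \<open>vertical H + M\<close>, which is \<open>L\<close>.\<close>
  have U': "w \<in> snd ` (H \<inter> K) \<longleftrightarrow> \<delta> w \<in> L" if w: "w \<in> U" for w
  proof
    have w': "w \<in> P" "w \<in> V" using w by (auto simp: U_def)
    have c: "A w \<in> carrier Zm" "B w \<in> carrier Zm" using w' Ac B(1) by auto
    {
      assume "w \<in> snd ` (H \<inter> K)"
      then obtain x where x: "(x, w) \<in> H" "(x, w) \<in> K" by auto
      have xc: "x \<in> carrier Zm" using mem_ZF(1)[OF H(1) x(1)] .
      have "x \<boxplus> negZ (A w) \<in> L" using vertical_diff[OF H(1) x(1) A(1)[OF w'(1)]] L(2) by blast
      moreover have "x \<boxplus> negZ (B w) \<in> L" using x(2) M(2) by (auto simp: K_def)
      ultimately have "negZ (x \<boxplus> negZ (A w)) \<boxplus> (x \<boxplus> negZ (B w)) \<in> L"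
        using subgroup.m_closed[OF L(1)] subgroup.m_inv_closed[OF L(1)] by blast
      moreover have "negZ (x \<boxplus> negZ (A w)) \<boxplus> (x \<boxplus> negZ (B w)) = \<delta> w"
        using xc c by (simp add: \<delta>_def Z.inv_mult_group Z.m_assoc)
      ultimately show "\<delta> w \<in> L" by simp
    }
    {
      assume "\<delta> w \<in> L"
      then obtain p q where pq: "p \<in> vertical H" "q \<in> M" "\<delta> w = p \<boxplus> q" using LM by blast
      have pc: "p \<in> carrier Zm" "q \<in> carrier Zm"
        using pq subgroup.mem_carrier[OF subgroup_vertical[OF H(1)]] subgroup.mem_carrier[OF M(1)] by auto
      let ?x = "negZ p \<boxplus> A w"
      have "negZ p \<in> vertical H" using pq(1) subgroup.m_inv_closed[OF subgroup_vertical[OF H(1)]] by blast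
      then have "(?x, w) \<in> H" using vertical_translate[OF H(1) _ A(1)[OF w'(1)]] by blast
      moreover have "?x \<boxplus> negZ (B w) = negZ p \<boxplus> \<delta> w" using pc c by (simp add: \<delta>_def Z.m_assoc)
      then have "?x \<boxplus> negZ (B w) = q" using pc pq(3) by simp
      then have "(?x, w) \<in> K" using pq(2) w'(2) pc c by (simp add: K_def)
      ultimately show "w \<in> snd ` (H \<inter> K)" using image_eqI[of w snd "(?x, w)" "H \<inter> K"] by simp
    }
  qed
  have HKU: "snd ` (H \<inter> K) \<subseteq> U" using sndK by (auto simp: U_def P_def)
  have surj: "carrier Zm \<subseteq> \<delta> ` U"
  proof
    fix x assume "x \<in> carrier Zm"
    have je: "j e \<in> U \<and> \<delta> (j e) = e" if "e \<in> E" for e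
    proof -
      have je: "j e \<in> W" using j(1) that by blast
      then have "j e \<in> V" unfolding V_def by (intro generate.incl) simp
      moreover have "e \<in> carrier Zm" using that E(1) by blast
      ultimately show ?thesis
        using WP[OF je] B(5)[of "j e"] je \<epsilon>j[OF that] Ac[OF WP[OF je]]
        by (simp add: U_def \<delta>_def b_def Z.inv_mult)
    qed
    have "\<exists>w \<in> U. \<delta> w = x" if "x \<in> generate Zm E" for x
      using E(1) that
    proof (induction rule: Z.generate_right_induct)
      case one
      have "\<one>\<^bsub>Fn\<^esub> \<in> U" using subgroup.one_closed[OF U] .
      then show ?case using A(4) B(4) by (intro bexI[of _ "\<one>\<^bsub>Fn\<^esub>"]) (simp_all add: \<delta>_def)
    next
      case (mult y e)
      then obtain w where w: "w \<in> U" "\<delta> w = y" by blast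
      then show ?case using \<delta>m[of w "j e"] je[OF mult(2)] subgroup.m_closed[OF U] by metis
    next
      case (mult_inv y e)
      then obtain w where w: "w \<in> U" "\<delta> w = y" by blast
      have ji: "invFn (j e) \<in> U" using je[OF mult_inv(2)] subgroup.m_inv_closed[OF U] by blast
      then show ?case
        using w \<delta>m[OF w(1) ji] \<delta>i[of "j e"] je[OF mult_inv(2)] subgroup.m_closed[OF U w(1) ji] by metis
    qed
    then show "x \<in> \<delta> ` U" using \<open>x \<in> carrier Zm\<close> E(4) by blast
  qed
  define f where "f w = (THE t. t \<in> TL \<and> \<delta> w \<boxplus> negZ t \<in> L)" for w
  have TLc: "TL \<subseteq> carrier Zm" using TL by (simp add: transversal_def)
  have f: "f w \<in> TL \<and> \<delta> w \<boxplus> negZ (f w) \<in> L" if "w \<in> U" for w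
  proof -
    have "\<exists>!t. t \<in> TL \<and> \<delta> w \<boxplus> negZ t \<in> L" using TL \<delta>c[OF that] by (simp add: transversal_def)
    then show ?thesis unfolding f_def by (rule theI')
  qed
  have f_eq: "f w = t" if "w \<in> U" "t \<in> TL" "\<delta> w \<boxplus> negZ t \<in> L" for w t
    using f[OF that(1)] TL \<delta>c[OF that(1)] that unfolding transversal_def by blast
  have iff: "v \<cdot> invFn w \<in> snd ` (H \<inter> K) \<longleftrightarrow> f v = f w" if v: "v \<in> U" and w: "w \<in> U" for v w
  proof -
    have vw: "v \<cdot> invFn w \<in> U" using v w subgroup.m_closed[OF U] subgroup.m_inv_closed[OF U] by blast
    have fc: "f v \<in> carrier Zm" "f w \<in> carrier Zm" using f v w TLc by auto
    have "\<delta> (v \<cdot> invFn w) = \<delta> v \<boxplus> negZ (\<delta> w)"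
      using \<delta>m[OF v] \<delta>i[OF w] w subgroup.m_inv_closed[OF U] by simp
    then have 1: "v \<cdot> invFn w \<in> snd ` (H \<inter> K) \<longleftrightarrow> \<delta> v \<boxplus> negZ (\<delta> w) \<in> L" using U'[OF vw] by simp
    show ?thesis
    proof
      assume "v \<cdot> invFn w \<in> snd ` (H \<inter> K)"
      then have "(\<delta> v \<boxplus> negZ (\<delta> w)) \<boxplus> (\<delta> w \<boxplus> negZ (f w)) \<in> L"
        using 1 f[OF w] subgroup.m_closed[OF L(1)] by blast
      moreover have "(\<delta> v \<boxplus> negZ (\<delta> w)) \<boxplus> (\<delta> w \<boxplus> negZ (f w)) = \<delta> v \<boxplus> negZ (f w)"
        using \<delta>c[OF v] \<delta>c[OF w] fc by (simp add: Z.m_assoc)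
      ultimately show "f v = f w" using f_eq[OF v] f[OF w] by simp
    next
      assume eq: "f v = f w"
      have "(\<delta> v \<boxplus> negZ (f v)) \<boxplus> negZ (\<delta> w \<boxplus> negZ (f w)) \<in> L"
        using f[OF v] f[OF w] subgroup.m_closed[OF L(1)] subgroup.m_inv_closed[OF L(1)] by blast
      moreover have "(\<delta> v \<boxplus> negZ (f v)) \<boxplus> negZ (\<delta> w \<boxplus> negZ (f w)) = \<delta> v \<boxplus> negZ (\<delta> w)"
        using \<delta>c[OF v] \<delta>c[OF w] fc eq by (simp add: Z.inv_mult_group Z.m_assoc)
      ultimately show "v \<cdot> invFn w \<in> snd ` (H \<inter> K)" using 1 by simp
    qed
  qed
  have fU: "f ` U = TL"
  proof
    show "TL \<subseteq> f ` U"
    proof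
      fix t assume t: "t \<in> TL"
      then obtain w where w: "w \<in> U" "\<delta> w = t" using surj TLc by blast
      have "f w = t" using f_eq[OF w(1) t] w(2) t TLc subgroup.one_closed[OF L(1)] by (auto simp: subsetD)
      then show "t \<in> f ` U" using w(1) by blast
    qed
  qed (use f in blast)
  obtain T where T: "transversal Fn (snd ` (H \<inter> K)) U T" "card T = card TL" "finite T"
    using F.transversal_of_map[of U "snd ` (H \<inter> K)" f, OF iff] fU TL(2) by metis
  have U'g: "subgroup (snd ` (H \<inter> K)) Fn" using subgroup_snd[OF HK] .
  have lett: "U \<subseteq> generate Fn (letters n)" using generate_letters[of n] subgroup.subset[OF U] by simp
  have fgU': "fg Fn (snd ` (H \<inter> K))" and rankU': "rank_of Fn (snd ` (H \<inter> K)) + card TL = card TL * rank_of Fn U + 1"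
    using F.finite_index_subgroup[OF free_set_letters U lett fgU U'g HKU T(1,3)] T(2) by simp_all
  have fgHK: "fg ZF (H \<inter> K)" using fg_product(1)[OF HK fgU'] .
  have "rank_of Fn (snd ` (H \<inter> K)) \<le> rank_of ZF (H \<inter> K)" using rank_product_ge[OF HK fgHK] by simp
  \<comment> \<open>The Kurosh step: a free basis of the intersection of \<open>P\<close> with
    \<open>generate Fn S\<close>, together with \<open>W\<close>, carries arbitrary additive maps on
    \<open>U\<close>, which bounds the rank of \<open>U\<close> from below.\<close>
  moreover have "rank_of Fn (P \<inter> generate Fn S) + (m + 1) \<le> rank_of Fn U"
  proof -
    let ?Q = "generate Fn S"
    have Sc: "S \<subseteq> carrier Fn" using SWc by blast
    have Q: "subgroup ?Q Fn" "fg Fn ?Q" using F.generate_is_subgroup[OF Sc] F.fgI[OF Sc S] by auto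
    have QV: "?Q \<subseteq> V" unfolding V_def by (rule F.mono_generate) auto
    have UQ: "U \<inter> ?Q = P \<inter> ?Q" using QV by (auto simp: U_def)
    have PQ: "subgroup (P \<inter> ?Q) Fn" "fg Fn (P \<inter> ?Q)"
      using F.subgroups_Inter_pair[OF P(1) Q(1)] howson[OF P Q] by auto
    obtain T0 where T0: "free_set Fn T0" "finite T0" "generate Fn T0 = P \<inter> ?Q" "card T0 = rank_of Fn (P \<inter> ?Q)"
      using F_free_basis[OF PQ] .
    have T0sub: "T0 \<subseteq> U \<inter> ?Q" using T0(3) UQ generate.incl[of _ T0 Fn] by blast
    have WU: "W \<subseteq> U" using WP by (auto simp: U_def V_def intro: generate.incl)
    have "extends_additively Fn (T0 \<union> W) U"
    proof (rule F.kurosh_extends_additively[OF free W(4) U _ WU T0sub])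
      show "U \<subseteq> generate Fn (S \<union> W)" by (auto simp: U_def V_def)
      show "extends_additively Fn T0 (U \<inter> ?Q)"
        using F.free_set_extends_additively[OF T0(1)] T0(3) UQ by simp
    qed
    then have "card (T0 \<union> W) \<le> rank_of Fn U"
      using F.rank_of_ge[OF U fgU] T0sub WU T0(2) W(1) by simp
    moreover have "T0 \<inter> W = {}"
      using F.free_set_notin_generate[OF free] W(4) T0sub by blast
    ultimately show ?thesis using T0(2,4) W(1,2) by (simp add: card_Un_disjoint)
  qed
  then have "card TL * (rank_of Fn (P \<inter> generate Fn S) + (m + 1)) \<le> card TL * rank_of Fn U"
    by (rule mult_left_mono) simp
  ultimately have "card TL * (rank_of Fn (snd ` H \<inter> generate Fn S) + (m + 1)) + 1 \<le> rank_of ZF (H \<inter> K) + card TL"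
    using rankU' unfolding P_def by linarith
  then show ?thesis using that[OF K fgK fgHK _ rankK] sndK by (simp add: V_def)
qed

section \<open>The restricted degree of inertia\<close>

context
  fixes H :: "((nat \<Rightarrow> int) \<times> letter list) set"
  assumes H: "subgroup H (Z_power m \<times>\<times> free_group n)" "fg (Z_power m \<times>\<times> free_group n) H"
    and cyc: "\<not> cyclic_group ((free_group n)\<lparr>carrier := snd ` H\<rparr>)"
    and der: "\<not> snd ` H \<subseteq> derived (free_group n) (carrier (free_group n))"
begin

abbreviation (input) "P \<equiv> snd ` H"
abbreviation (input) "DF \<equiv> derived (free_group n) (carrier (free_group n))"

lemma P_sub: "subgroup P Fn" and P_fg: "fg Fn P"
  using subgroup_snd fg_snd H by auto

lemma P_noncyclic: "P \<noteq> generate Fn {g}"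
proof
  assume P: "P = generate Fn {g}"
  then have "g \<in> P" by (auto intro: generate.incl)
  then have "g \<in> carrier Fn" using P_sub subgroup.mem_carrier by metis
  then show False using F.cyclic_groupI P cyc by blast
qed

lemma P_index: "g \<in> P \<Longrightarrow> \<not> finite_index Fn (generate Fn {g}) P"
  using not_virtually_cyclic[OF P_sub P_fg] P_noncyclic by blast

lemma F_center: "center Fn = {\<one>\<^bsub>Fn\<^esub>}"
  using noncyclic_center[OF P_sub P_fg] P_noncyclic by blast

lemma center_epi_snd: "center_epi ZF Fn snd"
proof -
  interpret s: group_hom ZF Fn snd by (rule snd_hom)
  show ?thesis
  proof
    show "snd ` carrier ZF = carrier Fn" using Z.one_closed by force
    show "kernel ZF Fn snd = center ZF"
    proof
      show "kernel ZF Fn snd \<subseteq> center ZF"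
        by (auto simp: kernel_def center_def Z.m_comm)
      show "center ZF \<subseteq> kernel ZF Fn snd"
      proof
        fix p assume p: "p \<in> center ZF"
        obtain x w where xw: "p = (x, w)" by (cases p)
        have w: "w \<in> carrier Fn" "x \<in> carrier Zm" using p xw by (auto simp: center_def)
        have "w \<otimes>\<^bsub>Fn\<^esub> v = v \<otimes>\<^bsub>Fn\<^esub> w" if "v \<in> carrier Fn" for v
          using p xw that Z.one_closed by (fastforce simp: center_def)
        then have "w \<in> center Fn" using w by (simp add: center_def)
        then show "p \<in> kernel ZF Fn snd" using F_center xw w by (simp add: kernel_def)
      qed
    qed
  qed
qed

lemma center_epi_id: "center_epi Fn Fn id"
proof -
  interpret i: group_hom Fn Fn id by unfold_locales (auto simp: hom_def)
  show ?thesis by unfold_locales (auto simp: kernel_def F_center)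
qed

definition G_tests where "G_tests = {K. subgroup K ZF \<and> fg ZF K \<and> fg ZF (H \<inter> K) \<and>
  \<not> finite_index Fn (P \<inter> snd ` K) P \<and> \<not> P \<inter> snd ` K \<subseteq> DF}"

definition F_tests where "F_tests = {K. subgroup K Fn \<and> fg Fn K \<and> fg Fn (P \<inter> K) \<and>
  \<not> finite_index Fn (P \<inter> K) P \<and> \<not> P \<inter> K \<subseteq> DF}"

lemma inertia_G:
  "restricted_inertia ZF H = (SUP K \<in> G_tests. rank_ratio (rank_of ZF (H \<inter> K) - 1) (rank_of ZF K - 1))"
proof -
  interpret c: center_epi ZF Fn snd by (rule center_epi_snd)
  have "inertia_admissible ZF H" using c.inertia_admissibleI[OF H] P_index der by blast
  then show ?thesis
    unfolding restricted_inertia_def reduced_rank_def c.inertia_test_subgroups_eq[OF H(1)] G_tests_def by simp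
qed

lemma inertia_F:
  "restricted_inertia Fn P = (SUP K \<in> F_tests. rank_ratio (rank_of Fn (P \<inter> K) - 1) (rank_of Fn K - 1))"
proof -
  interpret c: center_epi Fn Fn id by (rule center_epi_id)
  have "inertia_admissible Fn P" using c.inertia_admissibleI[OF P_sub P_fg] P_index der by simp
  then show ?thesis
    unfolding restricted_inertia_def reduced_rank_def c.inertia_test_subgroups_eq[OF P_sub] F_tests_def by simp
qed

lemma rank_pos:
  assumes "subgroup U Fn" "fg Fn U" "x \<in> U" "x \<noteq> \<one>\<^bsub>Fn\<^esub>"
  shows "rank_of Fn U \<ge> 1"
proof (rule ccontr)
  assume "\<not> ?thesis"
  then have "rank_of Fn U = 0" by simp
  moreover obtain B where B: "finite B" "card B = rank_of Fn U" "generate Fn B = U"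
    using F.rank_of_generators[OF assms(1,2)] by metis
  ultimately have "card B = 0" by simp
  then have "B = {}" using B(1) by simp
  then have "U = {\<one>\<^bsub>Fn\<^esub>}" using B(3) F.generate_empty by simp
  then show False using assms(3,4) by simp
qed

lemma one_in_derived: "\<one>\<^bsub>Fn\<^esub> \<in> DF"
  unfolding derived_def by (rule generate.one)

text \<open>The cyclic group generated by an element of \<open>P\<close> outside the derived
  subgroup is a test subgroup, and its ratio \<open>0/0\<close> counts as 1. The bound absorbs the
  rank of the vertical part in \<open>inertia_upper\<close>.\<close>

lemma F_inertia_ge_1: "1 \<le> restricted_inertia Fn P"
proof -
  obtain w where w: "w \<in> P" "w \<notin> DF" using der by blast
  have wc: "w \<in> carrier Fn" using w P_sub subgroup.mem_carrier by metis
  let ?K = "generate Fn {w}"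
  have K: "subgroup ?K Fn" "fg Fn ?K" using F.generate_is_subgroup[of "{w}"] F.fgI[of "{w}"] wc by auto
  have PK: "P \<inter> ?K = ?K" using F.generate_subgroup_incl[OF _ P_sub, of "{w}"] w(1) by auto
  have "w \<in> ?K" by (rule generate.incl) simp
  then have "?K \<in> F_tests" using K PK P_index[OF w(1)] w(2) by (auto simp: F_tests_def)
  have "rank_of Fn ?K \<le> 1" using F.rank_of_le[of "{w}" ?K] wc by simp
  then have "rank_ratio (rank_of Fn (P \<inter> ?K) - 1) (rank_of Fn ?K - 1) = 1"
    using PK by (simp add: rank_ratio_def)
  moreover have "rank_ratio (rank_of Fn (P \<inter> ?K) - 1) (rank_of Fn ?K - 1) \<le> restricted_inertia Fn P"
    unfolding inertia_F using \<open>?K \<in> F_tests\<close> by (rule SUP_upper)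
  ultimately show ?thesis by simp
qed

section \<open>The two inequalities for finite index and the case of infinite index\<close>

lemma inertia_upper:
  assumes TL: "transversal Zm (vertical H) (carrier Zm) TL" "finite TL"
  shows "restricted_inertia ZF H \<le> of_nat (card TL) * restricted_inertia Fn P"
  unfolding inertia_G
proof (rule SUP_least)
  fix K assume "K \<in> G_tests"
  then have K: "subgroup K ZF" "fg ZF K" "fg ZF (H \<inter> K)"
    "\<not> finite_index Fn (P \<inter> snd ` K) P" "\<not> P \<inter> snd ` K \<subseteq> DF" by (auto simp: G_tests_def)
  let ?U = "P \<inter> snd ` K"
  have U: "subgroup ?U Fn" using F.subgroups_Inter_pair[OF P_sub subgroup_snd[OF K(1)]] .
  have fgU: "fg Fn ?U" using intersection_rank_upper(1)[OF H(1) K(1,3) TL] .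
  have "snd ` K \<in> F_tests"
    using subgroup_snd[OF K(1)] fg_snd[OF K(1,2)] fgU K(4,5) by (simp add: F_tests_def)
  then have le: "rank_ratio (rank_of Fn ?U - 1) (rank_of Fn (snd ` K) - 1) \<le> restricted_inertia Fn P"
    unfolding inertia_F by (rule SUP_upper)
  obtain x where x: "x \<in> ?U" "x \<notin> DF" using K(5) by blast
  then have x1: "x \<noteq> \<one>\<^bsub>Fn\<^esub>" using one_in_derived by blast
  have U1: "rank_of Fn ?U \<ge> 1" using rank_pos[OF U fgU x(1) x1] .
  have K1: "rank_of Fn (snd ` K) \<ge> 1"
    using rank_pos[OF subgroup_snd[OF K(1)] fg_snd[OF K(1,2)] _ x1] x(1) by blast
  have "TL \<noteq> {}" using TL(1) Z.one_closed unfolding transversal_def by blast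
  then have l: "card TL \<ge> 1" using TL(2) by (simp add: Suc_leI card_gt_0_iff)
  show "rank_ratio (rank_of ZF (H \<inter> K) - 1) (rank_of ZF K - 1) \<le> of_nat (card TL) * restricted_inertia Fn P"
  proof (rule rank_ratio_upper[OF F_inertia_ge_1 le l])
    show "rank_of ZF (H \<inter> K) - 1 \<le> rank_of Zm (vertical K) + card TL * (rank_of Fn ?U - 1)"
      using intersection_rank_upper(2)[OF H(1) K(1,3) TL U1] by simp
    show "rank_of Zm (vertical K) + (rank_of Fn (snd ` K) - 1) \<le> rank_of ZF K - 1"
      using rank_product_ge[OF K(1,2)] K1 by simp
  qed
qed

text \<open>The common core of both cases. For finite index \<open>M\<close> is trivial and
  \<open>L\<close> is the vertical part of \<open>H\<close>, so that no vertical rank is added to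
  \<open>K\<close>; for infinite index \<open>M = L\<close> is a lattice of large finite index, at
  the price of at most \<open>m\<close> in the rank of \<open>K\<close>.\<close>

lemma exists_test:
  assumes L: "subgroup L Zm" "vertical H \<subseteq> L" and M: "subgroup M Zm" "M \<subseteq> L"
    and LM: "\<And>x. x \<in> L \<Longrightarrow> \<exists>p \<in> vertical H. \<exists>q \<in> M. x = p \<otimes>\<^bsub>Zm\<^esub> q"
    and TL: "transversal Zm L (carrier Zm) TL" "finite TL"
    and S: "free_set Fn S" "finite S" and inf: "\<not> finite_index Fn (P \<inter> generate Fn S) P"
    and w: "w \<in> P" "w \<in> generate Fn S" "w \<notin> DF"
  shows "\<exists>K \<in> G_tests. rank_of ZF K \<le> rank_of Zm M + card S + (m + 1) \<and>
    card TL * (rank_of Fn (P \<inter> generate Fn S) + (m + 1)) + 1 \<le> rank_of ZF (H \<inter> K) + card TL"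
proof -
  have "w \<noteq> []" using w(3) one_in_derived by (auto simp: F_one)
  then obtain W where W: "W \<subseteq> P" "finite W" "card W = m + 1" "S \<inter> W = {}" "free_set Fn (S \<union> W)"
    "\<not> finite_index Fn (P \<inter> generate Fn (S \<union> W)) P"
    using exists_free_extension[OF S P_sub _ inf w(1,2), of "m + 1"] P_noncyclic by blast
  obtain K where K: "subgroup K ZF" "fg ZF K" "fg ZF (H \<inter> K)" "snd ` K = generate Fn (S \<union> W)"
    "rank_of ZF K \<le> rank_of Zm M + card S + (m + 1)"
    "card TL * (rank_of Fn (P \<inter> generate Fn S) + (m + 1)) + 1 \<le> rank_of ZF (H \<inter> K) + card TL"
    using exists_twisted_subgroup[OF H L M LM TL S(2) W(2,3,1,4,5)] by metis
  have "w \<in> generate Fn (S \<union> W)" using w(2) F.mono_generate[of S "S \<union> W"] by blast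
  then have "\<not> P \<inter> snd ` K \<subseteq> DF" using w(1,3) K(4) by auto
  then have "K \<in> G_tests" using K(1-4) W(6) by (simp add: G_tests_def)
  then show ?thesis using K(5,6) by blast
qed

lemma inertia_lower:
  assumes TL: "transversal Zm (vertical H) (carrier Zm) TL" "finite TL"
  shows "of_nat (card TL) * restricted_inertia Fn P \<le> restricted_inertia ZF H"
proof -
  let ?l = "card TL"
  have "of_nat ?l * rank_ratio (rank_of Fn (P \<inter> K) - 1) (rank_of Fn K - 1) \<le> restricted_inertia ZF H"
    if "K \<in> F_tests" for K
  proof -
    have K: "subgroup K Fn" "fg Fn K" "fg Fn (P \<inter> K)" "\<not> finite_index Fn (P \<inter> K) P" "\<not> P \<inter> K \<subseteq> DF"
      using that by (auto simp: F_tests_def)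
    have PK: "subgroup (P \<inter> K) Fn" using F.subgroups_Inter_pair[OF P_sub K(1)] .
    obtain w where w: "w \<in> P" "w \<in> K" "w \<notin> DF" using K(5) by blast
    have wc: "w \<in> carrier Fn" using w P_sub subgroup.mem_carrier by metis
    have w1: "w \<noteq> \<one>\<^bsub>Fn\<^esub>" using w one_in_derived by blast
    obtain \<phi> where \<phi>: "additive_on Fn (carrier Fn) \<phi>" "\<phi> w \<noteq> 0"
      using exists_additive_notin_derived[OF wc w(3)] by blast
    have Kc: "K \<subseteq> carrier Fn" "P \<inter> K \<subseteq> carrier Fn" using K(1) PK subgroup.subset by blast+
    have \<phi>K: "additive_on Fn K \<phi>" "additive_on Fn (P \<inter> K) \<phi>"
      using additive_on_subset[OF \<phi>(1)] Kc by auto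
    define e where "e = nat \<bar>\<phi> w\<bar>"
    have e: "e \<ge> 1" using \<phi>(2) by (simp add: e_def)
    let ?a = "rank_of Fn (P \<inter> K) - 1" and ?b = "rank_of Fn K - 1"
    have rK: "rank_of Fn K = Suc ?b" using rank_pos[OF K(1,2) w(2) w1] by simp
    have rPK: "rank_of Fn (P \<inter> K) = Suc ?a" using rank_pos[OF PK K(3) _ w1] w by simp
    have "of_nat (?l * ((1 + e * k) * ?a + (m + 1))) / of_nat ((1 + e * k) * ?b + (m + 1)) \<le> restricted_inertia ZF H" for k
    proof -
      \<comment> \<open>A common divisor of \<open>d\<close> and \<open>\<phi> w\<close> also
        divides \<open>e * k\<close>, hence 1; so every \<open>k\<close> gives an admissible
        index.\<close>
      define d where "d = 1 + e * k"
      have d: "d > 0" by (simp add: d_def)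
      have cop: "coprime (\<phi> w) (int d)"
      proof (rule coprimeI)
        fix c assume c: "c dvd \<phi> w" "c dvd int d"
        have "int d = 1 + \<bar>\<phi> w\<bar> * int k" by (simp add: d_def e_def)
        moreover have "c dvd \<bar>\<phi> w\<bar> * int k" using c(1) by simp
        ultimately show "is_unit c" using c(2) by (metis dvd_add_left_iff)
      qed
      let ?Kd = "{x \<in> K. int d dvd \<phi> x}" and ?Md = "{x \<in> P \<inter> K. int d dvd \<phi> x}"
      note Kd = F.index_of_multiples[OF K(1) \<phi>K(1) w(2) cop d]
      have wPK: "w \<in> P \<inter> K" using w by blast
      note Md = F.index_of_multiples[OF PK \<phi>K(2) wPK cop d]
      obtain T where T: "transversal Fn ?Kd K T" "finite T" "card T = d" using Kd(2) by blast
      obtain T' where T': "transversal Fn ?Md (P \<inter> K) T'" "finite T'" "card T' = d" using Md(2) by blast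
      have KL: "K \<subseteq> generate Fn (letters n)" "P \<inter> K \<subseteq> generate Fn (letters n)"
        using Kc generate_letters by auto
      have subK: "?Kd \<subseteq> K" "?Md \<subseteq> P \<inter> K" by auto
      have fgKd: "fg Fn ?Kd" and rKd0: "rank_of Fn ?Kd + d = d * rank_of Fn K + 1"
        using F.finite_index_subgroup[OF free_set_letters K(1) KL(1) K(2) Kd(1) subK(1) T(1,2)] T(3) by auto
      have "d * rank_of Fn K = d * ?b + d" by (subst rK) simp
      then have rKd: "rank_of Fn ?Kd = d * ?b + 1" using rKd0 by linarith
      have "rank_of Fn ?Md + d = d * rank_of Fn (P \<inter> K) + 1"
        using F.finite_index_subgroup(2)[OF free_set_letters PK KL(2) K(3) Md(1) subK(2) T'(1,2)] T'(3) by simp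
      moreover have "d * rank_of Fn (P \<inter> K) = d * ?a + d" by (subst rPK) simp
      ultimately have rMd: "rank_of Fn ?Md = d * ?a + 1" by linarith
      obtain S where S: "free_set Fn S" "finite S" "generate Fn S = ?Kd" "card S = rank_of Fn ?Kd"
        using F_free_basis[OF Kd(1) fgKd] .
      have PS: "P \<inter> generate Fn S = ?Md" using S(3) by auto
      have inf: "\<not> finite_index Fn (P \<inter> generate Fn S) P"
        using K(4) finite_index_mono[of Fn ?Md P "P \<inter> K"] PS by auto
      \<comment> \<open>\<open>w\<close> itself may lie outside \<open>?Kd\<close>. Its
        \<open>d\<close>-th power lies inside, and \<open>\<phi>\<close> does not vanish on it, so
        it is still outside the derived subgroup.\<close>
      let ?v = "w [^]\<^bsub>Fn\<^esub> (int d)"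
      have \<phi>v: "\<phi> ?v = int d * \<phi> w" using F.additive_on_pow[OF \<phi>(1) F.subgroup_self wc] .
      have v: "?v \<in> P" "?v \<in> K"
        using F.subgroup_int_pow_closed P_sub K(1) w by blast+
      then have vS: "?v \<in> generate Fn S" using S(3) \<phi>v by simp
      have "\<phi> ?v \<noteq> 0" using \<phi>v \<phi>(2) d by simp
      then have vD: "?v \<notin> DF" using F.additive_on_derived[OF \<phi>(1)] by blast
      have vH: "subgroup (vertical H) Zm" using subgroup_vertical[OF H(1)] .
      have triv: "subgroup {\<one>\<^bsub>Zm\<^esub>} Zm" by (rule Z.triv_subgroup)
      have r0: "rank_of Zm {\<one>\<^bsub>Zm\<^esub>} = 0" using Z.rank_of_le[of "{}"] Z.generate_empty by simp
      have split: "\<exists>p \<in> vertical H. \<exists>q \<in> {\<one>\<^bsub>Zm\<^esub>}. x = p \<otimes>\<^bsub>Zm\<^esub> q" if "x \<in> vertical H" for x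
        by (rule bexI[of _ x], rule bexI[of _ "\<one>\<^bsub>Zm\<^esub>"])
          (use that subgroup.mem_carrier[OF vH that] in simp_all)
      have "\<exists>K' \<in> G_tests. rank_of ZF K' \<le> rank_of Zm {\<one>\<^bsub>Zm\<^esub>} + card S + (m + 1) \<and>
          ?l * (rank_of Fn (P \<inter> generate Fn S) + (m + 1)) + 1 \<le> rank_of ZF (H \<inter> K') + ?l"
        by (rule exists_test[OF vH subset_refl triv _ split TL S(1,2) inf v(1) vS vD])
          (use subgroup.one_closed[OF vH] in simp)
      then obtain K' where K': "K' \<in> G_tests" "rank_of ZF K' \<le> card S + (m + 1)"
          "?l * (rank_of Fn ?Md + (m + 1)) + 1 \<le> rank_of ZF (H \<inter> K') + ?l"
        using PS r0 by auto
      have "TL \<noteq> {}" using TL(1) Z.one_closed unfolding transversal_def by blast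
      then have l: "?l \<ge> 1" using TL(2) by (simp add: Suc_leI card_gt_0_iff)
      have "of_nat (?l * (d * ?a + (m + 1))) / of_nat (d * ?b + (m + 1))
          \<le> rank_ratio (rank_of ZF (H \<inter> K') - 1) (rank_of ZF K' - 1)"
      proof (rule ratio_le_rank_ratio)
        have "?l * (rank_of Fn ?Md + (m + 1)) = ?l * (d * ?a + (m + 1)) + ?l"
          unfolding rMd by (simp add: algebra_simps)
        then show "?l * (d * ?a + (m + 1)) \<le> rank_of ZF (H \<inter> K') - 1" using K'(3) by linarith
        show "rank_of ZF K' - 1 \<le> d * ?b + (m + 1)" using K'(2) S(4) rKd by linarith
        show "0 < ?l * (d * ?a + (m + 1))" using l by simp
      qed
      also have "\<dots> \<le> restricted_inertia ZF H" unfolding inertia_G using K'(1) by (rule SUP_upper)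
      finally show ?thesis by (simp only: d_def)
    qed
    then show ?thesis using e by (rule rank_ratio_limit) simp
  qed
  then show ?thesis unfolding inertia_F SUP_mult_left_ennreal by (rule SUP_least)
qed

text \<open>An additive map \<open>h\<close> that is nonzero but kills the vertical part of
  \<open>H\<close> provides the lattices: those \<open>x\<close> with \<open>d\<close> dividing
  \<open>h x\<close>. A cyclic group \<open>generate Fn {u}\<close> is enough as starting test
  subgroup, because the denominator only has to stay bounded while the numerator grows with
  \<open>d\<close>.\<close>

lemma inertia_infinite:
  assumes inf: "\<not> finite_index Zm (vertical H) (carrier Zm)"
  shows "restricted_inertia ZF H = \<infinity>"
proof -
  have vH: "subgroup (vertical H) Zm" using subgroup_vertical[OF H(1)] .
  obtain E where E: "E \<subseteq> carrier Zm" "finite E" "generate Zm E = carrier Zm"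
    using Z_basis[OF Z.subgroup_self] by metis
  have HE: "vertical H \<union> E \<subseteq> carrier Zm" using subgroup.subset[OF vH] E(1) by blast
  have "generate Zm (vertical H \<union> E) = carrier Zm"
    using Z.mono_generate[of E "vertical H \<union> E"] E(3) Z.generate_incl[OF HE] by blast
  then obtain h x0 where h: "additive_on Zm (carrier Zm) h" "\<And>x. x \<in> vertical H \<Longrightarrow> h x = 0"
    and x0: "x0 \<in> carrier Zm" "h x0 \<noteq> 0"
    using Z.finite_index_or_additive[OF vH E(2,1)] inf by auto
  define e where "e = nat \<bar>h x0\<bar>"
  have e: "e \<ge> 1" using x0(2) by (simp add: e_def)
  obtain u where u: "u \<in> P" "u \<notin> DF" using der by blast
  have uc: "u \<in> carrier Fn" using u P_sub subgroup.mem_carrier by metis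
  let ?Q = "generate Fn {u}"
  have Q: "subgroup ?Q Fn" "fg Fn ?Q" using F.generate_is_subgroup[of "{u}"] F.fgI[of "{u}"] uc by auto
  obtain S where S: "free_set Fn S" "finite S" "generate Fn S = ?Q" "card S = rank_of Fn ?Q"
    using F_free_basis[OF Q] .
  have cS: "card S \<le> 1" using S(4) F.rank_of_le[of "{u}" ?Q] uc by simp
  have PQ: "P \<inter> ?Q = ?Q" using F.generate_subgroup_incl[OF _ P_sub, of "{u}"] u(1) by auto
  have uQ: "u \<in> ?Q" by (rule generate.incl) simp
  have infS: "\<not> finite_index Fn (P \<inter> generate Fn S) P" using P_index[OF u(1)] S(3) PQ by simp
  \<comment> \<open>The denominator collects at most \<open>m\<close> from the lattice, 1 from
    \<open>S\<close> and \<open>m + 1\<close> from the new free factors, less 1 for the reduced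
    rank.\<close>
  have "of_nat (1 + e * k) / of_nat (2 * m + 1) \<le> restricted_inertia ZF H" for k
  proof -
    define d where "d = 1 + e * k"
    have d: "d > 0" by (simp add: d_def)
    have cop: "coprime (h x0) (int d)"
    proof (rule coprimeI)
      fix c assume c: "c dvd h x0" "c dvd int d"
      have "int d = 1 + \<bar>h x0\<bar> * int k" by (simp add: d_def e_def)
      moreover have "c dvd \<bar>h x0\<bar> * int k" using c(1) by simp
      ultimately show "is_unit c" using c(2) by (metis dvd_add_left_iff)
    qed
    let ?L = "{x \<in> carrier Zm. int d dvd h x}"
    note L = Z.index_of_multiples[OF Z.subgroup_self h(1) x0(1) cop d]
    obtain TL where TL: "transversal Zm ?L (carrier Zm) TL" "finite TL" "card TL = d" using L(2) by blast
    have vL: "vertical H \<subseteq> ?L" using h(2) subgroup.subset[OF vH] by auto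
    have split: "\<exists>p \<in> vertical H. \<exists>q \<in> ?L. x = p \<otimes>\<^bsub>Zm\<^esub> q" if "x \<in> ?L" for x
      by (rule bexI[of _ "\<one>\<^bsub>Zm\<^esub>"], rule bexI[of _ x])
        (use that subgroup.one_closed[OF vH] in simp_all)
    obtain K where K: "K \<in> G_tests" "rank_of ZF K \<le> rank_of Zm ?L + card S + (m + 1)"
      "d * (rank_of Fn (P \<inter> generate Fn S) + (m + 1)) + 1 \<le> rank_of ZF (H \<inter> K) + d"
      using exists_test[OF L(1) vL L(1) subset_refl split TL(1,2) S(1,2) infS u(1) _ u(2)] S(3) uQ TL(3)
      by auto
    have "rank_of Fn ?Q \<ge> 1" using rank_pos[OF Q uQ] u(2) one_in_derived by blast
    then have "d * 1 \<le> d * rank_of Fn (P \<inter> generate Fn S)" using S(3) PQ by (intro mult_left_mono) auto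
    moreover have "d * (rank_of Fn (P \<inter> generate Fn S) + (m + 1)) =
        d * rank_of Fn (P \<inter> generate Fn S) + (d * m + d)" by (simp add: distrib_left)
    ultimately have "d * m + d + 1 \<le> rank_of ZF (H \<inter> K)" using K(3) by linarith
    then have "of_nat d / of_nat (2 * m + 1) \<le> rank_ratio (rank_of ZF (H \<inter> K) - 1) (rank_of ZF K - 1)"
      using K(2) cS Z_rank_le[OF L(1)] d by (intro ratio_le_rank_ratio) auto
    also have "\<dots> \<le> restricted_inertia ZF H" unfolding inertia_G using K(1) by (rule SUP_upper)
    finally show ?thesis by (simp only: d_def)
  qed
  then show ?thesis using e by (rule unbounded_ratio) simp
qed

end

end

text \<open>The theorem measures the index inside the product, with \<open>ZG\<close> as a copy of
  the free abelian group; here it is transported to the free abelian group itself.\<close>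

lemma vertical_index:
  fixes m n :: nat and H :: "((nat \<Rightarrow> int) \<times> letter list) set"
  defines "G \<equiv> Z_power m \<times>\<times> free_group n"
  defines "ZG \<equiv> carrier (Z_power m) \<times> {\<one>\<^bsub>free_group n\<^esub>}"
  assumes H: "subgroup H G"
  shows "subgroup_index (G\<lparr>carrier := ZG\<rparr>) (H \<inter> ZG) = \<infinity> \<Longrightarrow>
      \<not> finite_index (Z_power m) (vertical n H) (carrier (Z_power m))"
    and "subgroup_index (G\<lparr>carrier := ZG\<rparr>) (H \<inter> ZG) = enat l \<Longrightarrow>
      \<exists>T. transversal (Z_power m) (vertical n H) (carrier (Z_power m)) T \<and> finite T \<and> card T = l"
proof -
  interpret Z: comm_group "Z_power m" by (rule comm_group_Z_power)
  interpret F: group "free_group n" by simp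
  interpret G: group G unfolding G_def by (rule DirProd_group) simp_all
  let ?Z = "Z_power m" and ?F = "free_group n"
  let ?i = "\<lambda>x. (x, \<one>\<^bsub>?F\<^esub>)"
  have ZG: "subgroup ZG G"
    by (rule G.subgroupI) (auto simp: ZG_def G_def)
  have HZ: "subgroup (H \<inter> ZG) G" using G.subgroups_Inter_pair[OF H ZG] .
  have ZGc: "ZG \<subseteq> carrier G" using subgroup.subset[OF ZG] .
  have vc: "vertical n H \<subseteq> carrier ?Z"
    using subgroup.subset[OF subgroup_vertical] H unfolding G_def by blast
  have hi: "group_hom ?Z G ?i"
    unfolding group_hom_def group_hom_axioms_def by (auto intro!: homI simp: G_def G.is_group[unfolded G_def] Z.is_group)
  have img: "?i ` vertical n H = H \<inter> ZG" "?i ` carrier ?Z = ZG"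
    using vc by (auto simp: vertical_def ZG_def)
  have mem: "?i x \<otimes>\<^bsub>G\<^esub> inv\<^bsub>G\<^esub> ?i y \<in> H \<inter> ZG \<longleftrightarrow> x \<otimes>\<^bsub>?Z\<^esub> inv\<^bsub>?Z\<^esub> y \<in> vertical n H"
    if "x \<in> carrier ?Z" "y \<in> carrier ?Z" for x y
    using that by (auto simp: G_def vertical_def ZG_def)
  show "\<not> finite_index ?Z (vertical n H) (carrier ?Z)"
    if "subgroup_index (G\<lparr>carrier := ZG\<rparr>) (H \<inter> ZG) = \<infinity>"
  proof
    assume fi: "finite_index ?Z (vertical n H) (carrier ?Z)"
    have "finite_index G (H \<inter> ZG) ZG"
      using group_hom.finite_index_image[OF hi fi subset_refl] img by simp
    then show False using G.subgroup_index_infinite_iff[OF HZ ZGc] that by simp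
  qed
  show "\<exists>T. transversal ?Z (vertical n H) (carrier ?Z) T \<and> finite T \<and> card T = l"
    if l: "subgroup_index (G\<lparr>carrier := ZG\<rparr>) (H \<inter> ZG) = enat l"
  proof -
    obtain T where T: "transversal G (H \<inter> ZG) ZG T" "finite T" "card T = l"
      using G.subgroup_index_transversal[OF HZ ZGc l] .
    have Ti0: "t = ?i (fst t)" if "t \<in> T" for t
      using T(1) that by (auto simp: transversal_def ZG_def)
    from this[symmetric] have Ti: "T = ?i ` fst ` T" unfolding image_image by (metis (no_types, lifting) image_cong image_ident)
    have "transversal ?Z (vertical n H) (carrier ?Z) (fst ` T)"
      unfolding transversal_def
    proof (intro conjI ballI)
      show Tc: "fst ` T \<subseteq> carrier ?Z" using T(1) by (auto simp: transversal_def ZG_def)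
      fix x assume x: "x \<in> carrier ?Z"
      have "\<exists>!t. t \<in> T \<and> ?i x \<otimes>\<^bsub>G\<^esub> inv\<^bsub>G\<^esub> t \<in> H \<inter> ZG"
        using T(1) x by (auto simp: transversal_def ZG_def)
      then obtain t where t: "t \<in> T" "?i x \<otimes>\<^bsub>G\<^esub> inv\<^bsub>G\<^esub> t \<in> H \<inter> ZG"
        and uniq: "\<And>s. s \<in> T \<Longrightarrow> ?i x \<otimes>\<^bsub>G\<^esub> inv\<^bsub>G\<^esub> s \<in> H \<inter> ZG \<Longrightarrow> s = t" by blast
      show "\<exists>!t. t \<in> fst ` T \<and> x \<otimes>\<^bsub>?Z\<^esub> inv\<^bsub>?Z\<^esub> t \<in> vertical n H"
      proof (rule ex1I[of _ "fst t"])
        have "t = ?i (fst t)" using Ti0 t(1) .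
        then show "fst t \<in> fst ` T \<and> x \<otimes>\<^bsub>?Z\<^esub> inv\<^bsub>?Z\<^esub> fst t \<in> vertical n H"
          using t mem[OF x, of "fst t"] Tc by (metis imageI subsetD)
        fix y assume y: "y \<in> fst ` T \<and> x \<otimes>\<^bsub>?Z\<^esub> inv\<^bsub>?Z\<^esub> y \<in> vertical n H"
        then have "?i y \<in> T" using Ti by blast
        moreover have "?i x \<otimes>\<^bsub>G\<^esub> inv\<^bsub>G\<^esub> ?i y \<in> H \<inter> ZG" using mem[OF x, of y] y Tc by blast
        ultimately show "y = fst t" using uniq by force
      qed
    qed
    moreover have "inj_on fst T"
    proof (rule inj_onI)
      fix s t assume "s \<in> T" "t \<in> T" "fst s = fst t"
      then show "s = t" using Ti0[of s] Ti0[of t] by simp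
    qed
    then have "card (fst ` T) = l" using T(3) by (simp add: card_image)
    ultimately show ?thesis using T(2) by blast
  qed
qed

theorem theorem1p15:
  fixes m n :: nat and H :: "((nat \<Rightarrow> int) \<times> letter list) set"
  defines "G \<equiv> Z_power m \<times>\<times> free_group n"
  defines "ZG \<equiv> carrier (Z_power m) \<times> {\<one>\<^bsub>free_group n\<^esub>}"
  assumes "subgroup H G"
    and "finitely_generated (G\<lparr>carrier := H\<rparr>)"
    and "\<not> cyclic_group ((free_group n)\<lparr>carrier := snd ` H\<rparr>)"
    and "\<not> snd ` H \<subseteq> derived (free_group n) (carrier (free_group n))"
  shows
    "(subgroup_index (G\<lparr>carrier := ZG\<rparr>) (H \<inter> ZG) = \<infinity> \<longrightarrow> restricted_inertia G H = \<infinity>) \<and>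
     (\<forall>l. subgroup_index (G\<lparr>carrier := ZG\<rparr>) (H \<inter> ZG) = enat l \<longrightarrow>
        restricted_inertia G H = of_nat l * restricted_inertia (free_group n) (snd ` H))"
proof (intro conjI allI impI)
  note H = assms(3-)[unfolded G_def]
  show "restricted_inertia G H = \<infinity>" if "subgroup_index (G\<lparr>carrier := ZG\<rparr>) (H \<inter> ZG) = \<infinity>"
    using inertia_infinite[OF H vertical_index(1)[OF H(1)]] that unfolding G_def ZG_def by blast
  show "restricted_inertia G H = of_nat l * restricted_inertia (free_group n) (snd ` H)"
    if l: "subgroup_index (G\<lparr>carrier := ZG\<rparr>) (H \<inter> ZG) = enat l" for l
  proof -
    obtain T where T: "transversal (Z_power m) (vertical n H) (carrier (Z_power m)) T" "finite T" "card T = l"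
      using vertical_index(2)[OF H(1)] l unfolding G_def ZG_def by blast
    show ?thesis
      using inertia_upper[OF H T(1,2)] inertia_lower[OF H T(1,2)] T(3) unfolding G_def by simp
  qed
qed

end
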